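(* Let $K$ be a compact Hausdorff space. If $f\in\mathcal{H}_b(C(K))$ is orthogonally additive, then $f$ is integral; that is, writing $E=C(K)$, there is a regular (complex) Borel measure $\nu$ on $B_{E'}$ such that $$f(x)=\int_{B_{E'}}\frac{1}{1-\gamma(x)}\,d\nu(\gamma)\quad\text{for all } x\in E \text{ with } \|x\|<1.$$
   Context: $C(K)$ is the Banach algebra of complex-valued continuous functions on $K$ with the supremum norm. $\mathcal{H}_b(C(K))$ is the space of holomorphic functions $f\colon C(K)\to\mathbb{C}$ that are bounded on every bounded subset of $C(K)$. A function $f\colon C(K)\to\mathbb{C}$ is orthogonally additive if $f(x+y)=f(x)+f(y)$ whenever $x,y\in C(K)$ satisfy $xy=0$ on $K$. For a Banach space $E$, $E'$ is its dual and $B_{E'}$ the closed unit ball of $E'$ endowed with the weak$^*$ topology (a compact space). A holomorphic function on the open unit ball of $E$ is called integral if it has a representation of the displayed form; for a function $f$ defined on all of $E$, being integral refers to its restriction to the open unit ball. *)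

theory Defs
  imports "HOL-Analysis.Analysis"
begin

class complex_normed_vector = real_normed_vector +
  fixes scaleC :: "complex \<Rightarrow> 'a \<Rightarrow> 'a" (infixr \<open>*\<^sub>C\<close> 75)
  assumes scaleC_add_right: "c *\<^sub>C (x + y) = c *\<^sub>C x + c *\<^sub>C y"
    and scaleC_add_left: "(c + d) *\<^sub>C x = c *\<^sub>C x + d *\<^sub>C x"
    and scaleC_scaleC: "c *\<^sub>C d *\<^sub>C x = (c * d) *\<^sub>C x"
    and scaleC_of_real: "complex_of_real r *\<^sub>C x = r *\<^sub>R x"
    and norm_scaleC: "norm (c *\<^sub>C x) = cmod c * norm x"

instantiation complex :: complex_normed_vector
begin

definition scaleC_complex :: "complex \<Rightarrow> complex \<Rightarrow> complex"
  where "scaleC_complex c z = c * z"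

instance
  by standard (auto simp: scaleC_complex_def algebra_simps scaleR_conv_of_real norm_mult)

end

lemma continuous_on_scaleC_right:
  fixes c :: complex
  shows "continuous_on UNIV (\<lambda>x :: 'a :: complex_normed_vector. c *\<^sub>C x)"
proof -
  have "bounded_linear (\<lambda>x :: 'a. c *\<^sub>C x)"
  proof (rule bounded_linear_intro[where K = "cmod c"])
    fix r :: real and x :: 'a
    have "c *\<^sub>C r *\<^sub>R x = (c * of_real r) *\<^sub>C x"
      by (simp add: scaleC_scaleC flip: scaleC_of_real)
    also have "\<dots> = r *\<^sub>R c *\<^sub>C x"
      by (metis mult.commute scaleC_of_real scaleC_scaleC)
    finally show "c *\<^sub>C r *\<^sub>R x = r *\<^sub>R c *\<^sub>C x" .
  qed (simp_all add: scaleC_add_right norm_scaleC mult.commute)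
  then show ?thesis
    using linear_continuous_on by blast
qed

lemma scaleC_bcontfun_mem:
  fixes f :: "'a :: topological_space \<Rightarrow>\<^sub>C 'b :: complex_normed_vector"
  shows "(\<lambda>t. c *\<^sub>C apply_bcontfun f t) \<in> bcontfun"
proof (rule bcontfun_normI)
  show "continuous_on UNIV (\<lambda>t. c *\<^sub>C apply_bcontfun f t)"
    by (rule continuous_on_compose2[OF continuous_on_scaleC_right]) auto
  show "norm (c *\<^sub>C apply_bcontfun f t) \<le> cmod c * norm f" for t
    by (simp add: norm_scaleC norm_bounded mult_left_mono)
qed

text \<open>For a compact space \<open>K\<close>, realised as a type \<open>'k\<close>, every continuous function on \<open>K\<close> is bounded,
  so the type \<open>'k \<Rightarrow>\<^sub>C complex\<close> of bounded continuous functions is \<open>C(K)\<close>; its library norm is the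
  supremum norm.\<close>

instantiation bcontfun :: (topological_space, complex_normed_vector) complex_normed_vector
begin

definition scaleC_bcontfun :: "complex \<Rightarrow> ('a \<Rightarrow>\<^sub>C 'b) \<Rightarrow> 'a \<Rightarrow>\<^sub>C 'b" where
  "scaleC_bcontfun c f = Bcontfun (\<lambda>t. c *\<^sub>C apply_bcontfun f t)"

lemma apply_bcontfun_scaleC: "apply_bcontfun (c *\<^sub>C f) t = c *\<^sub>C apply_bcontfun f t"
  for f :: "'a \<Rightarrow>\<^sub>C 'b"
  by (simp add: scaleC_bcontfun_def Bcontfun_inverse[OF scaleC_bcontfun_mem])

instance
proof
  fix c d :: complex and r :: real and x y :: "'a \<Rightarrow>\<^sub>C 'b"
  show "c *\<^sub>C (x + y) = c *\<^sub>C x + c *\<^sub>C y"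
    by (rule bcontfun_eqI) (simp add: apply_bcontfun_scaleC scaleC_add_right)
  show "(c + d) *\<^sub>C x = c *\<^sub>C x + d *\<^sub>C x"
    by (rule bcontfun_eqI) (simp add: apply_bcontfun_scaleC scaleC_add_left)
  show *: "c *\<^sub>C d *\<^sub>C x = (c * d) *\<^sub>C x" for c d and x :: "'a \<Rightarrow>\<^sub>C 'b"
    by (rule bcontfun_eqI) (simp add: apply_bcontfun_scaleC scaleC_scaleC)
  show r: "complex_of_real r *\<^sub>C x = r *\<^sub>R x" for r and x :: "'a \<Rightarrow>\<^sub>C 'b"
    by (rule bcontfun_eqI) (simp add: apply_bcontfun_scaleC scaleC_of_real)
  have le: "norm (c *\<^sub>C x) \<le> cmod c * norm x" for c and x :: "'a \<Rightarrow>\<^sub>C 'b"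
    by (rule norm_bound)
      (simp add: apply_bcontfun_scaleC norm_scaleC norm_bounded mult_left_mono)
  show "norm (c *\<^sub>C x) = cmod c * norm x"
  proof (cases "c = 0")
    case True
    then show ?thesis
      using r[of 0 x] by simp
  next
    case False
    have "x = inverse c *\<^sub>C c *\<^sub>C x"
      using False r[of 1 x] by (simp add: *)
    then have "norm x \<le> inverse (cmod c) * norm (c *\<^sub>C x)"
      using le[of "inverse c" "c *\<^sub>C x"] by (simp add: norm_inverse)
    then have "cmod c * norm x \<le> norm (c *\<^sub>C x)"
      using False by (simp add: field_simps)
    then show ?thesis
      using le[of c x] by simp
  qed
qed

end

definition bounded_clinear :: "('e :: complex_normed_vector \<Rightarrow> complex) \<Rightarrow> bool" where
  "bounded_clinear \<gamma> \<longleftrightarrow> bounded_linear \<gamma> \<and> (\<forall>c x. \<gamma> (c *\<^sub>C x) = c * \<gamma> x)"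

text \<open>Holomorphy on an open set \<open>U\<close> is complex Frechet differentiability at every point of \<open>U\<close>.\<close>

definition holomorphic_fun_on ::
    "('e :: complex_normed_vector \<Rightarrow> complex) \<Rightarrow> 'e set \<Rightarrow> bool" where
  "holomorphic_fun_on f U \<longleftrightarrow>
     (\<forall>x\<in>U. \<exists>D. bounded_clinear D \<and> (f has_derivative D) (at x))"

definition holomorphic_bounded_type :: "('e :: complex_normed_vector \<Rightarrow> complex) set" where
  "holomorphic_bounded_type =
     {f. holomorphic_fun_on f UNIV \<and> (\<forall>B. bounded B \<longrightarrow> bounded (f ` B))}"

definition orthogonally_additive ::
    "(('k :: topological_space \<Rightarrow>\<^sub>C complex) \<Rightarrow> complex) \<Rightarrow> bool" where
  "orthogonally_additive f \<longleftrightarrow>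
     (\<forall>x y. (\<forall>t. apply_bcontfun x t * apply_bcontfun y t = 0) \<longrightarrow> f (x + y) = f x + f y)"

definition dual_unit_ball :: "('e :: complex_normed_vector \<Rightarrow> complex) set" where
  "dual_unit_ball = {\<gamma>. bounded_clinear \<gamma> \<and> onorm \<gamma> \<le> 1}"

text \<open>The weak* topology on the ball: the coarsest one making all evaluations continuous.\<close>

definition weak_star_ball :: "('e :: complex_normed_vector \<Rightarrow> complex) topology" where
  "weak_star_ball =
     topology_generated_by {{\<gamma> \<in> dual_unit_ball. \<gamma> x \<in> V} | x V. open V}"

definition borel_of :: "'a topology \<Rightarrow> 'a measure" where
  "borel_of T = sigma (topspace T) {U. openin T U}"

text \<open>Complex measures are countably additive complex set functions on a \<open>\<sigma>\<close>-algebra. Below, a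
  measure \<open>M\<close> only serves to carry the measurable space.\<close>

definition complex_measure :: "'a measure \<Rightarrow> ('a set \<Rightarrow> complex) \<Rightarrow> bool" where
  "complex_measure M \<nu> \<longleftrightarrow>
     (\<forall>A :: nat \<Rightarrow> 'a set. range A \<subseteq> sets M \<longrightarrow> disjoint_family A \<longrightarrow>
        (\<lambda>n. \<nu> (A n)) sums \<nu> (\<Union>n. A n))"

definition total_variation :: "'a measure \<Rightarrow> ('a set \<Rightarrow> complex) \<Rightarrow> 'a set \<Rightarrow> ennreal" where
  "total_variation M \<nu> A =
     (SUP P \<in> {P :: nat \<Rightarrow> 'a set. range P \<subseteq> sets M \<and> disjoint_family P \<and> (\<Union>n. P n) = A}.
        \<Sum>n. ennreal (cmod (\<nu> (P n))))"

definition regular_complex_borel_measure :: "'a topology \<Rightarrow> ('a set \<Rightarrow> complex) \<Rightarrow> bool" where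
  "regular_complex_borel_measure T \<nu> \<longleftrightarrow>
     complex_measure (borel_of T) \<nu> \<and>
     (\<forall>A \<in> sets (borel_of T).
        total_variation (borel_of T) \<nu> A
          = (INF U \<in> {U. openin T U \<and> A \<subseteq> U}. total_variation (borel_of T) \<nu> U) \<and>
        total_variation (borel_of T) \<nu> A
          = (SUP C \<in> {C. compactin T C \<and> C \<subseteq> A}. total_variation (borel_of T) \<nu> C))"

text \<open>The positive part \<open>\<mu>\<^sup>+(A) = sup {\<mu>(B) | B \<subseteq> A measurable}\<close> in the Jordan decomposition of a
  finite signed measure \<open>\<mu>\<close>; the negative part is the positive part of \<open>-\<mu>\<close>. Note that
  \<^const>\<open>ennreal\<close> maps negative numbers to \<open>0\<close>, which is harmless as \<open>B = {}\<close> is admitted.\<close>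

definition positive_part :: "'a measure \<Rightarrow> ('a set \<Rightarrow> real) \<Rightarrow> 'a measure" where
  "positive_part M \<mu> =
     measure_of (space M) (sets M) (\<lambda>A. SUP B \<in> {B \<in> sets M. B \<subseteq> A}. ennreal (\<mu> B))"

definition signed_integral ::
    "'a measure \<Rightarrow> ('a set \<Rightarrow> real) \<Rightarrow> ('a \<Rightarrow> complex) \<Rightarrow> complex" where
  "signed_integral M \<mu> g =
     integral\<^sup>L (positive_part M \<mu>) g - integral\<^sup>L (positive_part M (\<lambda>A. - \<mu> A)) g"

definition complex_measure_integral ::
    "'a measure \<Rightarrow> ('a set \<Rightarrow> complex) \<Rightarrow> ('a \<Rightarrow> complex) \<Rightarrow> complex" where
  "complex_measure_integral M \<nu> g =
     signed_integral M (\<lambda>A. Re (\<nu> A)) g + \<i> * signed_integral M (\<lambda>A. Im (\<nu> A)) g"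

text \<open>Integrality only concerns the restriction of \<open>f\<close> to the open unit ball. For \<open>norm x < 1\<close> the
  integrand is continuous and bounded, so the integrals below are genuine.\<close>

definition integral_holomorphic :: "('e :: complex_normed_vector \<Rightarrow> complex) \<Rightarrow> bool" where
  "integral_holomorphic f \<longleftrightarrow>
     holomorphic_fun_on f (ball 0 1) \<and>
     (\<exists>\<nu>. regular_complex_borel_measure weak_star_ball \<nu> \<and>
        (\<forall>x. norm x < 1 \<longrightarrow>
           f x = complex_measure_integral (borel_of weak_star_ball) \<nu> (\<lambda>\<gamma>. 1 / (1 - \<gamma> x))))"

end

theory Submission
  imports Defs "HOL-Complex_Analysis.Complex_Analysis"
begin

text \<open>
  Let \<open>E = C(K)\<close> and let \<open>F(w)\<close> be the continuous linear functional on \<open>E\<close> obtained by integrating the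
  derivative of \<open>f\<close> at the constant functions from \<open>0\<close> to \<open>w\<close>. Suppose for a moment that \<open>x\<close> is a
  simple function with values \<open>a\<^sub>i\<close> on disjoint open and closed sets \<open>A\<^sub>i\<close>. By orthogonal additivity \<open>f(x)\<close>
  is the sum of the numbers \<open>f(a\<^sub>i 1\<^sub>A\<^sub>i) = F(a\<^sub>i)(1\<^sub>A\<^sub>i)\<close>, and Cauchy's formula over the unit circle rewrites it
  as the average over \<open>|\<omega>| = 1\<close> of \<open>F(\<omega>)\<close> applied to \<open>1 / (1 - \<omega>\<^sup>-\<^sup>1 x)\<close>. The value of this function at \<open>t\<close>
  is \<open>1 / (1 - \<gamma>(x))\<close> for the functional \<open>\<gamma> = \<omega>\<^sup>-\<^sup>1 \<delta>\<^sub>t\<close>. So the candidate for the right-hand side is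
  \<open>h(x) = \<Lambda>(1 / (1 - \<gamma>(x)))\<close>, where \<open>\<Lambda>(\<phi>)\<close> is the average of \<open>F(\<omega>)(t \<mapsto> \<phi>(\<omega>\<^sup>-\<^sup>1 \<delta>\<^sub>t))\<close>. This \<open>\<Lambda>\<close> is a bounded
  functional on the continuous functions on the dual ball, which is compact by the Banach--Alaoglu theorem,
  and the Riesz theorem (\<open>riesz_representation\<close>) supplies the regular measure.

  It remains to show that the defect \<open>f - h\<close> vanishes on the open unit ball, for a space \<open>K\<close> that may be
  connected. The substitute for cutting \<open>x\<close> into pieces is \<open>locality\<close>: if \<open>uv = 0\<close> then
  \<open>f(x + u + v) + f(x) = f(x + u) + f(x + v)\<close> for every \<open>x\<close>. This is plain orthogonal additivity when \<open>x\<close>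
  vanishes on a set that separates \<open>u\<close> from \<open>v\<close>. In general, \<open>x\<close> is multiplied by independent complex factors
  in \<open>N\<close> disjoint layers between \<open>u\<close> and \<open>v\<close>; the mixed difference is holomorphic in these factors, bounded
  independently of \<open>N\<close>, and zero if one factor is zero, so Schwarz's lemma makes it \<open>O(2\<^sup>-\<^sup>N)\<close>.

  The function \<open>h\<close> is local as well, and by Cauchy's formula it has the same derivatives as \<open>f\<close> at the constants of
  modulus less than \<open>1\<close>. A real-valued \<open>x\<close> is built up in \<open>N\<close> thin horizontal layers. By locality each layer acts
  as if it were added to a constant function, where the defect is flat to second order, so the total
  change is \<open>O(1/N)\<close> and the defect vanishes at \<open>x\<close> (\<open>defect_constant_real\<close>). The identity theorem along
  \<open>z \<mapsto> Re x + z Im x\<close> extends this to complex-valued \<open>x\<close> (\<open>defect_zero\<close>).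
\<close>

section \<open>The Riesz theorem for positive functionals on a compact space\<close>

lemma continuous_map_compact_bounded:
  fixes g :: "'a \<Rightarrow> 'b :: real_normed_vector"
  assumes "compact_space X" "continuous_map X euclidean g"
  shows "\<exists>B>0. \<forall>x\<in>topspace X. norm (g x) \<le> B"
proof -
  have "compactin euclidean (g ` topspace X)"
    using image_compactin assms unfolding compact_space_def by blast
  then have "bounded (g ` topspace X)"
    by (simp add: compact_imp_bounded)
  then show ?thesis
    by (auto simp: bounded_pos)
qed

lemma sum_unit_slices: "0 \<le> y \<Longrightarrow> (\<Sum>j<n. max 0 (min 1 (y - real j))) = min y (real n)"
  by (induction n) auto

text \<open>Positive functionals are given on the cone of nonnegative functions, because the variation of a
  complex functional, to which the construction is applied, is defined there by a supremum.\<close>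

definition nonneg_continuous :: "'a topology \<Rightarrow> ('a \<Rightarrow> real) set" where
  "nonneg_continuous X = {\<phi>. continuous_map X euclideanreal \<phi> \<and> (\<forall>x\<in>topspace X. 0 \<le> \<phi> x)}"

locale positive_functional =
  fixes X :: "'a topology" and p :: "('a \<Rightarrow> real) \<Rightarrow> real"
  assumes compact: "compact_space X" and hausdorff: "Hausdorff_space X"
    and nonneg: "\<phi> \<in> nonneg_continuous X \<Longrightarrow> 0 \<le> p \<phi>"
    and add: "\<phi> \<in> nonneg_continuous X \<Longrightarrow> \<psi> \<in> nonneg_continuous X
      \<Longrightarrow> p (\<lambda>x. \<phi> x + \<psi> x) = p \<phi> + p \<psi>"
    and scale: "\<phi> \<in> nonneg_continuous X \<Longrightarrow> 0 \<le> c \<Longrightarrow> p (\<lambda>x. c * \<phi> x) = c * p \<phi>"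
begin

definition tests :: "'a set \<Rightarrow> ('a \<Rightarrow> real) set" where
  "tests U = {\<phi> \<in> nonneg_continuous X.
     (\<forall>x\<in>topspace X. \<phi> x \<le> 1) \<and> (\<forall>x\<in>topspace X - U. \<phi> x = 0)}"

definition content :: "'a set \<Rightarrow> ennreal" where
  "content U = (SUP \<phi>\<in>tests U. ennreal (p \<phi>))"

text \<open>The classical construction: an open set is measured from inside by the functions that it carries,
  an arbitrary set from outside by the open sets around it.\<close>

definition outer :: "'a set \<Rightarrow> ennreal" where
  "outer A = (INF U\<in>{U. openin X U \<and> A \<subseteq> U}. content U)"

abbreviation (input) trim :: "('a \<Rightarrow> real) \<Rightarrow> real \<Rightarrow> 'a \<Rightarrow> real" where
  "trim \<phi> e \<equiv> \<lambda>x. max 0 (\<phi> x - e)"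

lemma functional_mono:
  assumes "\<phi> \<in> nonneg_continuous X" "\<psi> \<in> nonneg_continuous X"
    and "\<And>x. x \<in> topspace X \<Longrightarrow> \<phi> x \<le> \<psi> x"
  shows "p \<phi> \<le> p \<psi>"
proof -
  have d: "(\<lambda>x. \<psi> x - \<phi> x) \<in> nonneg_continuous X"
    using assms by (auto simp: nonneg_continuous_def intro!: continuous_intros)
  have "p \<psi> = p \<phi> + p (\<lambda>x. \<psi> x - \<phi> x)"
    using add[OF assms(1) d] by simp
  then show ?thesis
    using nonneg[OF d] by simp
qed

lemma functional_cong:
  assumes "\<phi> \<in> nonneg_continuous X" "\<psi> \<in> nonneg_continuous X"
    and "\<And>x. x \<in> topspace X \<Longrightarrow> \<phi> x = \<psi> x"
  shows "p \<phi> = p \<psi>"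
  using functional_mono[OF assms(1,2)] functional_mono[OF assms(2,1)] assms(3)
  by (simp add: order_antisym)

lemma const_nonneg: "0 \<le> c \<Longrightarrow> (\<lambda>x. c) \<in> nonneg_continuous X"
  by (simp add: nonneg_continuous_def)

lemma functional_const: "0 \<le> c \<Longrightarrow> p (\<lambda>x. c) = c * p (\<lambda>x. 1)"
  using scale[OF const_nonneg[of 1], of c] by simp

lemma tests_nonneg: "\<phi> \<in> tests U \<Longrightarrow> \<phi> \<in> nonneg_continuous X"
  by (simp add: tests_def)

lemma zero_test: "(\<lambda>x. 0) \<in> tests U"
  by (simp add: tests_def nonneg_continuous_def)

lemma content_upper: "\<phi> \<in> tests U \<Longrightarrow> ennreal (p \<phi>) \<le> content U"
  by (auto simp: content_def intro: SUP_upper)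

lemma content_mono: "U \<subseteq> V \<Longrightarrow> content U \<le> content V"
  unfolding content_def by (rule SUP_subset_mono) (auto simp: tests_def)

lemma content_finite: "content U \<le> ennreal (p (\<lambda>x. 1))"
  unfolding content_def
  by (rule SUP_least, rule ennreal_leI, rule functional_mono)
    (auto simp: tests_def nonneg_continuous_def)

lemma content_space: "content (topspace X) = ennreal (p (\<lambda>x. 1))"
  by (rule antisym[OF content_finite content_upper]) (auto simp: tests_def const_nonneg)

lemma trim_nonneg: "\<phi> \<in> nonneg_continuous X \<Longrightarrow> trim \<phi> e \<in> nonneg_continuous X"
  by (auto simp: nonneg_continuous_def intro!: continuous_intros)

lemma trim_test:
  assumes "\<phi> \<in> tests U" "0 < e" and "{x \<in> topspace X. e \<le> \<phi> x} \<subseteq> V"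
  shows "trim \<phi> e \<in> tests V"
  using assms trim_nonneg[of \<phi> e]
  by (fastforce simp: tests_def)

lemma level_compact:
  assumes "\<phi> \<in> nonneg_continuous X"
  shows "closedin X {x \<in> topspace X. e \<le> \<phi> x}" "compactin X {x \<in> topspace X. e \<le> \<phi> x}"
proof -
  have "closedin X {x \<in> topspace X. \<phi> x \<in> {e..}}"
    using assms by (intro closedin_continuous_map_preimage[where Y = euclideanreal])
      (auto simp: nonneg_continuous_def)
  then show "closedin X {x \<in> topspace X. e \<le> \<phi> x}"
    by simp
  then show "compactin X {x \<in> topspace X. e \<le> \<phi> x}"
    using compact closedin_compact_space by blast
qed

text \<open>A test function may be trimmed before its value is estimated: \<open>max 0 (\<phi> - e)\<close> is carried by the
  compact set \<open>{\<phi> \<ge> e}\<close>, so that compactness and Urysohn's lemma become available, while \<open>p\<close> changes by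
  at most \<open>e * p 1\<close>.\<close>

lemma content_leI:
  assumes "\<And>\<phi> e. \<phi> \<in> tests U \<Longrightarrow> 0 < e \<Longrightarrow> ennreal (p (trim \<phi> e)) \<le> B"
  shows "content U \<le> B"
  unfolding content_def
proof (rule SUP_least)
  fix \<phi> assume \<phi>: "\<phi> \<in> tests U"
  have \<phi>n: "\<phi> \<in> nonneg_continuous X"
    by (rule tests_nonneg[OF \<phi>])
  have p1: "0 \<le> p (\<lambda>x. 1)"
    by (rule nonneg) (simp add: const_nonneg)
  show "ennreal (p \<phi>) \<le> B"
  proof (rule ennreal_le_epsilon)
    fix e :: real assume e: "0 < e"
    define d where "d = e / (p (\<lambda>x. 1) + 1)"
    have d: "0 < d" "d * p (\<lambda>x. 1) \<le> e"
      using e p1 by (auto simp: d_def field_simps)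
    have "p \<phi> \<le> p (\<lambda>x. trim \<phi> d x + d)"
    proof (rule functional_mono[OF \<phi>n])
      show "(\<lambda>x. trim \<phi> d x + d) \<in> nonneg_continuous X"
        using d(1) trim_nonneg[OF \<phi>n, of d] by (auto simp: nonneg_continuous_def intro!: continuous_map_add)
    qed simp
    also have "\<dots> = p (trim \<phi> d) + d * p (\<lambda>x. 1)"
      using d(1) add[OF trim_nonneg[OF \<phi>n] const_nonneg[of d]] functional_const[of d] by simp
    also have "\<dots> \<le> p (trim \<phi> d) + e"
      using d by simp
    finally have "ennreal (p \<phi>) \<le> ennreal (p (trim \<phi> d) + e)"
      by (rule ennreal_leI)
    also have "\<dots> = ennreal (p (trim \<phi> d)) + ennreal e"
      using e nonneg[OF trim_nonneg[OF \<phi>n, of d]] by simp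
    also have "\<dots> \<le> B + ennreal e"
      using assms[OF \<phi> d(1)] by (simp add: add_right_mono)
    finally show "ennreal (p \<phi>) \<le> B + ennreal e" .
  qed
qed

lemma content_empty: "content {} = 0"
proof -
  have "p \<phi> = 0" if "\<phi> \<in> tests {}" for \<phi>
    using functional_cong[OF tests_nonneg[OF that] const_nonneg[of 0]] that functional_const[of 0]
    by (simp add: tests_def)
  then have "content {} \<le> 0"
    unfolding content_def by (intro SUP_least) simp
  then show ?thesis
    by simp
qed

text \<open>On the compact set \<open>K = {\<phi> \<ge> e}\<close> the pieces \<open>K - U\<close> and \<open>K - V\<close> are disjoint and closed. A Urysohn
  function between them splits the trimmed \<open>\<phi>\<close> into one function carried by \<open>U\<close> and one carried by \<open>V\<close>.\<close>

lemma content_Un: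
  assumes "openin X U" "openin X V"
  shows "content (U \<union> V) \<le> content U + content V"
proof (rule content_leI)
  fix \<phi> and e :: real
  assume \<phi>: "\<phi> \<in> tests (U \<union> V)" and e: "0 < e"
  define K where "K = {x \<in> topspace X. e \<le> \<phi> x}"
  have K: "closedin X K" and KUV: "K \<subseteq> U \<union> V"
    using level_compact(1)[OF tests_nonneg[OF \<phi>]] \<phi> e by (force simp: K_def tests_def)+
  have "closedin X (K - U)" "closedin X (K - V)" "disjnt (K - U) (K - V)"
    using assms K KUV by (auto simp: disjnt_def)
  then obtain g where g: "continuous_map X (top_of_set {0..1::real}) g"
    "g ` (K - U) \<subseteq> {0}" "g ` (K - V) \<subseteq> {1}"
    using Urysohn_lemma[OF compact_Hausdorff_or_regular_imp_normal_space[OF compact disjI1[OF hausdorff]]]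
    by (metis zero_le_one)
  then have gc: "continuous_map X euclideanreal g" and g01: "\<And>x. x \<in> topspace X \<Longrightarrow> 0 \<le> g x \<and> g x \<le> 1"
    by (auto simp: continuous_map_in_subtopology image_subset_iff Pi_iff)
  note \<phi>' = \<phi>[unfolded tests_def nonneg_continuous_def, simplified]
  have 1: "(\<lambda>x. g x * trim \<phi> e x) \<in> tests U" (is "?a \<in> _")
    unfolding tests_def nonneg_continuous_def
  proof (intro CollectI conjI ballI)
    show "continuous_map X euclideanreal ?a"
      using gc \<phi>' by (auto intro!: continuous_intros)
    fix x assume x: "x \<in> topspace X"
    show "0 \<le> ?a x" using g01[OF x] by simp
    show "?a x \<le> 1" using g01[OF x] \<phi>' e x by (intro mult_le_one) (auto simp: le_diff_eq intro: order_trans)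
  next
    fix x assume "x \<in> topspace X - U"
    then show "?a x = 0" using g(2) by (cases "x \<in> K") (auto simp: K_def)
  qed
  have 2: "(\<lambda>x. (1 - g x) * trim \<phi> e x) \<in> tests V" (is "?b \<in> _")
    unfolding tests_def nonneg_continuous_def
  proof (intro CollectI conjI ballI)
    show "continuous_map X euclideanreal ?b"
      using gc \<phi>' by (auto intro!: continuous_intros)
    fix x assume x: "x \<in> topspace X"
    show "0 \<le> ?b x" using g01[OF x] by simp
    show "?b x \<le> 1" using g01[OF x] \<phi>' e x by (intro mult_le_one) (auto simp: le_diff_eq intro: order_trans)
  next
    fix x assume "x \<in> topspace X - V"
    then show "?b x = 0" using g(3) by (cases "x \<in> K") (auto simp: K_def)
  qed
  have "p (trim \<phi> e) = p (\<lambda>x. ?a x + ?b x)"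
    by (rule arg_cong[where f = p]) (auto simp: algebra_simps)
  also have "\<dots> = p ?a + p ?b"
    by (rule add[OF tests_nonneg[OF 1] tests_nonneg[OF 2]])
  finally have "ennreal (p (trim \<phi> e)) = ennreal (p ?a) + ennreal (p ?b)"
    using nonneg[OF tests_nonneg[OF 1]] nonneg[OF tests_nonneg[OF 2]] by simp
  then show "ennreal (p (trim \<phi> e)) \<le> content U + content V"
    using content_upper[OF 1] content_upper[OF 2] by (simp add: add_mono)
qed

lemma content_UN_finite:
  assumes "\<And>i. openin X (U i)"
  shows "content (\<Union>i<(n::nat). U i) \<le> (\<Sum>i<n. content (U i))"
proof (induction n)
  case (Suc n)
  have "content (\<Union>i<Suc n. U i) = content ((\<Union>i<n. U i) \<union> U n)"
    by (simp add: lessThan_Suc Un_commute)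
  also have "\<dots> \<le> content (\<Union>i<n. U i) + content (U n)"
    using assms by (intro content_Un) auto
  finally show ?case
    using Suc by (auto intro: order_trans add_right_mono)
qed (simp add: content_empty)

lemma content_UN:
  assumes "\<And>i::nat. openin X (U i)"
  shows "content (\<Union>i. U i) \<le> (\<Sum>i. content (U i))"
proof (rule content_leI)
  fix \<phi> and e :: real
  assume \<phi>: "\<phi> \<in> tests (\<Union>i. U i)" and e: "0 < e"
  define K where "K = {x \<in> topspace X. e \<le> \<phi> x}"
  have K: "compactin X K" and KU: "K \<subseteq> (\<Union>i. U i)"
    using level_compact(2)[OF tests_nonneg[OF \<phi>]] \<phi> e by (force simp: K_def tests_def)+
  obtain F where F: "finite F" "F \<subseteq> range U" "K \<subseteq> \<Union>F"
    using compactinD[OF K, of "range U"] KU assms by auto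
  then obtain I where I: "finite I" "F = U ` I"
    by (meson finite_subset_image)
  then obtain n where "\<And>i. i \<in> I \<Longrightarrow> i < n"
    using finite_nat_set_iff_bounded by auto
  then have "K \<subseteq> (\<Union>i<n. U i)"
    using F(3) I(2) by blast
  then have "trim \<phi> e \<in> tests (\<Union>i<n. U i)"
    using trim_test[OF \<phi> e] by (simp add: K_def)
  then have "ennreal (p (trim \<phi> e)) \<le> (\<Sum>i<n. content (U i))"
    using content_upper content_UN_finite[of U n] assms order_trans by blast
  also have "\<dots> \<le> (\<Sum>i. content (U i))"
    by (rule sum_le_suminf) auto
  finally show "ennreal (p (trim \<phi> e)) \<le> (\<Sum>i. content (U i))" .
qed

lemma outer_open: "openin X U \<Longrightarrow> outer U = content U"
  unfolding outer_def by (rule antisym) (auto intro!: INF_lower INF_greatest content_mono)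

lemma outer_mono: "A \<subseteq> B \<Longrightarrow> outer A \<le> outer B"
  unfolding outer_def by (rule INF_superset_mono) auto

lemma outer_approx:
  assumes "A \<subseteq> topspace X" "0 < e"
  obtains U where "openin X U" "A \<subseteq> U" "content U \<le> outer A + ennreal e"
proof -
  have "outer A \<le> content (topspace X)"
    unfolding outer_def using assms by (intro INF_lower) auto
  then have "outer A < top"
    by (rule le_less_trans[OF order_trans[OF _ content_finite] ennreal_less_top])
  then have "outer A + 0 < outer A + ennreal e"
    using assms(2) by (subst ennreal_add_left_cancel_less) (auto simp: less_top)
  then have "outer A < outer A + ennreal e"
    by simp
  then obtain U where "openin X U" "A \<subseteq> U" "content U < outer A + ennreal e"
    unfolding outer_def INF_less_iff by auto
  then show ?thesis
    using that less_imp_le by blast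
qed

lemma outer_measure_space_outer: "outer_measure_space (Pow (topspace X)) outer"
  unfolding outer_measure_space_def
proof (intro conjI)
  show "positive (Pow (topspace X)) outer"
    by (simp add: positive_def outer_open content_empty)
  show "increasing (Pow (topspace X)) outer"
    unfolding increasing_def by (blast intro: outer_mono)
  show "countably_subadditive (Pow (topspace X)) outer"
    unfolding countably_subadditive_def
  proof (intro allI impI)
    fix A :: "nat \<Rightarrow> 'a set"
    assume A: "range A \<subseteq> Pow (topspace X)"
    show "outer (\<Union>i. A i) \<le> (\<Sum>i. outer (A i))"
    proof (rule ennreal_le_epsilon)
      fix e :: real assume e: "0 < e"
      have "\<exists>U. openin X U \<and> A i \<subseteq> U \<and> content U \<le> outer (A i) + ennreal (e * (1 / 2) ^ Suc i)" for i
      proof -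
        have "A i \<subseteq> topspace X" "0 < e * (1 / 2) ^ Suc i"
          using A e by auto
        then show ?thesis
          by (metis outer_approx)
      qed
      then obtain U where U: "\<And>i. openin X (U i)" "\<And>i. A i \<subseteq> U i"
        "\<And>i. content (U i) \<le> outer (A i) + ennreal (e * (1 / 2) ^ Suc i)"
        by metis
      have "outer (\<Union>i. A i) \<le> outer (\<Union>i. U i)"
        using U(2) by (intro outer_mono) blast
      also have "\<dots> = content (\<Union>i. U i)"
        using U(1) by (intro outer_open) auto
      also have "\<dots> \<le> (\<Sum>i. content (U i))"
        by (rule content_UN[OF U(1)])
      also have "\<dots> \<le> (\<Sum>i. outer (A i) + ennreal (e * (1 / 2) ^ Suc i))"
        by (intro suminf_le U(3)) auto
      also have "\<dots> = (\<Sum>i. outer (A i)) + (\<Sum>i. ennreal (e * (1 / 2) ^ Suc i))"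
        by (subst suminf_add) auto
      also have "(\<Sum>i. ennreal (e * (1 / 2) ^ Suc i)) = ennreal e"
        proof (rule suminf_ennreal_eq)
          show "(\<lambda>i. e * (1 / 2) ^ Suc i) sums e"
            using sums_mult[OF power_half_series, of e] by (simp del: power_Suc)
        qed (use e in simp)
      finally show "outer (\<Union>i. A i) \<le> (\<Sum>i. outer (A i)) + ennreal e" .
    qed
  qed
qed

text \<open>It is enough to show superadditivity on an open set \<open>V\<close> around \<open>A\<close>. A function carried by \<open>U \<inter> V\<close>
  lives, once trimmed, on a compact subset of \<open>U \<inter> V\<close>; any test function carried by the rest of \<open>V\<close>
  can be added to it without exceeding \<open>1\<close>, and this rest contains \<open>A - U\<close>.\<close>

lemma open_caratheodory:
  assumes U: "openin X U"
  shows "U \<in> lambda_system (topspace X) (Pow (topspace X)) outer"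
  unfolding lambda_system_def
proof (intro CollectI conjI ballI)
  show "U \<in> Pow (topspace X)"
    using U openin_subset by blast
  fix A assume A: "A \<in> Pow (topspace X)"
  have "outer (U \<inter> A) + outer ((topspace X - U) \<inter> A) \<le> outer A"
  proof (subst (3) outer_def, rule INF_greatest)
    fix V assume V: "V \<in> {V. openin X V \<and> A \<subseteq> V}"
    have key: "ennreal (p (trim \<phi> e)) + content W \<le> content V"
      if \<phi>: "\<phi> \<in> tests (U \<inter> V)" and e: "0 < e" and W: "W = V - {x \<in> topspace X. e \<le> \<phi> x}"
      for \<phi> e W
    proof -
      note \<phi>n = tests_nonneg[OF \<phi>]
      have "ennreal (p \<psi>) + ennreal (p (trim \<phi> e)) \<le> content V" if \<psi>: "\<psi> \<in> tests W" for \<psi>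
      proof -
        have "(\<lambda>x. \<psi> x + trim \<phi> e x) \<in> tests V"
          unfolding tests_def nonneg_continuous_def
        proof (intro CollectI conjI ballI)
          show "continuous_map X euclideanreal (\<lambda>x. \<psi> x + trim \<phi> e x)"
            using \<phi> \<psi> by (auto simp: tests_def nonneg_continuous_def intro!: continuous_intros)
          fix x assume x: "x \<in> topspace X"
          then have bd: "0 \<le> \<phi> x" "\<phi> x \<le> 1" "0 \<le> \<psi> x" "\<psi> x \<le> 1"
            using \<phi> \<psi> by (auto simp: tests_def nonneg_continuous_def)
          then show "0 \<le> \<psi> x + trim \<phi> e x" by simp
          show "\<psi> x + trim \<phi> e x \<le> 1"
            using bd \<psi> x e by (cases "e \<le> \<phi> x") (auto simp: tests_def W)
        next
          fix x assume x: "x \<in> topspace X - V"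
          then show "\<psi> x + trim \<phi> e x = 0"
            using \<phi> \<psi> e by (auto simp: tests_def W)
        qed
        then have "ennreal (p (\<lambda>x. \<psi> x + trim \<phi> e x)) \<le> content V"
          by (rule content_upper)
        then show ?thesis
          using add[OF tests_nonneg[OF \<psi>] trim_nonneg[OF \<phi>n]] nonneg[OF tests_nonneg[OF \<psi>]]
            nonneg[OF trim_nonneg[OF \<phi>n]] by simp
      qed
      then have "(SUP \<psi>\<in>tests W. ennreal (p \<psi>) + ennreal (p (trim \<phi> e))) \<le> content V"
        by (rule SUP_least)
      moreover have "(SUP \<psi>\<in>tests W. ennreal (p \<psi>) + ennreal (p (trim \<phi> e)))
          = content W + ennreal (p (trim \<phi> e))"
        unfolding content_def using zero_test[of W] by (subst ennreal_SUP_add_left) auto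
      ultimately show ?thesis
        by (simp add: add.commute)
    qed
    have le: "ennreal (p (trim \<phi> e)) + outer ((topspace X - U) \<inter> A) \<le> content V"
      if \<phi>: "\<phi> \<in> tests (U \<inter> V)" and e: "0 < e" for \<phi> e
    proof -
      define W where "W = V - {x \<in> topspace X. e \<le> \<phi> x}"
      have "openin X W"
        using V level_compact(1)[OF tests_nonneg[OF \<phi>]] by (auto simp: W_def)
      moreover have "(topspace X - U) \<inter> A \<subseteq> W"
        using V \<phi> e by (auto simp: W_def tests_def)
      ultimately have "outer ((topspace X - U) \<inter> A) \<le> content W"
        by (metis outer_mono outer_open)
      then show ?thesis
        using key[OF \<phi> e W_def] by (meson add_left_mono order_trans)
    qed
    have "outer ((topspace X - U) \<inter> A) \<le> ennreal (p (trim (\<lambda>x. 0) 1)) + outer ((topspace X - U) \<inter> A)"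
      by simp
    also have "\<dots> \<le> content V"
      by (rule le[OF zero_test zero_less_one])
    finally have fin: "outer ((topspace X - U) \<inter> A) \<le> content V" .
    have "content (U \<inter> V) \<le> content V - outer ((topspace X - U) \<inter> A)"
      using le by (intro content_leI) (simp add: ennreal_le_minus_iff add.commute)
    then have "content (U \<inter> V) + outer ((topspace X - U) \<inter> A)
        \<le> content V - outer ((topspace X - U) \<inter> A) + outer ((topspace X - U) \<inter> A)"
      by (rule add_right_mono)
    also have "\<dots> = content V"
      using fin by (rule diff_add_cancel_ennreal)
    finally have 1: "content (U \<inter> V) + outer ((topspace X - U) \<inter> A) \<le> content V" .
    have "outer (U \<inter> A) \<le> outer (U \<inter> V)"
      using V by (intro outer_mono) auto
    also have "\<dots> = content (U \<inter> V)"
      using V U by (intro outer_open) auto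
    finally show "outer (U \<inter> A) + outer ((topspace X - U) \<inter> A) \<le> content V"
      by (rule order_trans[OF add_right_mono 1])
  qed
  moreover have "outer A \<le> outer (U \<inter> A) + outer ((topspace X - U) \<inter> A)"
  proof -
    have "subadditive (Pow (topspace X)) outer"
      using outer_measure_space_outer unfolding outer_measure_space_def
      by (intro ring_of_sets.countably_subadditive_subadditive[OF ring_of_sets_Pow]) auto
    then have "outer ((U \<inter> A) \<union> ((topspace X - U) \<inter> A)) \<le> outer (U \<inter> A) + outer ((topspace X - U) \<inter> A)"
      by (rule subadditiveD) (use A in auto)
    moreover have "(U \<inter> A) \<union> ((topspace X - U) \<inter> A) = A"
      using A by auto
    ultimately show ?thesis by simp
  qed
  ultimately show "outer (U \<inter> A) + outer ((topspace X - U) \<inter> A) = outer A"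
    by (rule antisym)
qed

definition radon :: "'a measure" where
  "radon = measure_of (topspace X) {U. openin X U} outer"

lemma sets_radon: "sets radon = sets (borel_of X)" and space_radon: "space radon = topspace X"
  using openin_subset by (auto simp: radon_def borel_of_def sets_measure_of_conv space_measure_of_conv)

lemma open_radon: "openin X U \<Longrightarrow> U \<in> sets radon"
  unfolding radon_def using openin_subset by (intro in_measure_of) auto

lemma emeasure_radon:
  assumes "A \<in> sets radon"
  shows "emeasure radon A = outer A"
proof -
  let ?L = "lambda_system (topspace X) (Pow (topspace X)) outer"
  interpret P: sigma_algebra "topspace X" "Pow (topspace X)"
    by (rule sigma_algebra_Pow)
  have ms: "measure_space (topspace X) ?L outer"
    by (rule P.caratheodory_lemma[OF outer_measure_space_outer])
  have opens: "{U. openin X U} \<subseteq> Pow (topspace X)"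
    using openin_subset by auto
  have sub: "sets radon \<subseteq> ?L"
    unfolding radon_def sets_measure_of[OF opens]
    using ms open_caratheodory by (intro sigma_algebra.sigma_sets_subset) (auto simp: measure_space_def)
  show ?thesis
  proof (rule emeasure_measure_of[OF radon_def opens _ _ assms])
    show "positive (sets radon) outer"
      by (simp add: positive_def outer_open content_empty)
    show "countably_additive (sets radon) outer"
      unfolding countably_additive_def
    proof (intro allI impI)
      fix A :: "nat \<Rightarrow> 'a set"
      assume A: "range A \<subseteq> sets radon" "disjoint_family A" "(\<Union>i. A i) \<in> sets radon"
      have "range A \<subseteq> ?L" "(\<Union>i. A i) \<in> ?L"
        using A sub by blast+
      with A(2) ms show "(\<Sum>i. outer (A i)) = outer (\<Union>i. A i)"
        unfolding measure_space_def countably_additive_def by blast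
    qed
  qed
qed

lemma emeasure_radon_open: "openin X U \<Longrightarrow> emeasure radon U = content U"
  by (simp add: emeasure_radon open_radon outer_open)

lemma radon_outer_regular:
  assumes "A \<in> sets radon"
  shows "emeasure radon A = (INF U\<in>{U. openin X U \<and> A \<subseteq> U}. emeasure radon U)"
  using assms by (simp add: emeasure_radon outer_def emeasure_radon_open cong: INF_cong_simp)

lemma finite_radon: "finite_measure radon"
  by (rule finite_measureI)
    (simp add: space_radon emeasure_radon_open content_space)

lemma continuous_measurable_radon:
  assumes "continuous_map X euclidean g"
  shows "g \<in> borel_measurable radon"
proof (rule borel_measurableI)
  fix S :: "'b set" assume "open S"
  then have "openin X {x \<in> topspace X. g x \<in> S}"
    using assms by (simp add: continuous_map)
  moreover have "{x \<in> topspace X. g x \<in> S} = g -` S \<inter> space radon"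
    by (auto simp: space_radon)
  ultimately show "g -` S \<inter> space radon \<in> sets radon"
    using open_radon by metis
qed

lemma functional_sum:
  "finite J \<Longrightarrow> (\<And>j. j \<in> J \<Longrightarrow> t j \<in> nonneg_continuous X)
    \<Longrightarrow> (\<lambda>x. \<Sum>j\<in>J. t j x) \<in> nonneg_continuous X \<and> p (\<lambda>x. \<Sum>j\<in>J. t j x) = (\<Sum>j\<in>J. p (t j))"
proof (induction J rule: finite_induct)
  case empty
  then show ?case
    using functional_const[of 0] const_nonneg[of 0] by simp
next
  case (insert j J)
  then have J: "(\<lambda>x. \<Sum>j\<in>J. t j x) \<in> nonneg_continuous X"
      "p (\<lambda>x. \<Sum>j\<in>J. t j x) = (\<Sum>j\<in>J. p (t j))" and j: "t j \<in> nonneg_continuous X"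
    by auto
  have "(\<lambda>x. t j x + (\<Sum>j\<in>J. t j x)) \<in> nonneg_continuous X"
    using J(1) j by (auto simp: nonneg_continuous_def intro!: continuous_map_add)
  with add[OF j J(1)] J(2) insert.hyps show ?case
    by simp
qed

text \<open>Slice horizontally: \<open>N \<phi>\<close> is the sum of the slices \<open>t j\<close>, the part of \<open>N \<phi>\<close> between the heights \<open>j\<close>
  and \<open>j + 1\<close>. Both \<open>p (t j)\<close> and the integral of \<open>t j\<close> lie between the measures of the open sets
  \<open>{N \<phi> > j + 1}\<close> and \<open>{N \<phi> > j}\<close>. The gaps telescope, so for \<open>N \<phi>\<close> the two values differ by at most
  the mass of \<open>X\<close>, whatever \<open>N\<close> is.\<close>

lemma radon_integral_unit:
  assumes \<phi>: "\<phi> \<in> nonneg_continuous X" and le1: "\<And>x. x \<in> topspace X \<Longrightarrow> \<phi> x \<le> 1"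
  shows "integral\<^sup>L radon \<phi> = p \<phi>"
proof -
  interpret finite_measure radon by (rule finite_radon)
  note [simp] = space_radon
  have bound: "real N * \<bar>p \<phi> - integral\<^sup>L radon \<phi>\<bar> \<le> measure radon (topspace X)" for N :: nat
  proof -
    define t where "t j x = max 0 (min 1 (real N * \<phi> x - real j))" for j :: nat and x
    define U where "U j = {x \<in> topspace X. real j < real N * \<phi> x}" for j :: nat
    have \<phi>c: "continuous_map X euclideanreal \<phi>" and \<phi>0: "\<And>x. x \<in> topspace X \<Longrightarrow> 0 \<le> \<phi> x"
      using \<phi> by (auto simp: nonneg_continuous_def)
    have t: "t j \<in> nonneg_continuous X" for j
      unfolding nonneg_continuous_def t_def using \<phi>c by (auto intro!: continuous_intros)
    have openU: "openin X (U j)" for j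
    proof -
      have "openin X {x \<in> topspace X. real N * \<phi> x \<in> {real j<..}}"
        using \<phi>c by (intro openin_continuous_map_preimage[where Y = euclideanreal] continuous_intros) auto
      then show ?thesis by (simp add: U_def)
    qed
    note [measurable] = open_radon[OF openU]
    have test: "t j \<in> tests (U j)" for j
      using t[of j] by (auto simp: tests_def t_def U_def)
    have tm: "integrable radon (t j)" for j
      using continuous_measurable_radon[of "t j"] t[of j]
      by (intro integrable_const_bound[where B = 1]) (auto simp: t_def nonneg_continuous_def)
    have content_eq: "content (U j) = ennreal (measure radon (U j))" for j
      by (simp add: emeasure_radon_open[OF openU, symmetric] emeasure_eq_measure)
    have up: "p (t j) \<le> measure radon (U j)" for j
      using content_upper[OF test[of j]] nonneg[OF t[of j]] by (simp add: content_eq)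
    have content_low: "content (U (Suc j)) \<le> ennreal (p (t j))" for j
      unfolding content_def
    proof (rule SUP_least, rule ennreal_leI)
      fix \<psi> assume \<psi>: "\<psi> \<in> tests (U (Suc j))"
      show "p \<psi> \<le> p (t j)"
      proof (rule functional_mono[OF tests_nonneg[OF \<psi>] t])
        fix x assume "x \<in> topspace X"
        then show "\<psi> x \<le> t j x"
          using \<psi> by (cases "x \<in> U (Suc j)") (auto simp: tests_def U_def t_def)
      qed
    qed
    have low: "measure radon (U (Suc j)) \<le> p (t j)" for j
      using content_low[of j] nonneg[OF t[of j]] by (simp add: content_eq)
    have ind: "integrable radon (indicat_real (U j))" for j
      using open_radon[OF openU] by (intro integrable_real_indicator) (auto simp: emeasure_eq_measure)
    have low': "measure radon (U (Suc j)) \<le> integral\<^sup>L radon (t j)" for j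
    proof -
      have "integral\<^sup>L radon (indicat_real (U (Suc j))) \<le> integral\<^sup>L radon (t j)"
        by (rule integral_mono[OF ind tm]) (auto simp: t_def U_def indicator_def)
      then show ?thesis by (simp add: openin_subset[OF openU] Int_absorb2)
    qed
    have up': "integral\<^sup>L radon (t j) \<le> measure radon (U j)" for j
    proof -
      have "integral\<^sup>L radon (t j) \<le> integral\<^sup>L radon (indicat_real (U j))"
        by (rule integral_mono[OF tm ind]) (auto simp: t_def U_def indicator_def)
      then show ?thesis by (simp add: openin_subset[OF openU] Int_absorb2)
    qed
    have sum_t: "(\<Sum>j<N. t j x) = real N * \<phi> x" if "x \<in> topspace X" for x
      unfolding t_def using \<phi>0[OF that] le1[OF that] by (subst sum_unit_slices) (auto simp: mult_left_le)
    have "real N * p \<phi> = p (\<lambda>x. real N * \<phi> x)"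
      using scale[OF \<phi>, of "real N"] by simp
    also have "\<dots> = p (\<lambda>x. \<Sum>j<N. t j x)"
      using \<phi>c \<phi>0 functional_sum[of "{..<N}" t] t sum_t
      by (intro functional_cong) (auto simp: nonneg_continuous_def intro!: continuous_intros)
    also have "\<dots> = (\<Sum>j<N. p (t j))"
      using functional_sum[of "{..<N}" t] t by simp
    finally have 1: "real N * p \<phi> = (\<Sum>j<N. p (t j))" .
    have "real N * integral\<^sup>L radon \<phi> = integral\<^sup>L radon (\<lambda>x. real N * \<phi> x)"
      by simp
    also have "\<dots> = integral\<^sup>L radon (\<lambda>x. \<Sum>j<N. t j x)"
      by (rule Bochner_Integration.integral_cong) (auto simp: sum_t)
    also have "\<dots> = (\<Sum>j<N. integral\<^sup>L radon (t j))"
      using tm by (intro Bochner_Integration.integral_sum) auto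
    finally have 2: "real N * integral\<^sup>L radon \<phi> = (\<Sum>j<N. integral\<^sup>L radon (t j))" .
    have "real N * \<bar>p \<phi> - integral\<^sup>L radon \<phi>\<bar> = \<bar>\<Sum>j<N. p (t j) - integral\<^sup>L radon (t j)\<bar>"
      unfolding sum_subtractf 1[symmetric] 2[symmetric] right_diff_distrib[symmetric]
      by (simp add: abs_mult)
    also have "\<dots> \<le> (\<Sum>j<N. measure radon (U j) - measure radon (U (Suc j)))"
    proof (rule order_trans[OF sum_abs], rule sum_mono)
      fix j
      show "\<bar>p (t j) - integral\<^sup>L radon (t j)\<bar> \<le> measure radon (U j) - measure radon (U (Suc j))"
        using up[of j] low[of j] up'[of j] low'[of j] by linarith
    qed
    also have "\<dots> = measure radon (U 0) - measure radon (U N)"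
      by (rule sum_lessThan_telescope')
    also have "\<dots> \<le> measure radon (topspace X)"
      using bounded_measure[of "U 0"] by (auto intro: order_trans[rotated])
    finally show ?thesis .
  qed
  have "\<bar>p \<phi> - integral\<^sup>L radon \<phi>\<bar> \<le> 0"
  proof (rule ccontr)
    assume "\<not> ?thesis"
    then obtain N :: nat where "measure radon (topspace X) < real N * \<bar>p \<phi> - integral\<^sup>L radon \<phi>\<bar>"
      using reals_Archimedean3[of "\<bar>p \<phi> - integral\<^sup>L radon \<phi>\<bar>"] by force
    then show False using bound[of N] by simp
  qed
  then show ?thesis by simp
qed

theorem radon_integral:
  assumes \<phi>: "\<phi> \<in> nonneg_continuous X"
  shows "integral\<^sup>L radon \<phi> = p \<phi>"
proof -
  obtain B where B: "0 < B" "\<And>x. x \<in> topspace X \<Longrightarrow> \<bar>\<phi> x\<bar> \<le> B"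
    using \<phi> continuous_map_compact_bounded[OF compact, of \<phi>] by (auto simp: nonneg_continuous_def)
  let ?\<psi> = "\<lambda>x. inverse B * \<phi> x"
  have \<psi>: "?\<psi> \<in> nonneg_continuous X"
    using \<phi> B(1) by (auto simp: nonneg_continuous_def intro!: continuous_intros)
  have "integral\<^sup>L radon ?\<psi> = p ?\<psi>"
    using B by (intro radon_integral_unit[OF \<psi>]) (auto simp: field_simps abs_le_iff)
  moreover have "p ?\<psi> = inverse B * p \<phi>"
    using scale[OF \<phi>, of "inverse B"] B(1) by simp
  ultimately show ?thesis
    using B(1) by simp
qed

lemma integrable_radon:
  assumes "continuous_map X euclideanreal h"
  shows "integrable radon h"
proof -
  interpret finite_measure radon by (rule finite_radon)
  show ?thesis
    using continuous_map_compact_bounded[OF compact assms] continuous_measurable_radon[OF assms]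
    by (metis (no_types, lifting) AE_I2 integrable_const_bound space_radon)
qed

lemma radon_integral_real:
  assumes h: "continuous_map X euclideanreal h"
  shows "integral\<^sup>L radon h = p (\<lambda>x. max 0 (h x)) - p (\<lambda>x. max 0 (- h x))"
proof -
  have c: "continuous_map X euclideanreal (\<lambda>x. max 0 (h x))" "continuous_map X euclideanreal (\<lambda>x. max 0 (- h x))"
    using h by (auto intro!: continuous_intros)
  have "integral\<^sup>L radon h = (LINT x|radon. max 0 (h x) - max 0 (- h x))"
    by (rule Bochner_Integration.integral_cong) auto
  also have "\<dots> = (LINT x|radon. max 0 (h x)) - (LINT x|radon. max 0 (- h x))"
    using c by (intro Bochner_Integration.integral_diff integrable_radon)
  finally show ?thesis
    using c by (simp add: radon_integral nonneg_continuous_def)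
qed

lemma radon_integral_complex:
  assumes \<phi>: "continuous_map X euclidean \<phi>"
  shows "integral\<^sup>L radon \<phi> = Complex (p (\<lambda>x. max 0 (Re (\<phi> x))) - p (\<lambda>x. max 0 (- Re (\<phi> x))))
    (p (\<lambda>x. max 0 (Im (\<phi> x))) - p (\<lambda>x. max 0 (- Im (\<phi> x))))"
proof -
  have c: "continuous_map X euclideanreal (\<lambda>x. Re (\<phi> x))" "continuous_map X euclideanreal (\<lambda>x. Im (\<phi> x))"
    using \<phi> by (simp_all add: continuous_map_atin tendsto_Re tendsto_Im)
  note i = integrable_radon[OF c(1)] integrable_radon[OF c(2)]
  have "integral\<^sup>L radon \<phi> = (LINT x|radon. complex_of_real (Re (\<phi> x)) + \<i> * complex_of_real (Im (\<phi> x)))"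
    by (simp flip: complex_eq)
  also have "\<dots> = (LINT x|radon. complex_of_real (Re (\<phi> x))) + (LINT x|radon. \<i> * complex_of_real (Im (\<phi> x)))"
    using i by (intro Bochner_Integration.integral_add) auto
  also have "\<dots> = Complex (LINT x|radon. Re (\<phi> x)) (LINT x|radon. Im (\<phi> x))"
    by (simp add: Complex_eq)
  finally show ?thesis
    by (simp add: radon_integral_real[OF c(1)] radon_integral_real[OF c(2)])
qed

end

text \<open>This comparison yields the absolute continuity that the Radon--Nikodym theorem asks for, and the
  bound from which the regularity of a complex measure is obtained.\<close>

lemma radon_mono:
  assumes "positive_functional X p" "positive_functional X q" and "0 \<le> c"
    and le: "\<And>\<phi>. \<phi> \<in> nonneg_continuous X \<Longrightarrow> q \<phi> \<le> c * p \<phi>"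
    and A: "A \<in> sets (borel_of X)"
  shows "measure (positive_functional.radon X q) A \<le> c * measure (positive_functional.radon X p) A"
proof -
  interpret p: positive_functional X p by fact
  interpret q: positive_functional X q by fact
  interpret mp: finite_measure p.radon by (rule p.finite_radon)
  interpret mq: finite_measure q.radon by (rule q.finite_radon)
  have content: "q.content U \<le> ennreal c * p.content U" for U
    unfolding q.content_def
  proof (rule SUP_least)
    fix \<phi> assume \<phi>: "\<phi> \<in> q.tests U"
    have "ennreal (q \<phi>) \<le> ennreal c * ennreal (p \<phi>)"
      using le[OF q.tests_nonneg[OF \<phi>]] p.nonneg[OF q.tests_nonneg[OF \<phi>]] \<open>0 \<le> c\<close>
      by (simp add: ennreal_leI flip: ennreal_mult)
    also have "\<dots> \<le> ennreal c * p.content U"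
      using p.content_upper[OF \<phi>] by (simp add: mult_left_mono)
    finally show "ennreal (q \<phi>) \<le> ennreal c * p.content U" .
  qed
  have A': "A \<in> sets p.radon" "A \<in> sets q.radon"
    using A by (simp_all add: p.sets_radon q.sets_radon)
  have "emeasure q.radon A \<le> ennreal c * emeasure p.radon A"
  proof (rule ennreal_le_epsilon)
    fix e :: real assume e: "0 < e"
    define d where "d = e / (c + 1)"
    have d: "0 < d" "c * d \<le> e" using e \<open>0 \<le> c\<close> by (auto simp: d_def field_simps)
    obtain U where U: "openin X U" "A \<subseteq> U" "p.content U \<le> p.outer A + ennreal d"
      using p.outer_approx[of A d] d(1) sets.sets_into_space[OF A'(1)] by (auto simp: p.space_radon)
    have "emeasure q.radon A \<le> emeasure q.radon U"
      using U q.open_radon by (intro emeasure_mono) auto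
    also have "\<dots> \<le> ennreal c * p.content U"
      using content U(1) by (simp add: q.emeasure_radon_open)
    also have "\<dots> \<le> ennreal c * (emeasure p.radon A + ennreal d)"
      using U(3) A' by (simp add: p.emeasure_radon mult_left_mono)
    also have "\<dots> = ennreal c * emeasure p.radon A + ennreal (c * d)"
      using \<open>0 \<le> c\<close> d(1) by (simp add: distrib_left ennreal_mult)
    also have "\<dots> \<le> ennreal c * emeasure p.radon A + ennreal e"
      using d(2) by (simp add: add_left_mono ennreal_leI)
    finally show "emeasure q.radon A \<le> ennreal c * emeasure p.radon A + ennreal e" .
  qed
  then show ?thesis
    using \<open>0 \<le> c\<close> by (simp add: mp.emeasure_eq_measure mq.emeasure_eq_measure flip: ennreal_mult)
qed

section \<open>Differences of positive measures as complex measures\<close>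

text \<open>The supremum that defines the positive part is attained at \<open>A \<inter> {k > 0}\<close>.\<close>

lemma positive_part_eq_density:
  assumes sets: "sets M = sets N" and k: "integrable N k"
    and \<mu>: "\<And>A. A \<in> sets M \<Longrightarrow> \<mu> A = (LINT x|N. indicator A x * k x)"
  shows "positive_part M \<mu> = density N (\<lambda>x. ennreal (k x))"
proof -
  have sp: "space M = space N"
    by (rule sets_eq_imp_space_eq[OF sets])
  have [measurable]: "k \<in> borel_measurable N"
    using k by auto
  have "(SUP B\<in>{B \<in> sets M. B \<subseteq> A}. ennreal (\<mu> B)) = (\<integral>\<^sup>+x. ennreal (k x) * indicator A x \<partial>N)"
    if A: "A \<in> sets M" for A
  proof (rule antisym)
    have [measurable]: "A \<in> sets N" using A sets by simp
    show "(SUP B\<in>{B \<in> sets M. B \<subseteq> A}. ennreal (\<mu> B)) \<le> (\<integral>\<^sup>+x. ennreal (k x) * indicator A x \<partial>N)"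
    proof (rule SUP_least)
      fix B assume B: "B \<in> {B \<in> sets M. B \<subseteq> A}"
      then have [measurable]: "B \<in> sets N" using sets by simp
      have i: "integrable N (\<lambda>x. indicator B x * k x)"
        using integrable_mult_indicator[OF _ k, of B] by simp
      have "ennreal (\<mu> B) = ennreal (LINT x|N. indicator B x * k x)"
        using B \<mu> by simp
      also have "\<dots> \<le> ennreal (LINT x|N. max 0 (indicator B x * k x))"
        using i by (intro ennreal_leI integral_mono) auto
      also have "\<dots> = (\<integral>\<^sup>+x. ennreal (max 0 (indicator B x * k x)) \<partial>N)"
        using i by (intro nn_integral_eq_integral[symmetric]) auto
      also have "\<dots> \<le> (\<integral>\<^sup>+x. ennreal (k x) * indicator A x \<partial>N)"
        using B by (intro nn_integral_mono) (auto simp: indicator_def max_def ennreal_neg)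
      finally show "ennreal (\<mu> B) \<le> (\<integral>\<^sup>+x. ennreal (k x) * indicator A x \<partial>N)" .
    qed
    define B where "B = {x \<in> space N. x \<in> A \<and> 0 < k x}"
    have [measurable]: "B \<in> sets N"
      unfolding B_def by measurable
    have i: "integrable N (\<lambda>x. indicator B x * k x)"
      using integrable_mult_indicator[OF _ k, of B] by simp
    have "(\<integral>\<^sup>+x. ennreal (k x) * indicator A x \<partial>N) = (\<integral>\<^sup>+x. ennreal (indicator B x * k x) \<partial>N)"
      by (intro nn_integral_cong) (auto simp: B_def indicator_def ennreal_neg)
    also have "\<dots> = ennreal (LINT x|N. indicator B x * k x)"
      using i by (intro nn_integral_eq_integral) (auto simp: B_def indicator_def)
    also have "\<dots> = ennreal (\<mu> B)"
      using \<mu>[of B] sets by simp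
    also have "\<dots> \<le> (SUP B\<in>{B \<in> sets M. B \<subseteq> A}. ennreal (\<mu> B))"
      using sets by (intro SUP_upper) (auto simp: B_def)
    finally show "(\<integral>\<^sup>+x. ennreal (k x) * indicator A x \<partial>N) \<le> (SUP B\<in>{B \<in> sets M. B \<subseteq> A}. ennreal (\<mu> B))" .
  qed
  then show ?thesis
    unfolding positive_part_def density_def sp[symmetric] sets[symmetric]
    by (intro measure_of_eq sets.space_closed) (simp add: sets.sigma_sets_eq)
qed

lemma signed_integral_density:
  fixes g :: "'a \<Rightarrow> complex"
  assumes sets: "sets M = sets N" and k: "integrable N k"
    and \<mu>: "\<And>A. A \<in> sets M \<Longrightarrow> \<mu> A = (LINT x|N. indicator A x * k x)"
    and g: "g \<in> borel_measurable N" "\<And>x. x \<in> space N \<Longrightarrow> cmod (g x) \<le> B"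
  shows "signed_integral M \<mu> g = (LINT x|N. k x *\<^sub>R g x)"
proof -
  have [measurable]: "k \<in> borel_measurable N" "g \<in> borel_measurable N"
    using k g by auto
  have 1: "positive_part M \<mu> = density N (\<lambda>x. ennreal (max 0 (k x)))"
    using positive_part_eq_density[OF sets k \<mu>] by (simp add: ennreal_max_0)
  have 2: "positive_part M (\<lambda>A. - \<mu> A) = density N (\<lambda>x. ennreal (max 0 (- k x)))"
    using positive_part_eq_density[OF sets integrable_minus[OF k], of "\<lambda>A. - \<mu> A"] \<mu>
    by (simp add: ennreal_max_0)
  have int: "integrable N (\<lambda>x. h x *\<^sub>R g x)"
    if [measurable]: "h \<in> borel_measurable N" and h: "\<And>x. \<bar>h x\<bar> \<le> \<bar>k x\<bar>" for h
  proof (rule Bochner_Integration.integrable_bound[of _ "\<lambda>x. \<bar>k x\<bar> * B"])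
    show "AE x in N. norm (h x *\<^sub>R g x) \<le> norm (\<bar>k x\<bar> * B)"
    proof (rule AE_I2)
      fix x assume "x \<in> space N"
      then have "cmod (g x) \<le> \<bar>B\<bar>"
        using g(2)[of x] by linarith
      then show "norm (h x *\<^sub>R g x) \<le> norm (\<bar>k x\<bar> * B)"
        using h[of x] by (simp add: abs_mult mult_mono)
    qed
  qed (use k in auto)
  have "signed_integral M \<mu> g
      = (LINT x|N. max 0 (k x) *\<^sub>R g x) - (LINT x|N. max 0 (- k x) *\<^sub>R g x)"
    unfolding signed_integral_def 1 2 by (simp add: integral_density)
  also have "\<dots> = (LINT x|N. max 0 (k x) *\<^sub>R g x - max 0 (- k x) *\<^sub>R g x)"
    by (rule Bochner_Integration.integral_diff[symmetric]) (auto intro!: int)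
  also have "\<dots> = (LINT x|N. k x *\<^sub>R g x)"
    by (rule Bochner_Integration.integral_cong) (auto simp: max_def simp flip: scaleR_diff_left)
  finally show ?thesis .
qed

text \<open>The Jordan decomposition of \<open>P - N\<close> becomes explicit once \<open>P\<close> has a density \<open>D\<close> with respect to \<open>N\<close>:
  the difference then has the density \<open>D - 1\<close>.\<close>

lemma signed_integral_diff:
  fixes g :: "'a \<Rightarrow> complex"
  assumes fin: "finite_measure N" "finite_measure P"
    and sets: "sets M = sets N" "sets P = sets N" and ac: "absolutely_continuous N P"
    and g: "g \<in> borel_measurable N" "\<And>x. x \<in> space N \<Longrightarrow> cmod (g x) \<le> B"
  shows "signed_integral M (\<lambda>A. measure P A - measure N A) g = integral\<^sup>L P g - integral\<^sup>L N g"
proof -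
  interpret N: finite_measure N by fact
  interpret P: finite_measure P by fact
  have [measurable]: "g \<in> borel_measurable N"
    using g by auto
  obtain D where D: "D \<in> borel_measurable N" "AE x in N. RN_deriv N P x = ennreal (D x)"
    "\<And>x. 0 \<le> D x"
    using N.real_RN_deriv[OF fin(2) ac sets(2)] by metis
  note [measurable] = D(1)
  have P_eq: "P = density N (\<lambda>x. ennreal (D x))"
    using N.density_RN_deriv[OF ac sets(2)] density_cong[OF _ _ D(2)] by simp
  have gb: "integrable N g" "integrable P g"
    using g(2) sets sets_eq_imp_space_eq[OF sets(2)]
    by (auto intro!: N.integrable_const_bound[where B = B] P.integrable_const_bound[where B = B]
        simp: measurable_cong_sets[OF sets(2) refl])
  have mP: "ennreal (measure P A) = (\<integral>\<^sup>+x. ennreal (indicator A x * D x) \<partial>N)" if [measurable]: "A \<in> sets N" for A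
  proof -
    have "ennreal (measure P A) = emeasure P A"
      by (simp add: P.emeasure_eq_measure)
    also have "\<dots> = (\<integral>\<^sup>+x. ennreal (indicator A x * D x) \<partial>N)"
      unfolding P_eq by (subst emeasure_density) (auto intro!: nn_integral_cong simp: indicator_def)
    finally show ?thesis .
  qed
  have iD: "integrable N D"
  proof (rule integrableI_nonneg)
    have "(\<integral>\<^sup>+x. ennreal (D x) \<partial>N) = (\<integral>\<^sup>+x. ennreal (indicator (space N) x * D x) \<partial>N)"
      by (intro nn_integral_cong) auto
    also have "\<dots> < \<infinity>"
      using mP[of "space N"] by (metis ennreal_less_top infinity_ennreal_def sets.top)
    finally show "(\<integral>\<^sup>+x. ennreal (D x) \<partial>N) < \<infinity>" .
  qed (use D(3) in auto)
  have mP': "measure P A = (LINT x|N. indicator A x * D x)" if A[measurable]: "A \<in> sets N" for A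
  proof -
    have "integrable N (\<lambda>x. indicator A x * D x)"
      using integrable_mult_indicator[OF A iD] by simp
    then have "ennreal (LINT x|N. indicator A x * D x) = ennreal (measure P A)"
      using D(3) by (subst mP[OF A]) (auto intro!: nn_integral_eq_integral[symmetric])
    then show ?thesis
      using D(3) by (subst (asm) ennreal_inj) (auto intro!: integral_nonneg_AE)
  qed
  have "signed_integral M (\<lambda>A. measure P A - measure N A) g = (LINT x|N. (D x - 1) *\<^sub>R g x)"
  proof (rule signed_integral_density[OF sets(1) _ _ g])
    show "integrable N (\<lambda>x. D x - 1)"
      using iD by auto
    fix A assume "A \<in> sets M"
    then have A: "A \<in> sets N" by (simp add: sets)
    have "(LINT x|N. indicator A x * (D x - 1)) = (LINT x|N. indicator A x * D x - indicator A x)"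
      by (simp add: right_diff_distrib)
    also have "\<dots> = (LINT x|N. indicator A x * D x) - (LINT x|N. indicator A x)"
    proof (rule Bochner_Integration.integral_diff)
      show "integrable N (\<lambda>x. indicator A x * D x)"
        using integrable_mult_indicator[OF A iD] by simp
      show "integrable N (indicat_real A)"
        using A by (intro integrable_real_indicator) (auto simp: N.emeasure_eq_measure)
    qed
    also have "(LINT x|N. indicat_real A x) = measure N A"
      using sets.sets_into_space[OF A] by (simp add: Int_absorb2)
    finally show "measure P A - measure N A = (LINT x|N. indicator A x * (D x - 1))"
      using mP'[OF A] by simp
  qed
  also have "\<dots> = (LINT x|N. D x *\<^sub>R g x - g x)"
    by (simp add: scaleR_diff_left)
  also have "\<dots> = (LINT x|N. D x *\<^sub>R g x) - integral\<^sup>L N g"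
  proof (rule Bochner_Integration.integral_diff[OF _ gb(1)])
    show "integrable N (\<lambda>x. D x *\<^sub>R g x)"
      using gb(2) unfolding P_eq using D(3) by (subst (asm) integrable_density) auto
  qed
  also have "(LINT x|N. D x *\<^sub>R g x) = integral\<^sup>L P g"
    unfolding P_eq using D(3) by (subst integral_density) auto
  finally show ?thesis .
qed

lemma complex_measure_empty:
  assumes "complex_measure M \<nu>"
  shows "\<nu> {} = 0"
proof -
  have "(\<lambda>n::nat. \<nu> {}) sums \<nu> (\<Union>n::nat. {})"
    using assms[unfolded complex_measure_def, rule_format, of "\<lambda>n. {}"]
    by (simp add: disjoint_family_on_def)
  then have "(\<lambda>n::nat. \<nu> {}) \<longlonglongrightarrow> 0"
    using sums_summable summable_LIMSEQ_zero by blast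
  then show ?thesis
    by (simp add: LIMSEQ_const_iff)
qed

lemma complex_measure_Un:
  assumes \<nu>: "complex_measure M \<nu>" and "A \<in> sets M" "B \<in> sets M" "A \<inter> B = {}"
  shows "\<nu> (A \<union> B) = \<nu> A + \<nu> B"
proof -
  have "range (binaryset A B) \<subseteq> sets M" "disjoint_family (binaryset A B)"
    using assms(2-4) by (auto simp: range_binaryset_eq disjoint_family_on_def binaryset_def)
  then have "(\<lambda>n. \<nu> (binaryset A B n)) sums \<nu> (\<Union>n. binaryset A B n)"
    using \<nu> unfolding complex_measure_def by blast
  moreover have "(\<lambda>n. \<nu> (binaryset A B n)) sums (\<nu> A + \<nu> B)"
    by (rule binaryset_sums) (rule complex_measure_empty[OF \<nu>])
  ultimately show ?thesis
    by (simp add: UN_binaryset_eq sums_unique2)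
qed

lemma total_variation_upper:
  assumes "range P \<subseteq> sets M" "disjoint_family P" "(\<Union>n. P n) = A"
  shows "(\<Sum>n. ennreal (cmod (\<nu> (P n)))) \<le> total_variation M \<nu> A"
  unfolding total_variation_def using assms by (intro SUP_upper) auto

lemma total_variation_mono:
  assumes "A \<in> sets M" "B \<in> sets M" "A \<subseteq> B"
  shows "total_variation M \<nu> A \<le> total_variation M \<nu> B"
proof (subst total_variation_def, rule SUP_least, clarsimp)
  fix P :: "nat \<Rightarrow> 'a set"
  assume P: "range P \<subseteq> sets M" "disjoint_family P" and A: "A = (\<Union>n. P n)"
  define Q where "Q n = (case n of 0 \<Rightarrow> B - A | Suc n \<Rightarrow> P n)" for n
  have "(\<Sum>n. ennreal (cmod (\<nu> (P n)))) = (\<Sum>n. ennreal (cmod (\<nu> (Q (Suc n)))))"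
    by (simp add: Q_def)
  also have "\<dots> \<le> (\<Sum>n. ennreal (cmod (\<nu> (Q n))))"
    by (subst (2) suminf_offset[of _ 1]) (auto simp: add_increasing)
  also have "\<dots> \<le> total_variation M \<nu> B"
  proof (rule total_variation_upper)
    show "range Q \<subseteq> sets M"
      using P assms by (auto simp: Q_def split: nat.splits)
    show "disjoint_family Q"
      using P(2) by (auto simp: disjoint_family_on_def Q_def A split: nat.splits)
    show "(\<Union>n. Q n) = B"
    proof -
      have "(\<Union>n. Q n) = Q 0 \<union> (\<Union>n. Q (Suc n))"
        by (metis UNIV_nat_eq UN_insert image_image)
      then show ?thesis
        using assms(3) by (auto simp: Q_def A)
    qed
  qed
  finally show "(\<Sum>n. ennreal (cmod (\<nu> (P n)))) \<le> total_variation M \<nu> B" .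
qed

lemma total_variation_Un:
  assumes \<nu>: "complex_measure M \<nu>" and AB: "A \<in> sets M" "B \<in> sets M" "A \<inter> B = {}"
  shows "total_variation M \<nu> (A \<union> B) \<le> total_variation M \<nu> A + total_variation M \<nu> B"
proof (subst total_variation_def, rule SUP_least, clarify)
  fix P :: "nat \<Rightarrow> 'a set"
  assume P: "range P \<subseteq> sets M" "disjoint_family P" "(\<Union>n. P n) = A \<union> B"
  have Pn: "P n \<in> sets M" for n using P(1) by auto
  have split: "\<nu> (P n) = \<nu> (P n \<inter> A) + \<nu> (P n \<inter> B)" for n
  proof -
    have "P n = (P n \<inter> A) \<union> (P n \<inter> B)"
      using P(3) by blast
    then show ?thesis
      using complex_measure_Un[OF \<nu>, of "P n \<inter> A" "P n \<inter> B"] Pn AB by auto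
  qed
  have "(\<Sum>n. ennreal (cmod (\<nu> (P n))))
      \<le> (\<Sum>n. ennreal (cmod (\<nu> (P n \<inter> A))) + ennreal (cmod (\<nu> (P n \<inter> B))))"
    by (intro suminf_le) (auto simp: split simp flip: ennreal_plus intro!: ennreal_leI norm_triangle_ineq)
  also have "\<dots> = (\<Sum>n. ennreal (cmod (\<nu> (P n \<inter> A)))) + (\<Sum>n. ennreal (cmod (\<nu> (P n \<inter> B))))"
    by (rule suminf_add[symmetric]) auto
  also have "\<dots> \<le> total_variation M \<nu> A + total_variation M \<nu> B"
  proof (intro add_mono total_variation_upper)
    show "range (\<lambda>n. P n \<inter> A) \<subseteq> sets M" "range (\<lambda>n. P n \<inter> B) \<subseteq> sets M"
      using Pn AB by auto
    show "disjoint_family (\<lambda>n. P n \<inter> A)" "disjoint_family (\<lambda>n. P n \<inter> B)"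
      using P(2) unfolding disjoint_family_on_def by blast+
    show "(\<Union>n. P n \<inter> A) = A" "(\<Union>n. P n \<inter> B) = B"
      using P(3) by blast+
  qed
  finally show "(\<Sum>n. ennreal (cmod (\<nu> (P n)))) \<le> total_variation M \<nu> A + total_variation M \<nu> B" .
qed

lemma total_variation_le:
  assumes fin: "finite_measure m" and sets: "sets m = sets M" and C: "0 \<le> C"
    and le: "\<And>A. A \<in> sets M \<Longrightarrow> cmod (\<nu> A) \<le> C * measure m A"
  shows "total_variation M \<nu> A \<le> ennreal (C * measure m A)"
proof (subst total_variation_def, rule SUP_least, clarify)
  interpret finite_measure m by fact
  fix P :: "nat \<Rightarrow> 'a set"
  assume P: "range P \<subseteq> sets M" "disjoint_family P"
  have "(\<Sum>n. ennreal (cmod (\<nu> (P n)))) \<le> (\<Sum>n. ennreal (C * measure m (P n)))"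
    using P le by (intro suminf_le ennreal_leI) auto
  also have "\<dots> = ennreal (C * measure m (\<Union>n. P n))"
    using P sets C by (intro suminf_ennreal_eq sums_mult finite_measure_UNION) auto
  finally show "(\<Sum>n. ennreal (cmod (\<nu> (P n)))) \<le> ennreal (C * measure m (\<Union>n. P n))" .
qed

text \<open>Since the total variation of \<open>\<nu>\<close> is subadditive and at most \<open>C * m\<close>, sets that are close in \<open>m\<close> have
  close total variations, and regularity is inherited from \<open>m\<close>. Inner approximation of \<open>A\<close> is outer
  approximation of its complement, closed sets being compact.\<close>

lemma regular_complex_borel_measureI:
  assumes X: "compact_space X" "Hausdorff_space X"
    and fin: "finite_measure m" and sets: "sets m = sets (borel_of X)"
    and reg: "\<And>A. A \<in> sets (borel_of X) \<Longrightarrow>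
      emeasure m A = (INF U\<in>{U. openin X U \<and> A \<subseteq> U}. emeasure m U)"
    and \<nu>: "complex_measure (borel_of X) \<nu>" and C: "0 \<le> C"
    and le: "\<And>A. A \<in> sets (borel_of X) \<Longrightarrow> cmod (\<nu> A) \<le> C * measure m A"
  shows "regular_complex_borel_measure X \<nu>"
  unfolding regular_complex_borel_measure_def
proof (intro conjI ballI \<nu>)
  interpret finite_measure m by fact
  let ?B = "borel_of X" and ?T = "total_variation (borel_of X) \<nu>"
  have open_sets: "U \<in> sets ?B" if "openin X U" for U
    unfolding borel_of_def using that openin_subset by (intro in_measure_of) auto
  have space: "space m = topspace X"
    using sets_eq_imp_space_eq[OF sets] openin_subset by (auto simp: borel_of_def space_measure_of_conv)
  have compact_sets: "K \<in> sets ?B" if "compactin X K" for K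
  proof -
    have "closedin X K" using that X(2) compactin_imp_closedin by blast
    then have "topspace X - (topspace X - K) = K" "openin X (topspace X - K)"
      by (auto simp: closedin_def)
    then show ?thesis
      using sets.compl_sets[of "topspace X - K" m] open_sets sets space by metis
  qed
  have approx: "\<exists>U. openin X U \<and> A \<subseteq> U \<and> measure m (U - A) \<le> d" if A: "A \<in> sets ?B" and d: "0 < d" for A d
  proof -
    have "emeasure m A < emeasure m A + ennreal d"
      using d by (simp add: emeasure_eq_measure ennreal_less_iff flip: ennreal_plus)
    then obtain U where U: "openin X U" "A \<subseteq> U" "emeasure m U < emeasure m A + ennreal d"
      using reg[OF A] by (auto simp: INF_less_iff)
    then have "measure m U \<le> measure m A + d"
      using d by (simp add: emeasure_eq_measure ennreal_less_iff flip: ennreal_plus)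
    then have "measure m (U - A) \<le> d"
      using U open_sets[OF U(1)] A sets by (simp add: finite_measure_Diff)
    then show ?thesis using U by blast
  qed
  fix A assume A: "A \<in> sets ?B"
  have Asub: "A \<subseteq> topspace X"
    using sets.sets_into_space[of A m] A sets space by simp
  have eps: "\<exists>d>0. C * d \<le> e" if "0 < e" for e :: real
    using C that by (intro exI[of _ "e / (C + 1)"]) (auto simp: field_simps)
  have diff: "?T V \<le> ?T W + ennreal e"
    if "V \<in> sets ?B" "W \<in> sets ?B" "W \<subseteq> V" "measure m (V - W) \<le> d" "C * d \<le> e" for V W d e
  proof -
    have "?T (W \<union> (V - W)) \<le> ?T W + ?T (V - W)"
      using that by (intro total_variation_Un[OF \<nu>]) auto
    also have "?T (V - W) \<le> ennreal (C * measure m (V - W))"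
      by (rule total_variation_le[OF fin sets C le])
    also have "\<dots> \<le> ennreal e"
      using that C by (intro ennreal_leI) (meson mult_left_mono order_trans)
    finally show ?thesis
      using that(3) by (simp add: add_left_mono Un_absorb1)
  qed
  show "?T A = (INF U\<in>{U. openin X U \<and> A \<subseteq> U}. ?T U)"
  proof (rule antisym)
    show "?T A \<le> (INF U\<in>{U. openin X U \<and> A \<subseteq> U}. ?T U)"
      using A open_sets by (intro INF_greatest total_variation_mono) auto
    show "(INF U\<in>{U. openin X U \<and> A \<subseteq> U}. ?T U) \<le> ?T A"
    proof (rule ennreal_le_epsilon)
      fix e :: real assume "0 < e"
      then obtain d where d: "0 < d" "C * d \<le> e" using eps by blast
      then obtain U where U: "openin X U" "A \<subseteq> U" "measure m (U - A) \<le> d"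
        using approx[OF A] by blast
      have "(INF U\<in>{U. openin X U \<and> A \<subseteq> U}. ?T U) \<le> ?T U"
        using U by (intro INF_lower) auto
      also have "\<dots> \<le> ?T A + ennreal e"
        using diff[OF open_sets[OF U(1)] A U(2,3) d(2)] .
      finally show "(INF U\<in>{U. openin X U \<and> A \<subseteq> U}. ?T U) \<le> ?T A + ennreal e" .
    qed
  qed
  show "?T A = (SUP K\<in>{K. compactin X K \<and> K \<subseteq> A}. ?T K)"
  proof (rule antisym)
    show "(SUP K\<in>{K. compactin X K \<and> K \<subseteq> A}. ?T K) \<le> ?T A"
      using A compact_sets by (intro SUP_least total_variation_mono) auto
    show "?T A \<le> (SUP K\<in>{K. compactin X K \<and> K \<subseteq> A}. ?T K)"
    proof (rule ennreal_le_epsilon)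
      fix e :: real assume "0 < e"
      then obtain d where d: "0 < d" "C * d \<le> e" using eps by blast
      have "topspace X - A \<in> sets ?B"
        using sets.compl_sets[of A m] A sets space by simp
      then obtain U where U: "openin X U" "topspace X - A \<subseteq> U" "measure m (U - (topspace X - A)) \<le> d"
        using approx d(1) by blast
      define K where "K = topspace X - U"
      have "closedin X K" unfolding K_def using U(1) by blast
      then have K: "compactin X K" "K \<subseteq> A"
        using X(1) closedin_compact_space U(2) by (auto simp: K_def)
      have "A - K = U - (topspace X - A)"
        using openin_subset[OF U(1)] Asub by (auto simp: K_def)
      then have "?T A \<le> ?T K + ennreal e"
        using diff[OF A compact_sets[OF K(1)] K(2) _ d(2)] U(3) by simp
      also have "?T K \<le> (SUP K\<in>{K. compactin X K \<and> K \<subseteq> A}. ?T K)"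
        using K by (intro SUP_upper) auto
      finally show "?T A \<le> (SUP K\<in>{K. compactin X K \<and> K \<subseteq> A}. ?T K) + ennreal e"
        by (simp add: add_right_mono)
    qed
  qed
qed

section \<open>The Riesz theorem for complex functionals\<close>

lemma continuous_map_of_real:
  "continuous_map X euclideanreal h \<Longrightarrow> continuous_map X euclidean (\<lambda>x. complex_of_real (h x))"
  by (simp add: continuous_map_atin tendsto_of_real)

lemma continuous_map_mult_complex [continuous_intros]:
  fixes f g :: "'a \<Rightarrow> complex"
  shows "continuous_map X euclidean f \<Longrightarrow> continuous_map X euclidean g
    \<Longrightarrow> continuous_map X euclidean (\<lambda>x. f x * g x)"
  by (simp add: continuous_map_atin tendsto_mult)

text \<open>A bounded linear functional on \<open>C(X)\<close>, given on all functions and constrained on the continuous ones.\<close>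

locale bounded_functional =
  fixes X :: "'a topology" and \<Lambda> :: "('a \<Rightarrow> complex) \<Rightarrow> complex" and C :: real
  assumes compact: "compact_space X" and hausdorff: "Hausdorff_space X"
    and add: "continuous_map X euclidean \<phi> \<Longrightarrow> continuous_map X euclidean \<psi>
      \<Longrightarrow> \<Lambda> (\<lambda>x. \<phi> x + \<psi> x) = \<Lambda> \<phi> + \<Lambda> \<psi>"
    and scale: "continuous_map X euclidean \<phi> \<Longrightarrow> \<Lambda> (\<lambda>x. c * \<phi> x) = c * \<Lambda> \<phi>"
    and bound: "continuous_map X euclidean \<phi> \<Longrightarrow> 0 \<le> B \<Longrightarrow> (\<And>x. x \<in> topspace X \<Longrightarrow> cmod (\<phi> x) \<le> B)
      \<Longrightarrow> cmod (\<Lambda> \<phi>) \<le> C * B"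
begin

definition dominated :: "('a \<Rightarrow> real) \<Rightarrow> ('a \<Rightarrow> complex) set" where
  "dominated \<phi> = {\<psi>. continuous_map X euclidean \<psi> \<and> (\<forall>x\<in>topspace X. cmod (\<psi> x) \<le> \<phi> x)}"

text \<open>The variation \<open>|\<Lambda>|\<close>, the least positive functional that dominates \<open>\<Lambda>\<close>.\<close>

definition variation :: "('a \<Rightarrow> real) \<Rightarrow> real" where
  "variation \<phi> = (SUP \<psi>\<in>dominated \<phi>. cmod (\<Lambda> \<psi>))"

lemma C_nonneg: "0 \<le> C"
proof -
  have "cmod (\<Lambda> (\<lambda>x. 0)) \<le> C * 1"
    by (rule bound) auto
  then show ?thesis
    using order_trans[OF norm_ge_zero] by fastforce
qed

lemma dominated_bdd:
  assumes "\<phi> \<in> nonneg_continuous X"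
  shows "bdd_above ((\<lambda>\<psi>. cmod (\<Lambda> \<psi>)) ` dominated \<phi>)"
proof -
  obtain B where B: "\<And>x. x \<in> topspace X \<Longrightarrow> \<bar>\<phi> x\<bar> \<le> B" "0 < B"
    using assms continuous_map_compact_bounded[OF compact, of \<phi>] by (auto simp: nonneg_continuous_def)
  have "cmod (\<Lambda> \<psi>) \<le> C * B" if "\<psi> \<in> dominated \<phi>" for \<psi>
    using that B by (intro bound) (force simp: dominated_def)+
  then show ?thesis
    by (auto intro!: bdd_aboveI2)
qed

lemma zero_dominated: "\<phi> \<in> nonneg_continuous X \<Longrightarrow> (\<lambda>x. 0) \<in> dominated \<phi>"
  by (simp add: dominated_def nonneg_continuous_def)

lemma variation_upper: "\<phi> \<in> nonneg_continuous X \<Longrightarrow> \<psi> \<in> dominated \<phi> \<Longrightarrow> cmod (\<Lambda> \<psi>) \<le> variation \<phi>"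
  unfolding variation_def by (intro cSUP_upper dominated_bdd)

lemma variation_least:
  "\<phi> \<in> nonneg_continuous X \<Longrightarrow> (\<And>\<psi>. \<psi> \<in> dominated \<phi> \<Longrightarrow> cmod (\<Lambda> \<psi>) \<le> b) \<Longrightarrow> variation \<phi> \<le> b"
  unfolding variation_def using zero_dominated by (intro cSUP_least) auto

lemma variation_nonneg: "\<phi> \<in> nonneg_continuous X \<Longrightarrow> 0 \<le> variation \<phi>"
  using order_trans[OF norm_ge_zero variation_upper[OF _ zero_dominated]] .

lemma variation_scale_le:
  assumes \<phi>: "\<phi> \<in> nonneg_continuous X" and c: "0 < c"
  shows "variation (\<lambda>x. c * \<phi> x) \<le> c * variation \<phi>"
proof (rule variation_least)
  show "(\<lambda>x. c * \<phi> x) \<in> nonneg_continuous X"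
    using \<phi> c by (auto simp: nonneg_continuous_def intro!: continuous_intros)
  fix \<psi> assume \<psi>: "\<psi> \<in> dominated (\<lambda>x. c * \<phi> x)"
  let ?\<psi> = "\<lambda>x. complex_of_real (inverse c) * \<psi> x"
  have "?\<psi> \<in> dominated \<phi>"
    unfolding dominated_def
  proof (intro CollectI conjI ballI)
    show "continuous_map X euclidean ?\<psi>"
      using \<psi> unfolding dominated_def by (intro continuous_intros) auto
    fix x assume "x \<in> topspace X"
    then have "cmod (\<psi> x) \<le> c * \<phi> x"
      using \<psi> by (simp add: dominated_def)
    then show "cmod (?\<psi> x) \<le> \<phi> x"
      using c by (simp add: norm_divide field_simps)
  qed
  then have "cmod (\<Lambda> ?\<psi>) \<le> variation \<phi>"
    by (rule variation_upper[OF \<phi>])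
  moreover have "\<Lambda> ?\<psi> = complex_of_real (inverse c) * \<Lambda> \<psi>"
    using \<psi> by (intro scale) (simp add: dominated_def)
  ultimately have "cmod (complex_of_real (inverse c) * \<Lambda> \<psi>) \<le> variation \<phi>"
    by metis
  then show "cmod (\<Lambda> \<psi>) \<le> c * variation \<phi>"
    using c by (simp add: norm_divide field_simps)
qed

lemma variation_scale:
  assumes \<phi>: "\<phi> \<in> nonneg_continuous X" and c: "0 \<le> c"
  shows "variation (\<lambda>x. c * \<phi> x) = c * variation \<phi>"
proof (cases "c = 0")
  case True
  have z: "(\<lambda>x. 0) \<in> nonneg_continuous X"
    by (simp add: nonneg_continuous_def)
  have "variation (\<lambda>x. 0) \<le> C * 0"
    by (rule variation_least[OF z]) (rule bound, auto simp: dominated_def)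
  then show ?thesis
    using True variation_nonneg[OF z] by simp
next
  case False
  with c have c: "0 < c" by simp
  have c\<phi>: "(\<lambda>x. c * \<phi> x) \<in> nonneg_continuous X"
    using \<phi> c by (auto simp: nonneg_continuous_def intro!: continuous_intros)
  have "variation (\<lambda>x. inverse c * (c * \<phi> x)) \<le> inverse c * variation (\<lambda>x. c * \<phi> x)"
    using c by (intro variation_scale_le[OF c\<phi>]) auto
  then have "c * variation \<phi> \<le> variation (\<lambda>x. c * \<phi> x)"
    using c by (simp add: field_simps)
  with variation_scale_le[OF \<phi> c] show ?thesis
    by (rule antisym)
qed

text \<open>For \<open>\<ge>\<close>, competitors for \<open>\<phi>1\<close> and \<open>\<phi>2\<close> are multiplied by unimodular constants that make both values
  of \<open>\<Lambda>\<close> positive, and are added. For \<open>\<le>\<close>, a competitor \<open>\<psi>\<close> for the sum is shared out in the proportion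
  of \<open>\<phi>1\<close> to \<open>\<phi>2\<close>. Dividing by \<open>\<phi>1 + \<phi>2 + d\<close> keeps the shares continuous at common zeros of \<open>\<phi>1\<close> and \<open>\<phi>2\<close>,
  and leaves a remainder that is bounded by \<open>d\<close>.\<close>

lemma variation_add:
  assumes \<phi>1: "\<phi>1 \<in> nonneg_continuous X" and \<phi>2: "\<phi>2 \<in> nonneg_continuous X"
  shows "variation (\<lambda>x. \<phi>1 x + \<phi>2 x) = variation \<phi>1 + variation \<phi>2"
proof (rule antisym)
  have sum: "(\<lambda>x. \<phi>1 x + \<phi>2 x) \<in> nonneg_continuous X"
    using \<phi>1 \<phi>2 by (auto simp: nonneg_continuous_def intro!: continuous_intros)
  note c1 = \<phi>1[unfolded nonneg_continuous_def, simplified] and c2 = \<phi>2[unfolded nonneg_continuous_def, simplified]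
  show "variation (\<lambda>x. \<phi>1 x + \<phi>2 x) \<le> variation \<phi>1 + variation \<phi>2"
  proof (rule variation_least[OF sum])
    fix \<psi> assume \<psi>: "\<psi> \<in> dominated (\<lambda>x. \<phi>1 x + \<phi>2 x)"
    then have \<psi>c: "continuous_map X euclidean \<psi>" and \<psi>b: "\<And>x. x \<in> topspace X \<Longrightarrow> cmod (\<psi> x) \<le> \<phi>1 x + \<phi>2 x"
      by (auto simp: dominated_def)
    show "cmod (\<Lambda> \<psi>) \<le> variation \<phi>1 + variation \<phi>2"
    proof (rule field_le_epsilon)
      fix e :: real assume e: "0 < e"
      define d where "d = e / (C + 1)"
      have d: "0 < d" "C * d \<le> e"
        using e C_nonneg by (auto simp: d_def field_simps)
      define w where "w \<phi> x = \<phi> x / (\<phi>1 x + \<phi>2 x + d)" for \<phi> :: "'a \<Rightarrow> real" and x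
      have pos: "0 < \<phi>1 x + \<phi>2 x + d" if "x \<in> topspace X" for x
        using c1 c2 d(1) that by (simp add: add_nonneg_pos)
      have wc: "continuous_map X euclideanreal (w \<phi>)" if "continuous_map X euclideanreal \<phi>" for \<phi>
        unfolding w_def using c1 c2 that by (intro continuous_intros) (auto dest: pos)
      have wpc: "continuous_map X euclidean (\<lambda>x. \<psi> x * complex_of_real (w \<phi> x))"
        if "continuous_map X euclideanreal \<phi>" for \<phi>
        using \<psi>c continuous_map_of_real[OF wc[OF that]] by (intro continuous_intros)
      have norm_eq: "cmod (\<psi> x * complex_of_real (w \<phi> x)) = cmod (\<psi> x) * \<phi> x / (\<phi>1 x + \<phi>2 x + d)"
        if "0 \<le> \<phi> x" "x \<in> topspace X" for \<phi> x
      proof -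
        have "cmod (\<psi> x * complex_of_real (w \<phi> x)) = cmod (\<psi> x) * \<bar>w \<phi> x\<bar>"
          by (simp add: norm_mult)
        then show ?thesis
          using that pos[OF that(2)] by (simp add: w_def)
      qed
      have dom: "(\<lambda>x. \<psi> x * complex_of_real (w \<phi> x)) \<in> dominated \<phi>" if "\<phi> \<in> nonneg_continuous X" for \<phi>
      proof -
        have "cmod (\<psi> x * complex_of_real (w \<phi> x)) \<le> \<phi> x" if x: "x \<in> topspace X" for x
        proof -
          have "0 \<le> \<phi> x" using \<open>\<phi> \<in> _\<close> x by (simp add: nonneg_continuous_def)
          moreover have "cmod (\<psi> x) * \<phi> x \<le> (\<phi>1 x + \<phi>2 x + d) * \<phi> x"
            using \<psi>b[OF x] d(1) calculation by (intro mult_right_mono) auto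
          ultimately show ?thesis
            using pos[OF x] x by (simp add: norm_eq pos_divide_le_eq mult.commute)
        qed
        then show ?thesis
          using wpc that by (simp add: dominated_def nonneg_continuous_def)
      qed
      have wd: "cmod (\<psi> x * complex_of_real (w (\<lambda>x. d) x)) \<le> d" if x: "x \<in> topspace X" for x
      proof -
        have "cmod (\<psi> x) * d \<le> (\<phi>1 x + \<phi>2 x + d) * d"
          using \<psi>b[OF x] d(1) by (intro mult_right_mono) auto
        then show ?thesis
          using pos[OF x] x d(1) norm_eq[of "\<lambda>x. d" x] by (simp add: pos_divide_le_eq mult.commute)
      qed
      have \<psi>_eq: "\<psi> x = \<psi> x * complex_of_real (w \<phi>1 x) + (\<psi> x * complex_of_real (w \<phi>2 x)
          + \<psi> x * complex_of_real (w (\<lambda>x. d) x))" if x: "x \<in> topspace X" for x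
      proof -
        have "w \<phi>1 x + w \<phi>2 x + w (\<lambda>x. d) x = 1"
          unfolding w_def using pos[OF x] by (simp flip: add_divide_distrib)
        then have "complex_of_real (w \<phi>1 x) + complex_of_real (w \<phi>2 x) + complex_of_real (w (\<lambda>x. d) x) = 1"
          by (metis of_real_1 of_real_add)
        then show ?thesis
          by (simp add: add.assoc flip: distrib_left)
      qed
      let ?f = "\<lambda>\<phi> x. \<psi> x * complex_of_real (w \<phi> x)"
      have f_cont: "continuous_map X euclidean (?f \<phi>1)" "continuous_map X euclidean (?f \<phi>2)"
          "continuous_map X euclidean (?f (\<lambda>x. d))"
        using wpc c1 c2 by auto
      have diff0: "cmod (\<Lambda> (\<lambda>x. \<psi> x + - 1 * (?f \<phi>1 x + (?f \<phi>2 x + ?f (\<lambda>x. d) x)))) \<le> C * 0"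
      proof (rule bound)
        show "continuous_map X euclidean (\<lambda>x. \<psi> x + - 1 * (?f \<phi>1 x + (?f \<phi>2 x + ?f (\<lambda>x. d) x)))"
          by (intro continuous_map_add continuous_map_mult_complex \<psi>c f_cont) simp
        fix x assume x: "x \<in> topspace X"
        show "cmod (\<psi> x + - 1 * (?f \<phi>1 x + (?f \<phi>2 x + ?f (\<lambda>x. d) x))) \<le> 0"
          unfolding \<psi>_eq[OF x, symmetric] by simp
      qed simp
      have "\<Lambda> (\<lambda>x. \<psi> x + - 1 * (?f \<phi>1 x + (?f \<phi>2 x + ?f (\<lambda>x. d) x)))
          = \<Lambda> \<psi> + - 1 * (\<Lambda> (?f \<phi>1) + (\<Lambda> (?f \<phi>2) + \<Lambda> (?f (\<lambda>x. d))))"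
      proof -
        have f23: "continuous_map X euclidean (\<lambda>x. ?f \<phi>2 x + ?f (\<lambda>x. d) x)"
          by (rule continuous_map_add[OF f_cont(2,3)])
        have f123: "continuous_map X euclidean (\<lambda>x. ?f \<phi>1 x + (?f \<phi>2 x + ?f (\<lambda>x. d) x))"
          by (rule continuous_map_add[OF f_cont(1) f23])
        have "\<Lambda> (\<lambda>x. \<psi> x + - 1 * (?f \<phi>1 x + (?f \<phi>2 x + ?f (\<lambda>x. d) x)))
          = \<Lambda> \<psi> + \<Lambda> (\<lambda>x. - 1 * (?f \<phi>1 x + (?f \<phi>2 x + ?f (\<lambda>x. d) x)))"
          by (rule add[OF \<psi>c]) (intro continuous_map_mult_complex f123, simp)
        then show ?thesis
          unfolding scale[OF f123] add[OF f_cont(1) f23] add[OF f_cont(2,3)] .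
      qed
      with diff0 have "\<Lambda> \<psi> + - 1 * (\<Lambda> (?f \<phi>1) + (\<Lambda> (?f \<phi>2) + \<Lambda> (?f (\<lambda>x. d)))) = 0"
        by (simp only: mult_zero_right norm_le_zero_iff)
      then have "\<Lambda> \<psi> = \<Lambda> (?f \<phi>1) + (\<Lambda> (?f \<phi>2) + \<Lambda> (?f (\<lambda>x. d)))"
        by (simp only: mult_minus1 add_uminus_conv_diff right_minus_eq)
      then have "cmod (\<Lambda> \<psi>) \<le> cmod (\<Lambda> (?f \<phi>1)) + cmod (\<Lambda> (?f \<phi>2) + \<Lambda> (?f (\<lambda>x. d)))"
        by (simp only: norm_triangle_ineq)
      also have "\<dots> \<le> cmod (\<Lambda> (?f \<phi>1)) + (cmod (\<Lambda> (?f \<phi>2)) + cmod (\<Lambda> (?f (\<lambda>x. d))))"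
        by (intro add_left_mono norm_triangle_ineq)
      also have "\<dots> \<le> variation \<phi>1 + (variation \<phi>2 + C * d)"
        using \<phi>1 \<phi>2 dom wd wpc d(1) by (intro add_mono variation_upper bound) auto
      also have "\<dots> \<le> variation \<phi>1 + variation \<phi>2 + e"
        using d(2) by simp
      finally show "cmod (\<Lambda> \<psi>) \<le> variation \<phi>1 + variation \<phi>2 + e" .
    qed
  qed
  show "variation \<phi>1 + variation \<phi>2 \<le> variation (\<lambda>x. \<phi>1 x + \<phi>2 x)"
  proof -
    have unimodular: "\<exists>a. cmod a = 1 \<and> a * z = complex_of_real (cmod z)" for z
      using complex_norm_square[of z]
      by (intro exI[of _ "if z = 0 then 1 else cnj z / cmod z"])
        (auto simp: norm_divide field_simps power2_eq_square)
    have key: "cmod (\<Lambda> \<psi>1) + cmod (\<Lambda> \<psi>2) \<le> variation (\<lambda>x. \<phi>1 x + \<phi>2 x)"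
      if \<psi>: "\<psi>1 \<in> dominated \<phi>1" "\<psi>2 \<in> dominated \<phi>2" for \<psi>1 \<psi>2
    proof -
      obtain a b where a: "cmod a = 1" "a * \<Lambda> \<psi>1 = complex_of_real (cmod (\<Lambda> \<psi>1))"
        and b: "cmod b = 1" "b * \<Lambda> \<psi>2 = complex_of_real (cmod (\<Lambda> \<psi>2))"
        using unimodular by metis
      have c: "continuous_map X euclidean \<psi>1" "continuous_map X euclidean \<psi>2"
        using \<psi> by (auto simp: dominated_def)
      have "\<Lambda> (\<lambda>x. a * \<psi>1 x + b * \<psi>2 x) = \<Lambda> (\<lambda>x. a * \<psi>1 x) + \<Lambda> (\<lambda>x. b * \<psi>2 x)"
        using c by (intro add continuous_intros)
      also have "\<dots> = complex_of_real (cmod (\<Lambda> \<psi>1) + cmod (\<Lambda> \<psi>2))"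
        using c by (simp add: scale a b)
      finally have "cmod (\<Lambda> (\<lambda>x. a * \<psi>1 x + b * \<psi>2 x)) = cmod (\<Lambda> \<psi>1) + cmod (\<Lambda> \<psi>2)"
        by (metis abs_of_nonneg add_nonneg_nonneg norm_ge_zero norm_of_real)
      moreover have "(\<lambda>x. a * \<psi>1 x + b * \<psi>2 x) \<in> dominated (\<lambda>x. \<phi>1 x + \<phi>2 x)"
        unfolding dominated_def
      proof (intro CollectI conjI ballI)
        show "continuous_map X euclidean (\<lambda>x. a * \<psi>1 x + b * \<psi>2 x)"
          using c by (intro continuous_intros)
        fix x assume "x \<in> topspace X"
        then have "cmod (\<psi>1 x) \<le> \<phi>1 x" "cmod (\<psi>2 x) \<le> \<phi>2 x"
          using \<psi> by (auto simp: dominated_def)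
        moreover have "cmod (a * \<psi>1 x + b * \<psi>2 x) \<le> cmod (\<psi>1 x) + cmod (\<psi>2 x)"
          using norm_triangle_ineq[of "a * \<psi>1 x" "b * \<psi>2 x"] a b by (simp add: norm_mult)
        ultimately show "cmod (a * \<psi>1 x + b * \<psi>2 x) \<le> \<phi>1 x + \<phi>2 x"
          by simp
      qed
      ultimately show ?thesis
        using variation_upper[OF sum] by metis
    qed
    have "variation \<phi>1 \<le> variation (\<lambda>x. \<phi>1 x + \<phi>2 x) - variation \<phi>2"
    proof (rule variation_least[OF \<phi>1])
      fix \<psi>1 assume \<psi>1: "\<psi>1 \<in> dominated \<phi>1"
      have "variation \<phi>2 \<le> variation (\<lambda>x. \<phi>1 x + \<phi>2 x) - cmod (\<Lambda> \<psi>1)"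
        by (rule variation_least[OF \<phi>2]) (use key[OF \<psi>1] in \<open>auto simp: algebra_simps\<close>)
      then show "cmod (\<Lambda> \<psi>1) \<le> variation (\<lambda>x. \<phi>1 x + \<phi>2 x) - variation \<phi>2"
        by simp
    qed
    then show ?thesis by simp
  qed
qed

lemma of_real_dominated:
  assumes "\<phi> \<in> nonneg_continuous X"
  shows "(\<lambda>x. complex_of_real (\<phi> x)) \<in> dominated \<phi>"
  using assms by (auto simp: dominated_def nonneg_continuous_def continuous_map_of_real)

text \<open>The cases of interest are \<open>r = 0\<close>, \<open>r = Re\<close> and \<open>r = Im\<close>: the functionals \<open>|\<Lambda>|\<close>, \<open>|\<Lambda>| + Re \<Lambda>\<close> and \<open>|\<Lambda>| + Im \<Lambda>\<close>
  are positive, and \<open>\<Lambda>\<close> is recovered from their differences.\<close>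

lemma positive_functional_variation_plus:
  fixes r :: "complex \<Rightarrow> real"
  assumes r: "linear r" "\<And>z. \<bar>r z\<bar> \<le> cmod z"
  shows "positive_functional X (\<lambda>\<phi>. variation \<phi> + r (\<Lambda> (\<lambda>x. complex_of_real (\<phi> x))))"
proof
  show "compact_space X" "Hausdorff_space X"
    by (rule compact hausdorff)+
next
  fix \<phi> assume \<phi>: "\<phi> \<in> nonneg_continuous X"
  show "0 \<le> variation \<phi> + r (\<Lambda> (\<lambda>x. complex_of_real (\<phi> x)))"
    using r(2)[of "\<Lambda> (\<lambda>x. complex_of_real (\<phi> x))"] variation_upper[OF \<phi> of_real_dominated[OF \<phi>]]
    by linarith
next
  fix \<phi> \<psi> assume \<phi>: "\<phi> \<in> nonneg_continuous X" and \<psi>: "\<psi> \<in> nonneg_continuous X"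
  then have "\<Lambda> (\<lambda>x. complex_of_real (\<phi> x) + complex_of_real (\<psi> x))
      = \<Lambda> (\<lambda>x. complex_of_real (\<phi> x)) + \<Lambda> (\<lambda>x. complex_of_real (\<psi> x))"
    by (intro add) (auto simp: nonneg_continuous_def continuous_map_of_real)
  then show "variation (\<lambda>x. \<phi> x + \<psi> x) + r (\<Lambda> (\<lambda>x. complex_of_real (\<phi> x + \<psi> x)))
      = variation \<phi> + r (\<Lambda> (\<lambda>x. complex_of_real (\<phi> x))) + (variation \<psi> + r (\<Lambda> (\<lambda>x. complex_of_real (\<psi> x))))"
    by (simp add: variation_add[OF \<phi> \<psi>] linear_add[OF r(1)])
next
  fix \<phi> and c :: real assume \<phi>: "\<phi> \<in> nonneg_continuous X" and c: "0 \<le> c"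
  have "\<Lambda> (\<lambda>x. complex_of_real c * complex_of_real (\<phi> x)) = c *\<^sub>R \<Lambda> (\<lambda>x. complex_of_real (\<phi> x))"
    using \<phi> by (subst scale) (auto simp: nonneg_continuous_def continuous_map_of_real scaleR_conv_of_real)
  then show "variation (\<lambda>x. c * \<phi> x) + r (\<Lambda> (\<lambda>x. complex_of_real (c * \<phi> x)))
      = c * (variation \<phi> + r (\<Lambda> (\<lambda>x. complex_of_real (\<phi> x))))"
    by (simp add: variation_scale[OF \<phi> c] linear_scale[OF r(1)] distrib_left)
qed

text \<open>If \<open>m0\<close>, \<open>m1\<close>, \<open>m2\<close> are the positive measures of \<open>|\<Lambda>|\<close>, \<open>|\<Lambda>| + Re \<Lambda>\<close> and \<open>|\<Lambda>| + Im \<Lambda>\<close>, then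
  \<open>\<nu> = (m1 - m0) + \<i> (m2 - m0)\<close> represents \<open>\<Lambda>\<close>. Both \<open>m1\<close> and \<open>m2\<close> are at most \<open>2 m0\<close>, whence \<open>|\<nu>| \<le> 2 m0\<close>.\<close>

theorem riesz_representation:
  obtains \<nu> where "regular_complex_borel_measure X \<nu>"
    "\<And>\<phi>. continuous_map X euclidean \<phi> \<Longrightarrow> complex_measure_integral (borel_of X) \<nu> \<phi> = \<Lambda> \<phi>"
proof -
  define p1 where "p1 \<phi> = variation \<phi> + Re (\<Lambda> (\<lambda>x. complex_of_real (\<phi> x)))" for \<phi>
  define p2 where "p2 \<phi> = variation \<phi> + Im (\<Lambda> (\<lambda>x. complex_of_real (\<phi> x)))" for \<phi>
  interpret p0: positive_functional X variation
    using positive_functional_variation_plus[of "\<lambda>z. 0"] by (simp add: linear_iff)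
  interpret p1: positive_functional X p1
    unfolding p1_def by (rule positive_functional_variation_plus) (auto simp: linear_iff abs_Re_le_cmod)
  interpret p2: positive_functional X p2
    unfolding p2_def by (rule positive_functional_variation_plus) (auto simp: linear_iff abs_Im_le_cmod)
  let ?B = "borel_of X" and ?m = "measure p0.radon"
  have \<Lambda>_le: "cmod (\<Lambda> (\<lambda>x. complex_of_real (\<phi> x))) \<le> variation \<phi>" if "\<phi> \<in> nonneg_continuous X" for \<phi>
    by (rule variation_upper[OF that of_real_dominated[OF that]])
  have le1: "measure p1.radon A \<le> 2 * ?m A" if "A \<in> sets ?B" for A
  proof (rule radon_mono[OF p0.positive_functional_axioms p1.positive_functional_axioms _ _ that])
    fix \<phi> assume "\<phi> \<in> nonneg_continuous X"
    then show "p1 \<phi> \<le> 2 * variation \<phi>"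
      using \<Lambda>_le[of \<phi>] abs_Re_le_cmod[of "\<Lambda> (\<lambda>x. complex_of_real (\<phi> x))"] unfolding p1_def by linarith
  qed simp
  have le2: "measure p2.radon A \<le> 2 * ?m A" if "A \<in> sets ?B" for A
  proof (rule radon_mono[OF p0.positive_functional_axioms p2.positive_functional_axioms _ _ that])
    fix \<phi> assume "\<phi> \<in> nonneg_continuous X"
    then show "p2 \<phi> \<le> 2 * variation \<phi>"
      using \<Lambda>_le[of \<phi>] abs_Im_le_cmod[of "\<Lambda> (\<lambda>x. complex_of_real (\<phi> x))"] unfolding p2_def by linarith
  qed simp
  have ac: "absolutely_continuous p0.radon (positive_functional.radon X q)"
    if q: "positive_functional X q"
      and le: "\<And>A. A \<in> sets ?B \<Longrightarrow> measure (positive_functional.radon X q) A \<le> 2 * ?m A" for q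
  proof -
    interpret q: positive_functional X q by (rule q)
    interpret mq: finite_measure q.radon by (rule q.finite_radon)
    interpret m0: finite_measure p0.radon by (rule p0.finite_radon)
    show ?thesis
      unfolding absolutely_continuous_def
    proof
      fix A assume "A \<in> null_sets p0.radon"
      then have A: "A \<in> sets ?B" "?m A = 0"
        by (auto simp: null_sets_def p0.sets_radon m0.emeasure_eq_measure)
      then have "measure q.radon A = 0"
        using le[of A] by (simp add: measure_le_0_iff)
      then show "A \<in> null_sets q.radon"
        using A by (auto simp: null_sets_def q.sets_radon mq.emeasure_eq_measure)
    qed
  qed
  define \<nu> where "\<nu> A = Complex (measure p1.radon A - ?m A) (measure p2.radon A - ?m A)" for A
  have cm: "complex_measure ?B \<nu>"
    unfolding complex_measure_def
  proof (intro allI impI)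
    fix A :: "nat \<Rightarrow> 'a set" assume A: "range A \<subseteq> sets ?B" "disjoint_family A"
    show "(\<lambda>n. \<nu> (A n)) sums \<nu> (\<Union>n. A n)"
      unfolding sums_complex_iff \<nu>_def complex.sel using A
      by (intro conjI sums_diff finite_measure.finite_measure_UNION p0.finite_radon p1.finite_radon p2.finite_radon)
        (auto simp: p0.sets_radon p1.sets_radon p2.sets_radon)
  qed
  have "regular_complex_borel_measure X \<nu>"
  proof (rule regular_complex_borel_measureI[OF compact hausdorff p0.finite_radon p0.sets_radon _ cm])
    fix A assume A: "A \<in> sets ?B"
    show "emeasure p0.radon A = (INF U\<in>{U. openin X U \<and> A \<subseteq> U}. emeasure p0.radon U)"
      using A by (intro p0.radon_outer_regular) (simp add: p0.sets_radon)
    have "cmod (\<nu> A) \<le> \<bar>measure p1.radon A - ?m A\<bar> + \<bar>measure p2.radon A - ?m A\<bar>"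
      using cmod_le[of "\<nu> A"] by (simp add: \<nu>_def)
    also have "\<dots> \<le> 2 * ?m A"
      using le1[OF A] le2[OF A] measure_nonneg[of p1.radon A] measure_nonneg[of p2.radon A] by linarith
    finally show "cmod (\<nu> A) \<le> 2 * ?m A" .
  qed simp
  moreover have "complex_measure_integral ?B \<nu> \<phi> = \<Lambda> \<phi>" if \<phi>: "continuous_map X euclidean \<phi>" for \<phi>
  proof -
    obtain B where B: "\<And>x. x \<in> topspace X \<Longrightarrow> cmod (\<phi> x) \<le> B"
      using continuous_map_compact_bounded[OF compact \<phi>] by auto
    have s1: "signed_integral ?B (\<lambda>A. measure p1.radon A - ?m A) \<phi> = integral\<^sup>L p1.radon \<phi> - integral\<^sup>L p0.radon \<phi>"
      using ac[OF p1.positive_functional_axioms le1] B p0.continuous_measurable_radon[OF \<phi>]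
      by (intro signed_integral_diff[where B = B] p0.finite_radon p1.finite_radon)
        (auto simp: p0.sets_radon p1.sets_radon p0.space_radon)
    have s2: "signed_integral ?B (\<lambda>A. measure p2.radon A - ?m A) \<phi> = integral\<^sup>L p2.radon \<phi> - integral\<^sup>L p0.radon \<phi>"
      using ac[OF p2.positive_functional_axioms le2] B p0.continuous_measurable_radon[OF \<phi>]
      by (intro signed_integral_diff[where B = B] p0.finite_radon p2.finite_radon)
        (auto simp: p0.sets_radon p2.sets_radon p0.space_radon)
    let ?a = "\<lambda>x. complex_of_real (max 0 (Re (\<phi> x)))" and ?b = "\<lambda>x. complex_of_real (max 0 (- Re (\<phi> x)))"
      and ?c = "\<lambda>x. complex_of_real (max 0 (Im (\<phi> x)))" and ?d = "\<lambda>x. complex_of_real (max 0 (- Im (\<phi> x)))"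
    have r: "continuous_map X euclideanreal (\<lambda>x. Re (\<phi> x))" "continuous_map X euclideanreal (\<lambda>x. Im (\<phi> x))"
      using \<phi> by (simp_all add: continuous_map_atin tendsto_Re tendsto_Im)
    have c: "continuous_map X euclidean ?a" "continuous_map X euclidean ?b"
      "continuous_map X euclidean ?c" "continuous_map X euclidean ?d"
      using r by (auto intro!: continuous_map_of_real continuous_intros)
    have k: "continuous_map X euclidean (\<lambda>x. u * h x)" if "continuous_map X euclidean h" for u :: complex and h
      using that by (intro continuous_map_mult_complex) auto
    have "\<phi> = (\<lambda>x. (?a x + - 1 * ?b x) + \<i> * (?c x + - 1 * ?d x))"
      by (auto simp: fun_eq_iff complex_eq_iff max_def)
    then have "\<Lambda> \<phi> = \<Lambda> (\<lambda>x. (?a x + - 1 * ?b x) + \<i> * (?c x + - 1 * ?d x))"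
      by (rule arg_cong)
    also have "\<dots> = \<Lambda> (\<lambda>x. ?a x + - 1 * ?b x) + \<i> * \<Lambda> (\<lambda>x. ?c x + - 1 * ?d x)"
      unfolding add[OF continuous_map_add[OF c(1) k[OF c(2)]] k[OF continuous_map_add[OF c(3) k[OF c(4)]]]]
        scale[OF continuous_map_add[OF c(3) k[OF c(4)]]] ..
    also have "\<dots> = (\<Lambda> ?a + - 1 * \<Lambda> ?b) + \<i> * (\<Lambda> ?c + - 1 * \<Lambda> ?d)"
      unfolding add[OF c(1) k[OF c(2)]] add[OF c(3) k[OF c(4)]] scale[OF c(2)] scale[OF c(4)] ..
    finally show ?thesis
      unfolding complex_measure_integral_def \<nu>_def complex.sel s1 s2
        p0.radon_integral_complex[OF \<phi>] p1.radon_integral_complex[OF \<phi>] p2.radon_integral_complex[OF \<phi>]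
      by (simp add: p1_def p2_def complex_eq_iff)
  qed
  ultimately show ?thesis
    using that by blast
qed

end

section \<open>The dual unit ball as a compact space\<close>

lemma dual_unit_ball_iff:
  "\<gamma> \<in> dual_unit_ball \<longleftrightarrow> (\<forall>x y. \<gamma> (x + y) = \<gamma> x + \<gamma> y) \<and> (\<forall>c x. \<gamma> (c *\<^sub>C x) = c * \<gamma> x)
     \<and> (\<forall>x. cmod (\<gamma> x) \<le> norm x)" (is "_ \<longleftrightarrow> ?R")
proof
  assume "\<gamma> \<in> dual_unit_ball"
  then have \<gamma>: "bounded_linear \<gamma>" "\<forall>c x. \<gamma> (c *\<^sub>C x) = c * \<gamma> x" "onorm \<gamma> \<le> 1"
    by (auto simp: dual_unit_ball_def bounded_clinear_def)
  have "cmod (\<gamma> x) \<le> norm x" for x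
    using order_trans[OF onorm[OF \<gamma>(1), of x] mult_right_mono[OF \<gamma>(3) norm_ge_zero]] by simp
  then show ?R
    using \<gamma> linear_add[OF bounded_linear.linear[OF \<gamma>(1)]] by simp
next
  assume R: ?R
  have "bounded_linear \<gamma>"
  proof (rule bounded_linear_intro[where K = 1])
    fix r :: real and x
    show "\<gamma> (r *\<^sub>R x) = r *\<^sub>R \<gamma> x"
      using R by (metis scaleC_of_real scaleR_conv_of_real)
  qed (use R in auto)
  then show "\<gamma> \<in> dual_unit_ball"
    using R by (auto simp: dual_unit_ball_def bounded_clinear_def intro!: onorm_bound)
qed

lemma topspace_weak_star_ball: "topspace weak_star_ball = dual_unit_ball"
  unfolding weak_star_ball_def topology_generated_by_topspace
proof (intro antisym subsetI)
  fix \<gamma> :: "'a \<Rightarrow> complex" assume "\<gamma> \<in> dual_unit_ball"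
  then have "\<gamma> \<in> {\<gamma> \<in> dual_unit_ball. \<gamma> 0 \<in> UNIV}"
    by simp
  then show "\<gamma> \<in> \<Union>{{\<gamma> \<in> dual_unit_ball. \<gamma> x \<in> V} |x V. open V}"
    using open_UNIV by blast
qed auto

lemma continuous_map_weak_star_eval: "continuous_map weak_star_ball euclidean (\<lambda>\<gamma>. \<gamma> x)"
proof -
  have "openin weak_star_ball {\<gamma> \<in> dual_unit_ball. \<gamma> x \<in> V}" if "open V" for V
    unfolding weak_star_ball_def using that by (intro topology_generated_by_Basis) blast
  then show ?thesis
    by (simp add: continuous_map topspace_weak_star_ball)
qed

text \<open>The weak* topology is that of pointwise convergence, so it is induced by the product topology on
  all functions and Tychonoff's theorem applies to the ball.\<close>

lemma weak_star_ball_eq: "weak_star_ball = top_of_set dual_unit_ball"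
proof (rule topology_eq[THEN iffD2], intro allI iffI)
  fix U :: "('a \<Rightarrow> complex) set"
  assume "openin weak_star_ball U"
  then have "generate_topology_on {{\<gamma> \<in> dual_unit_ball. \<gamma> x \<in> V} |x V. open V} U"
    unfolding weak_star_ball_def by (simp add: openin_topology_generated_by_iff)
  then show "openin (top_of_set dual_unit_ball) U"
  proof (rule generate_topology_on_coarsest[OF istopology_openin, rotated])
    fix S :: "('a \<Rightarrow> complex) set" assume "S \<in> {{\<gamma> \<in> dual_unit_ball. \<gamma> x \<in> V} |x V. open V}"
    then obtain x V where S: "S = {\<gamma> \<in> dual_unit_ball. \<gamma> x \<in> V}" and V: "open V"
      by blast
    have "open ((\<lambda>\<gamma>::'a \<Rightarrow> complex. \<gamma> x) -` V)"
      using V continuous_on_product_coordinates by (rule open_vimage)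
    then show "openin (top_of_set dual_unit_ball) S"
      unfolding openin_open S by blast
  qed
next
  fix U :: "('a \<Rightarrow> complex) set"
  assume "openin (top_of_set dual_unit_ball) U"
  then obtain W where W: "open W" "U = dual_unit_ball \<inter> W"
    by (auto simp: openin_open)
  have "continuous_map weak_star_ball (product_topology (\<lambda>_::'a. euclidean :: complex topology) UNIV) (\<lambda>\<gamma>. \<gamma>)"
    by (intro continuous_map_coordinatewise_then_product) (auto simp: continuous_map_weak_star_eval)
  then have "continuous_map weak_star_ball euclidean (\<lambda>\<gamma>::'a \<Rightarrow> complex. \<gamma>)"
    by (simp add: euclidean_product_topology)
  then have "openin weak_star_ball {\<gamma> \<in> topspace weak_star_ball. \<gamma> \<in> W}"
    using W(1) by (simp add: continuous_map)
  moreover have "{\<gamma> \<in> topspace weak_star_ball. \<gamma> \<in> W} = U"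
    using W(2) by (auto simp: topspace_weak_star_ball)
  ultimately show "openin weak_star_ball U"
    by simp
qed

text \<open>The Banach--Alaoglu theorem: linearity cuts a closed subset out of a product of discs.\<close>

lemma compact_dual_unit_ball: "compact (dual_unit_ball :: ('e :: complex_normed_vector \<Rightarrow> complex) set)"
proof -
  let ?P = "PiE UNIV (\<lambda>x::'e. cball (0::complex) (norm x))"
  have "compactin (product_topology (\<lambda>_::'e. euclidean :: complex topology) UNIV) ?P"
    by (simp add: compactin_PiE)
  then have P: "compact ?P"
    by (simp add: euclidean_product_topology)
  have cl: "closed {\<gamma> :: 'e \<Rightarrow> complex. (\<forall>x y. \<gamma> (x + y) = \<gamma> x + \<gamma> y) \<and> (\<forall>c x. \<gamma> (c *\<^sub>C x) = c * \<gamma> x)}"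
    by (intro closed_Collect_conj closed_Collect_all closed_Collect_eq continuous_intros
        continuous_on_product_coordinates)
  have eq: "(dual_unit_ball :: ('e \<Rightarrow> complex) set) = ?P \<inter>
      {\<gamma>. (\<forall>x y. \<gamma> (x + y) = \<gamma> x + \<gamma> y) \<and> (\<forall>c x. \<gamma> (c *\<^sub>C x) = c * \<gamma> x)}"
    by (auto simp: dual_unit_ball_iff PiE_UNIV_domain Pi_iff)
  show ?thesis
    unfolding eq by (rule compact_Int_closed[OF P cl])
qed

lemma compact_space_weak_star_ball: "compact_space weak_star_ball"
  by (simp add: weak_star_ball_eq compact_space_subtopology compact_dual_unit_ball)

lemma Hausdorff_space_weak_star_ball:
  "Hausdorff_space (weak_star_ball :: ('e :: complex_normed_vector \<Rightarrow> complex) topology)"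
proof -
  have "Hausdorff_space (product_topology (\<lambda>_::'e. euclidean :: complex topology) UNIV)"
    by (simp add: Hausdorff_space_product_topology)
  then show ?thesis
    by (simp add: weak_star_ball_eq euclidean_product_topology Hausdorff_space_subtopology)
qed

section \<open>Holomorphic functions on complex lines\<close>

lemma bounded_linear_scaleC_left: "bounded_linear (\<lambda>s. s *\<^sub>C (y :: 'e :: complex_normed_vector))"
proof (rule bounded_linear_intro[where K = "norm y"])
  fix r :: real and s :: complex
  show "(r *\<^sub>R s) *\<^sub>C y = r *\<^sub>R s *\<^sub>C y"
    by (simp add: scaleR_conv_of_real flip: scaleC_scaleC scaleC_of_real)
qed (simp_all add: scaleC_add_left norm_scaleC)

lemma scaleC_one [simp]: "1 *\<^sub>C (y :: 'e :: complex_normed_vector) = y"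
  using scaleC_of_real[of 1 y] by simp

lemma scaleC_zero_left [simp]: "0 *\<^sub>C (y :: 'e :: complex_normed_vector) = 0"
  using scaleC_of_real[of 0 y] by simp

lemma holomorphic_fun_derivative:
  assumes "holomorphic_fun_on f UNIV"
  shows "(f has_derivative frechet_derivative f (at x)) (at x)"
    and "bounded_clinear (frechet_derivative f (at x))"
  using assms unfolding holomorphic_fun_on_def by (metis UNIV_I frechet_derivative_at)+

lemma has_field_derivative_on_line:
  assumes "holomorphic_fun_on f UNIV"
  shows "((\<lambda>s. f (x + s *\<^sub>C y)) has_field_derivative frechet_derivative f (at (x + s *\<^sub>C y)) y) (at s)"
proof -
  let ?D = "frechet_derivative f (at (x + s *\<^sub>C y))"
  have "((\<lambda>s. x + s *\<^sub>C y) has_derivative (\<lambda>s. s *\<^sub>C y)) (at s)"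
    using bounded_linear_imp_has_derivative[OF bounded_linear_scaleC_left]
    by (auto intro!: derivative_eq_intros)
  from has_derivative_compose[OF this holomorphic_fun_derivative(1)[OF assms]]
  have "((\<lambda>s. f (x + s *\<^sub>C y)) has_derivative (\<lambda>s. ?D (s *\<^sub>C y))) (at s)" .
  moreover have "(\<lambda>s. ?D (s *\<^sub>C y)) = (*) (?D y)"
    using holomorphic_fun_derivative(2)[OF assms, of "x + s *\<^sub>C y"]
    by (auto simp: bounded_clinear_def mult.commute)
  ultimately show ?thesis
    by (simp add: has_field_derivative_def)
qed

lemma holomorphic_on_line:
  assumes "holomorphic_fun_on f UNIV"
  shows "(\<lambda>s. f (x + s *\<^sub>C y)) holomorphic_on S"
  using has_field_derivative_on_line[OF assms]
  by (meson holomorphic_on_def has_field_derivative_at_within field_differentiable_def)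

lemma bounded_type_bound:
  assumes "f \<in> holomorphic_bounded_type"
  shows "\<exists>M. 0 \<le> M \<and> (\<forall>x. norm x \<le> r \<longrightarrow> cmod (f x) \<le> M)"
proof -
  have "bounded (f ` cball 0 r)"
    using assms by (simp add: holomorphic_bounded_type_def)
  then obtain M where M: "\<And>z. z \<in> f ` cball 0 r \<Longrightarrow> cmod z \<le> M"
    by (meson bounded_iff)
  have "cmod (f x) \<le> max 0 M" if "norm x \<le> r" for x
    using M[of "f x"] that by (simp add: max.coboundedI2)
  then show ?thesis
    by (intro exI[of _ "max 0 M"]) simp
qed

text \<open>Schwarz's lemma on the disc of radius \<open>2\<close>.\<close>

lemma schwarz_half:
  assumes g: "g holomorphic_on UNIV" "g 0 = 0" and B: "\<And>s. cmod s \<le> 2 \<Longrightarrow> cmod (g s) \<le> B"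
  shows "cmod (g 1) \<le> B / 2"
proof (rule field_le_epsilon)
  fix e :: real assume e: "0 < e"
  have "0 \<le> B"
    using B[of 0] g(2) by simp
  let ?h = "\<lambda>s. g (2 * s) / complex_of_real (B + e)"
  have "cmod (?h (1/2)) \<le> cmod (1/2)"
  proof (rule Schwarz_Lemma(1))
    have "(g \<circ> (\<lambda>s. 2 * s)) holomorphic_on ball 0 1"
      by (intro holomorphic_on_compose holomorphic_intros holomorphic_on_subset[OF g(1)]) auto
    then show "?h holomorphic_on ball 0 1"
      using e \<open>0 \<le> B\<close> by (intro holomorphic_intros) (auto simp: o_def simp flip: of_real_add)
    fix z :: complex assume "cmod z < 1"
    then have "cmod (g (2 * z)) \<le> B"
      by (intro B) (simp add: norm_mult)
    then show "cmod (?h z) < 1"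
      using e \<open>0 \<le> B\<close> by (simp add: norm_divide del: of_real_add)
  qed (use g(2) in \<open>auto simp: norm_divide\<close>)
  then show "cmod (g 1) \<le> B / 2 + e"
    using e \<open>0 \<le> B\<close> by (simp add: norm_divide field_simps del: of_real_add)
qed

text \<open>Schwarz's lemma in one variable after the other: every variable whose vanishing makes \<open>H\<close> vanish
  gains a factor \<open>1/2\<close>.\<close>

lemma schwarz_iterated:
  fixes H :: "(nat \<Rightarrow> complex) \<Rightarrow> complex"
  assumes hol: "\<And>z k. k < N \<Longrightarrow> (\<lambda>s. H (z(k := s))) holomorphic_on UNIV"
    and zero: "\<And>z k. k < N \<Longrightarrow> z k = 0 \<Longrightarrow> H z = 0"
    and bound: "\<And>z. (\<And>k. cmod (z k) \<le> 2) \<Longrightarrow> cmod (H z) \<le> M"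
  shows "cmod (H (\<lambda>k. 1)) \<le> M / 2 ^ N"
proof -
  have "cmod (H z) \<le> M / 2 ^ j"
    if "j \<le> N" "\<And>k. cmod (z k) \<le> 2" "\<And>k. k < j \<Longrightarrow> z k = 1" for z j
    using that
  proof (induction j arbitrary: z)
    case 0
    then show ?case using bound by simp
  next
    case (Suc j)
    have "cmod (H (z(j := 1))) \<le> (M / 2 ^ j) / 2"
    proof (rule schwarz_half)
      show "(\<lambda>s. H (z(j := s))) holomorphic_on UNIV"
        using Suc.prems(1) by (intro hol) auto
      show "H (z(j := 0)) = 0"
        using Suc.prems(1) by (intro zero[of j]) auto
      fix s :: complex assume "cmod s \<le> 2"
      then show "cmod (H (z(j := s))) \<le> M / 2 ^ j"
        using Suc.prems by (intro Suc.IH) auto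
    qed
    moreover have "z(j := 1) = z"
      using Suc.prems(3)[of j] by (auto simp: fun_eq_iff)
    ultimately show ?case
      by (simp add: mult.commute)
  qed
  from this[of N "\<lambda>k. 1"] show ?thesis
    by simp
qed

section \<open>Orthogonally additive entire functions are local\<close>

lemma continuous_imp_bcontfun:
  fixes g :: "'k :: topological_space \<Rightarrow> 'b :: metric_space"
  assumes "compact (UNIV :: 'k set)" "continuous_on UNIV g"
  shows "g \<in> bcontfun"
  using assms compact_continuous_image compact_imp_bounded unfolding bcontfun_def by blast

text \<open>Bumps of height \<open>1\<close> with disjoint supports, peaking at the points \<open>(k + 1) / (N + 1)\<close> of the open unit
  interval.\<close>

definition tent :: "nat \<Rightarrow> nat \<Rightarrow> real \<Rightarrow> real" where
  "tent N k s = max 0 (1 - 2 * \<bar>real (N + 1) * s - real (k + 1)\<bar>)"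

lemma tent_disjoint: "j \<noteq> k \<Longrightarrow> tent N j s = 0 \<or> tent N k s = 0"
proof (rule ccontr)
  assume jk: "j \<noteq> k" and "\<not> (tent N j s = 0 \<or> tent N k s = 0)"
  then have "\<bar>real (N + 1) * s - real (j + 1)\<bar> < 1/2" "\<bar>real (N + 1) * s - real (k + 1)\<bar> < 1/2"
    by (auto simp: tent_def max_def split: if_splits)
  then have "\<bar>real j - real k\<bar> < 1"
    by linarith
  then show False
    using jk by linarith
qed

lemma tent_peak: "tent N k (real (k + 1) / real (N + 1)) = 1"
  by (simp add: tent_def)

lemma tent_bounds: "0 \<le> tent N k s" "tent N k s \<le> 1"
  by (auto simp: tent_def)

text \<open>A function on the unit interval that is affine in each parameter, is constant \<open>1\<close> if all the parameters
  are \<open>1\<close>, and takes the value \<open>z k\<close> at the \<open>k\<close>-th peak. As the bumps have disjoint supports, it is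
  bounded by \<open>2\<close> on the polydisc of radius \<open>2\<close>, for every \<open>N\<close>.\<close>

definition damping :: "nat \<Rightarrow> (nat \<Rightarrow> complex) \<Rightarrow> real \<Rightarrow> complex" where
  "damping N z s = 1 + (\<Sum>k<N. (z k - 1) * complex_of_real (tent N k s))"

lemma damping_eq:
  assumes "k < N" "tent N k s \<noteq> 0"
  shows "damping N z s = 1 + (z k - 1) * complex_of_real (tent N k s)"
proof -
  have "(\<Sum>j<N. (z j - 1) * complex_of_real (tent N j s))
      = (\<Sum>j<N. if j = k then (z k - 1) * complex_of_real (tent N k s) else 0)"
    using tent_disjoint[of _ k N s] assms(2) by (intro sum.cong) auto
  then show ?thesis
    using assms(1) by (simp add: damping_def)
qed

lemma damping_bound:
  assumes z: "\<And>k. cmod (z k) \<le> 2"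
  shows "cmod (damping N z s) \<le> 2"
proof (cases "\<exists>k<N. tent N k s \<noteq> 0")
  case True
  then obtain k where k: "k < N" "tent N k s \<noteq> 0"
    by blast
  let ?t = "tent N k s"
  have "damping N z s = complex_of_real (1 - ?t) + complex_of_real ?t * z k"
    by (simp add: damping_eq[OF k] algebra_simps)
  also have "cmod \<dots> \<le> cmod (complex_of_real (1 - ?t)) + cmod (complex_of_real ?t * z k)"
    by (rule norm_triangle_ineq)
  also have "\<dots> = (1 - ?t) + ?t * cmod (z k)"
    using tent_bounds[where N = N and k = k and s = s]
    by (simp add: norm_mult del: of_real_diff)
  also have "\<dots> \<le> (1 - ?t) + ?t * 2"
    using z[of k] tent_bounds(1)[of N k s] by (intro add_left_mono mult_left_mono)
  also have "\<dots> \<le> 2"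
    using tent_bounds(2)[of N k s] by simp
  finally show ?thesis .
next
  case False
  then have "damping N z s = 1"
    by (auto simp: damping_def)
  then show ?thesis by simp
qed

lemma damping_peak: "k < N \<Longrightarrow> damping N z (real (k + 1) / real (N + 1)) = z k"
  using damping_eq[of k N "real (k + 1) / real (N + 1)" z] unfolding tent_peak by simp

lemma damping_update:
  assumes "k < N"
  shows "damping N (z(k := w)) s = damping N (z(k := 0)) s + w * complex_of_real (tent N k s)"
proof -
  have *: "(\<Sum>j<N. ((z(k := w)) j - 1) * complex_of_real (tent N j s))
      = (w - 1) * complex_of_real (tent N k s) + (\<Sum>j\<in>{..<N} - {k}. (z j - 1) * complex_of_real (tent N j s))" for w
    using assms by (subst sum.remove[of _ k]) auto
  show ?thesis
    unfolding damping_def * by (simp add: algebra_simps)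
qed

lemma continuous_damping: "continuous_on UNIV q \<Longrightarrow> continuous_on UNIV (\<lambda>t. damping N z (q t))"
  unfolding damping_def tent_def by (intro continuous_intros)

locale entire_orthogonally_additive =
  fixes f :: "('k :: t2_space \<Rightarrow>\<^sub>C complex) \<Rightarrow> complex"
  assumes compact: "compact (UNIV :: 'k set)"
    and bounded_type: "f \<in> holomorphic_bounded_type"
    and orthogonal: "orthogonally_additive f"
begin

lemma holo: "holomorphic_fun_on f UNIV"
  using bounded_type by (simp add: holomorphic_bounded_type_def)

lemma apply_Bcontfun:
  fixes g :: "'k \<Rightarrow> complex"
  shows "continuous_on UNIV g \<Longrightarrow> apply_bcontfun (Bcontfun g) = g"
  by (simp add: Bcontfun_inverse continuous_imp_bcontfun[OF compact])

definition mixed :: "('k \<Rightarrow>\<^sub>C complex) \<Rightarrow> ('k \<Rightarrow>\<^sub>C complex) \<Rightarrow> ('k \<Rightarrow>\<^sub>C complex) \<Rightarrow> complex" where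
  "mixed u v x = f (x + u + v) - f (x + u) - f (x + v) + f x"

text \<open>If \<open>x\<close> vanishes on a level set of \<open>q\<close> that separates \<open>u\<close> from \<open>v\<close>, it can be cut there into continuous
  pieces \<open>a\<close> and \<open>b\<close>. Then \<open>a + u\<close> and \<open>b + v\<close> are orthogonal, as are all pairs taken from their parts, and
  the four values of \<open>f\<close> cancel.\<close>

lemma mixed_cut:
  assumes q: "continuous_on UNIV q" "0 < c" "c < 1"
    and u: "\<And>t. apply_bcontfun u t \<noteq> 0 \<Longrightarrow> q t = 0"
    and v: "\<And>t. apply_bcontfun v t \<noteq> 0 \<Longrightarrow> q t = (1::real)"
    and x: "\<And>t. q t = c \<Longrightarrow> apply_bcontfun x t = 0"
  shows "mixed u v x = 0"
proof -
  define a where "a = Bcontfun (\<lambda>t. if q t \<le> c then apply_bcontfun x t else 0)"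
  define b where "b = x - a"
  have "continuous_on UNIV (\<lambda>t. if q t \<le> c then apply_bcontfun x t else 0)"
    using q(1) x by (intro continuous_on_cases_le) auto
  then have a: "apply_bcontfun a t = (if q t \<le> c then apply_bcontfun x t else 0)" for t
    by (simp add: a_def apply_Bcontfun)
  have b: "apply_bcontfun b t = (if q t \<le> c then 0 else apply_bcontfun x t)" for t
    by (simp add: b_def a)
  have uv: "apply_bcontfun u t = 0 \<or> apply_bcontfun v t = 0" for t
    using u[of t] v[of t] by (metis zero_neq_one)
  have ub: "apply_bcontfun u t = 0 \<or> apply_bcontfun b t = 0" for t
    using u[of t] q(2) by (cases "apply_bcontfun u t = 0") (auto simp: b)
  have av: "apply_bcontfun a t = 0 \<or> apply_bcontfun v t = 0" for t
    using v[of t] q(3) by (cases "apply_bcontfun v t = 0") (auto simp: a)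
  have ab: "apply_bcontfun a t = 0 \<or> apply_bcontfun b t = 0" for t
    by (auto simp: a b)
  have prod: "apply_bcontfun u t * apply_bcontfun v t = 0" "apply_bcontfun u t * apply_bcontfun b t = 0"
    "apply_bcontfun a t * apply_bcontfun v t = 0" "apply_bcontfun a t * apply_bcontfun b t = 0" for t
    using uv[of t] ub[of t] av[of t] ab[of t] by auto
  have oa: "f (y + z) = f y + f z" if "\<And>t. apply_bcontfun y t * apply_bcontfun z t = 0" for y z
    using orthogonal that by (simp add: orthogonally_additive_def)
  have x: "x = a + b"
    by (simp add: b_def)
  have "f ((a + u) + (b + v)) = f (a + u) + f (b + v)"
    by (rule oa) (simp add: distrib_left distrib_right prod del: mult_eq_0_iff)
  moreover have "f ((a + u) + b) = f (a + u) + f b"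
    by (rule oa) (simp add: distrib_left distrib_right prod del: mult_eq_0_iff)
  moreover have "f (a + (b + v)) = f a + f (b + v)"
    by (rule oa) (simp add: distrib_left distrib_right prod del: mult_eq_0_iff)
  moreover have "f (a + b) = f a + f b"
    by (rule oa) (simp add: distrib_left distrib_right prod del: mult_eq_0_iff)
  ultimately show ?thesis
    by (simp add: mixed_def x add_ac)
qed

text \<open>An arbitrary \<open>x\<close> is damped at \<open>N\<close> intermediate levels of \<open>q\<close> by complex factors \<open>z k\<close>. The mixed
  difference is entire in each \<open>z k\<close>, vanishes when one of them is \<open>0\<close>, and is bounded on the polydisc
  of radius \<open>2\<close> by a constant \<open>4 M\<close> independent of \<open>N\<close>. Hence it is at most \<open>4 M / 2 ^ N\<close> where all factors are \<open>1\<close>, that is,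
  for \<open>x\<close> itself.\<close>

lemma mixed_separated:
  assumes q: "continuous_on UNIV q"
    and u: "\<And>t. apply_bcontfun u t \<noteq> 0 \<Longrightarrow> q t = 0"
    and v: "\<And>t. apply_bcontfun v t \<noteq> 0 \<Longrightarrow> q t = (1::real)"
  shows "mixed u v x = 0"
proof -
  define R where "R = 2 * norm x + norm u + norm v"
  obtain M where M: "0 \<le> M" "\<forall>y. norm y \<le> R \<longrightarrow> cmod (f y) \<le> M"
    using bounded_type_bound[OF bounded_type, of R] by (elim exE conjE)
  have bound: "cmod (mixed u v x) \<le> 4 * M / 2 ^ N" for N
  proof -
    define X where "X z = Bcontfun (\<lambda>t. apply_bcontfun x t * damping N z (q t))" for z
    have X: "apply_bcontfun (X z) t = apply_bcontfun x t * damping N z (q t)" for z t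
      unfolding X_def using q by (subst apply_Bcontfun) (auto intro!: continuous_intros continuous_damping)
    have X1: "X (\<lambda>k. 1) = x"
      by (rule bcontfun_eqI) (simp add: X damping_def)
    have "cmod (mixed u v (X (\<lambda>k. 1))) \<le> 4 * M / 2 ^ N"
    proof (rule schwarz_iterated)
      fix z :: "nat \<Rightarrow> complex" and k assume k: "k < N"
      define T where "T = Bcontfun (\<lambda>t. apply_bcontfun x t * complex_of_real (tent N k (q t)))"
      have T: "apply_bcontfun T t = apply_bcontfun x t * complex_of_real (tent N k (q t))" for t
        unfolding T_def using q by (subst apply_Bcontfun) (auto simp: tent_def intro!: continuous_intros)
      have Xs: "X (z(k := s)) = X (z(k := 0)) + s *\<^sub>C T" for s
        by (rule bcontfun_eqI)
          (simp add: X T apply_bcontfun_scaleC damping_update[OF k, of z s] scaleC_complex_def algebra_simps)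
      let ?Y = "X (z(k := 0))"
      have "(\<lambda>s. f (?Y + u + v + s *\<^sub>C T) - f (?Y + u + s *\<^sub>C T) - f (?Y + v + s *\<^sub>C T)
          + f (?Y + s *\<^sub>C T)) holomorphic_on UNIV"
        by (intro holomorphic_on_add holomorphic_on_diff holomorphic_on_line holo)
      moreover have "mixed u v (X (z(k := s))) = f (?Y + u + v + s *\<^sub>C T) - f (?Y + u + s *\<^sub>C T)
          - f (?Y + v + s *\<^sub>C T) + f (?Y + s *\<^sub>C T)" for s
        unfolding mixed_def Xs[of s] by (simp add: add_ac)
      ultimately show "(\<lambda>s. mixed u v (X (z(k := s)))) holomorphic_on UNIV"
        by simp
    next
      fix z :: "nat \<Rightarrow> complex" and k assume k: "k < N" and zk: "z k = 0"
      show "mixed u v (X z) = 0"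
      proof (rule mixed_cut[OF q _ _ u v])
        show "0 < real (k + 1) / real (N + 1)" "real (k + 1) / real (N + 1) < 1"
          using k by auto
        fix t assume "q t = real (k + 1) / real (N + 1)"
        then show "apply_bcontfun (X z) t = 0"
          using zk by (simp only: X damping_peak[OF k] mult_zero_right)
      qed
    next
      fix z :: "nat \<Rightarrow> complex" assume z: "\<And>k. cmod (z k) \<le> 2"
      have "norm (X z) \<le> norm x * 2"
        by (rule norm_bound) (auto simp: X norm_mult intro!: mult_mono norm_bounded damping_bound z)
      then have n: "norm (X z) \<le> 2 * norm x"
        by simp
      have le: "norm (X z + u + v) \<le> R" "norm (X z + u) \<le> R" "norm (X z + v) \<le> R" "norm (X z) \<le> R"
        unfolding R_def
        using n norm_triangle_ineq[of "X z + u" v] norm_triangle_ineq[of "X z" u] norm_triangle_ineq[of "X z" v]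
          norm_ge_zero[of u] norm_ge_zero[of v] by linarith+
      have "cmod (mixed u v (X z)) \<le> cmod (f (X z + u + v)) + cmod (f (X z + u)) + cmod (f (X z + v)) + cmod (f (X z))"
        unfolding mixed_def
        using norm_triangle_ineq[of "f (X z + u + v) - f (X z + u) - f (X z + v)" "f (X z)"]
          norm_triangle_ineq4[of "f (X z + u + v) - f (X z + u)" "f (X z + v)"]
          norm_triangle_ineq4[of "f (X z + u + v)" "f (X z + u)"] by linarith
      then show "cmod (mixed u v (X z)) \<le> 4 * M"
        using M(2)[rule_format, OF le(1)] M(2)[rule_format, OF le(2)] M(2)[rule_format, OF le(3)]
          M(2)[rule_format, OF le(4)] by linarith
    qed
    then show ?thesis by (simp add: X1)
  qed
  have "(\<lambda>N. 4 * M / 2 ^ N) \<longlonglongrightarrow> 0"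
    by real_asymp
  then have "cmod (mixed u v x) \<le> 0"
    using bound by (intro LIMSEQ_le_const) auto
  then show ?thesis by simp
qed

lemma continuous_f: "continuous_on UNIV f"
  by (intro continuous_at_imp_continuous_on ballI has_derivative_continuous[OF holomorphic_fun_derivative(1)[OF holo]])

text \<open>Where \<open>uv = 0\<close>, the function \<open>q = min 1 (|v| / e)\<close> separates \<open>u\<close> from a copy of \<open>v\<close> that is shrunk by at
  most \<open>e\<close> and vanishes on \<open>{|v| \<le> e}\<close>. The claim follows by continuity as \<open>e\<close> tends to \<open>0\<close>.\<close>

theorem locality:
  assumes uv: "\<And>t. apply_bcontfun u t = 0 \<or> apply_bcontfun v t = 0"
  shows "f (x + u + v) + f x = f (x + u) + f (x + v)"
proof -
  define e where "e n = inverse (real (Suc n))" for n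
  have e: "0 < e n" and e_lim: "e \<longlonglongrightarrow> 0" for n
    using LIMSEQ_inverse_real_of_nat by (simp_all add: e_def[abs_def])
  define w where "w n t = e n / max (e n) (cmod (apply_bcontfun v t))" for n t
  have w_cont: "continuous_on UNIV (w n)" for n
    unfolding w_def using e[of n] by (intro continuous_intros) (auto simp: max_def)
  define V where "V n = Bcontfun (\<lambda>t. apply_bcontfun v t - apply_bcontfun v t * complex_of_real (w n t))" for n
  have V: "apply_bcontfun (V n) t = apply_bcontfun v t - apply_bcontfun v t * complex_of_real (w n t)" for n t
    unfolding V_def using w_cont[of n] by (subst apply_Bcontfun) (auto intro!: continuous_intros)
  have mixed0: "mixed u (V n) x = 0" for n
  proof (rule mixed_separated)
    let ?q = "\<lambda>t. min 1 (cmod (apply_bcontfun v t) / e n)"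
    show "continuous_on UNIV ?q"
      using e[of n] by (intro continuous_intros) auto
    fix t
    show "?q t = 0" if "apply_bcontfun u t \<noteq> 0"
      using uv[of t] that by simp
    show "?q t = 1" if "apply_bcontfun (V n) t \<noteq> 0"
    proof -
      have "w n t = 1" if "cmod (apply_bcontfun v t) \<le> e n"
        using e[of n] that by (simp add: w_def max_absorb1)
      then have "\<not> cmod (apply_bcontfun v t) \<le> e n"
        using that by (auto simp: V)
      then show ?thesis
        using e[of n] by (simp add: field_simps)
    qed
  qed
  have V_close: "norm (V n - v) \<le> e n" for n
  proof (rule norm_bound)
    fix t
    have "apply_bcontfun (V n - v) t = - (apply_bcontfun v t * complex_of_real (w n t))"
      by (simp add: V)
    then have "norm (apply_bcontfun (V n - v) t) = cmod (apply_bcontfun v t) * \<bar>w n t\<bar>"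
      by (simp add: norm_mult)
    also have "\<dots> \<le> e n"
      using e[of n] by (auto simp: w_def max_def field_simps)
    finally show "norm (apply_bcontfun (V n - v) t) \<le> e n" .
  qed
  have "(\<lambda>n. V n - v) \<longlonglongrightarrow> 0"
    by (rule Lim_null_comparison[OF _ e_lim]) (simp add: V_close)
  then have V_lim: "V \<longlonglongrightarrow> v"
    by (simp add: LIM_zero_iff)
  have f_lim: "(\<lambda>n. f (y n)) \<longlonglongrightarrow> f l" if "y \<longlonglongrightarrow> l" for y l
    using continuous_f that by (metis UNIV_I continuous_on_tendsto_compose eventually_sequentiallyI)
  have "(\<lambda>n. mixed u (V n) x) \<longlonglongrightarrow> mixed u v x"
    unfolding mixed_def by (intro tendsto_intros f_lim V_lim)
  then have "mixed u v x = 0"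
    using mixed0 by (simp add: LIMSEQ_const_iff)
  then show ?thesis
    by (simp add: mixed_def algebra_simps)
qed

end

section \<open>The derivative of a function of bounded type\<close>

lemma holomorphic_fun_linear:
  assumes "holomorphic_fun_on f UNIV"
  shows "frechet_derivative f (at x) (y + z) = frechet_derivative f (at x) y + frechet_derivative f (at x) z"
    and "frechet_derivative f (at x) (c *\<^sub>C y) = c * frechet_derivative f (at x) y"
  using holomorphic_fun_derivative(2)[OF assms, of x] linear_add bounded_linear.linear
  unfolding bounded_clinear_def by blast+

text \<open>Cauchy's estimates for the first two derivatives of \<open>f\<close> along the complex line through \<open>x\<close> in the
  direction of \<open>y\<close>, with constants that depend on the ball only.\<close>

lemma bounded_type_estimates:
  assumes f: "f \<in> holomorphic_bounded_type"
  obtains C where "0 \<le> C"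
    "\<And>x y. norm x \<le> r \<Longrightarrow> cmod (frechet_derivative f (at x) y) \<le> C * norm y"
    "\<And>x y. norm x \<le> r \<Longrightarrow> norm y \<le> 1 \<Longrightarrow>
      cmod (f (x + y) - f x - frechet_derivative f (at x) y) \<le> C * (norm y)\<^sup>2"
proof -
  have hol: "holomorphic_fun_on f UNIV"
    using f by (simp add: holomorphic_bounded_type_def)
  obtain M where M: "0 \<le> M" "\<forall>x. norm x \<le> r + 2 \<longrightarrow> cmod (f x) \<le> M"
    using bounded_type_bound[OF f, of "r + 2"] by (elim exE conjE)
  let ?D = "\<lambda>x. frechet_derivative f (at x)"
  have main: "cmod (?D x y) \<le> (2 * (M + 1)) * norm y \<and>
      (norm y \<le> 1 \<longrightarrow> cmod (f (x + y) - f x - ?D x y) \<le> (2 * (M + 1)) * (norm y)\<^sup>2)"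
    if x: "norm x \<le> r" for x y
  proof (cases "y = 0")
    case True
    have "?D x 0 = 0"
      using holomorphic_fun_linear(2)[OF hol, of x 0 0] by simp
    then show ?thesis using True by simp
  next
    case False
    define e where "e = complex_of_real (inverse (norm y)) *\<^sub>C y"
    define g where "g s = f (x + s *\<^sub>C e)" for s
    have ne: "norm e = 1"
      using False by (simp add: e_def norm_scaleC norm_inverse)
    have ye: "complex_of_real (norm y) *\<^sub>C e = y"
      using False by (simp add: e_def scaleC_scaleC flip: of_real_mult)
    have gh: "g holomorphic_on S" for S
      unfolding g_def by (rule holomorphic_on_line[OF hol])
    have gM: "cmod (g s) \<le> M" if "cmod s \<le> 2" for s
    proof -
      have "norm (x + s *\<^sub>C e) \<le> r + 2"
        using norm_triangle_ineq[of x "s *\<^sub>C e"] x that by (simp add: norm_scaleC ne)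
      then show ?thesis unfolding g_def by (rule M(2)[rule_format])
    qed
    have cauchy: "cmod ((deriv ^^ n) g z) \<le> fact n * (M + 1)" if "cmod z \<le> 1" "0 < n" for z n
    proof -
      have "cmod ((deriv ^^ n) g z) \<le> fact n * (M + 1) / 1 ^ n"
      proof (rule Cauchy_higher_deriv_bound[where y = 0])
        show "g holomorphic_on ball z 1" "continuous_on (cball z 1) g"
          using gh holomorphic_on_imp_continuous_on by blast+
        fix w assume "w \<in> ball z 1"
        then have "cmod w \<le> 2"
          using that(1) norm_triangle_ineq2[of w z] by (simp add: dist_norm norm_minus_commute)
        then show "g w \<in> ball 0 (M + 1)"
          using gM[of w] by simp
      qed (use that in auto)
      then show ?thesis by simp
    qed
    have d0: "deriv g 0 = ?D x e"
      using DERIV_imp_deriv[OF has_field_derivative_on_line[OF hol, of x e 0]] by (simp add: g_def[abs_def])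
    have De: "?D x y = complex_of_real (norm y) * ?D x e"
      using holomorphic_fun_linear(2)[OF hol, of x "complex_of_real (norm y)" e] by (simp add: ye)
    have "cmod (?D x e) \<le> M + 1"
      using cauchy[of 0 1] by (simp add: d0)
    then have "cmod (?D x e) * norm y \<le> (M + 1) * norm y"
      by (rule mult_right_mono) simp
    then have 1: "cmod (?D x y) \<le> (M + 1) * norm y"
      by (simp add: De norm_mult mult.commute)
    have 2: "cmod (f (x + y) - f x - ?D x y) \<le> (2 * (M + 1)) * (norm y)\<^sup>2" if y: "norm y \<le> 1"
    proof -
      let ?z = "complex_of_real (norm y)"
      have "cmod ((deriv ^^ 0) g ?z - (\<Sum>i\<le>1. (deriv ^^ i) g 0 * (?z - 0) ^ i / fact i))
          \<le> (2 * (M + 1)) * cmod (?z - 0) ^ Suc 1 / fact 1"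
      proof (rule complex_Taylor[where S = "cball 0 1" and f = "\<lambda>i. (deriv ^^ i) g"])
        fix i :: nat and w :: complex
        show "((deriv ^^ i) g has_field_derivative (deriv ^^ Suc i) g w) (at w within cball 0 1)"
          using has_field_derivative_higher_deriv[OF gh open_UNIV UNIV_I] has_field_derivative_at_within by blast
      next
        fix w :: complex assume "w \<in> cball 0 1"
        then show "cmod ((deriv ^^ Suc 1) g w) \<le> 2 * (M + 1)"
          using cauchy[of w 2] by (simp add: numeral_2_eq_2)
      qed (use y in auto)
      moreover have "(\<Sum>i\<le>1. (deriv ^^ i) g 0 * (?z - 0) ^ i / fact i) = g 0 + deriv g 0 * ?z"
        by simp
      moreover have "g ?z = f (x + y)" "g 0 = f x"
        by (simp_all add: g_def ye)
      ultimately show ?thesis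
        by (simp add: d0 De power2_eq_square algebra_simps)
    qed
    have "(M + 1) * norm y \<le> (2 * (M + 1)) * norm y"
      using M(1) by (intro mult_right_mono) auto
    then show ?thesis
      using 1 2 by linarith
  qed
  show ?thesis
    by (rule that[of "2 * (M + 1)"]) (use main M(1) in auto)
qed

text \<open>The derivative is the locally uniform limit of difference quotients of step \<open>1 / (n + 1)\<close>, which are
  entire in \<open>w\<close>.\<close>

lemma holomorphic_derivative_along_line:
  fixes e y :: "'e :: complex_normed_vector"
  assumes f: "f \<in> holomorphic_bounded_type"
  shows "(\<lambda>w. frechet_derivative f (at (w *\<^sub>C e)) y) holomorphic_on UNIV"
proof (rule holomorphic_uniform_sequence[OF open_UNIV])
  have hol: "holomorphic_fun_on f UNIV"
    using f by (simp add: holomorphic_bounded_type_def)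
  let ?D = "\<lambda>w. frechet_derivative f (at (w *\<^sub>C e)) y"
  define h where "h n = complex_of_real (inverse (real (Suc n))) *\<^sub>C y" for n
  let ?g = "\<lambda>n w. of_nat (Suc n) * (f (h n + w *\<^sub>C e) - f (0 + w *\<^sub>C e))"
  show "?g n holomorphic_on UNIV" for n
    by (intro holomorphic_on_mult holomorphic_on_diff holomorphic_on_line[OF hol] holomorphic_on_const)
  fix w0 :: complex assume "w0 \<in> UNIV"
  obtain C where C: "0 \<le> C" "\<And>x y. norm x \<le> (cmod w0 + 1) * norm e \<Longrightarrow> norm y \<le> 1 \<Longrightarrow>
      cmod (f (x + y) - f x - frechet_derivative f (at x) y) \<le> C * (norm y)\<^sup>2"
    by (rule bounded_type_estimates[OF f, of "(cmod w0 + 1) * norm e"], erule that, simp)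
  have nh: "norm (h n) = norm y * inverse (real (Suc n))" for n
    by (simp add: h_def norm_scaleC norm_inverse del: of_nat_Suc)
  have est: "cmod (?g n w - ?D w) \<le> C * (norm y)\<^sup>2 * inverse (real (Suc n))"
    if w: "w \<in> cball w0 1" and n: "norm y \<le> real (Suc n)" for w n
  proof -
    have "cmod w \<le> cmod w0 + 1"
      using w norm_triangle_ineq2[of w w0] by (simp add: dist_norm norm_minus_commute)
    then have "norm (w *\<^sub>C e) \<le> (cmod w0 + 1) * norm e"
      by (simp add: norm_scaleC mult_right_mono)
    moreover have "norm (h n) \<le> 1"
      using n by (simp add: nh field_simps)
    ultimately have "cmod (f (w *\<^sub>C e + h n) - f (w *\<^sub>C e) - frechet_derivative f (at (w *\<^sub>C e)) (h n)) \<le> C * (norm (h n))\<^sup>2"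
      by (rule C(2))
    then have le: "real (Suc n) * cmod (f (w *\<^sub>C e + h n) - f (w *\<^sub>C e) - frechet_derivative f (at (w *\<^sub>C e)) (h n))
        \<le> real (Suc n) * (C * (norm (h n))\<^sup>2)"
      by (intro mult_left_mono) auto
    have "frechet_derivative f (at (w *\<^sub>C e)) (h n) = complex_of_real (inverse (real (Suc n))) * ?D w"
      unfolding h_def by (rule holomorphic_fun_linear(2)[OF hol])
    then have "of_nat (Suc n) * frechet_derivative f (at (w *\<^sub>C e)) (h n)
        = (of_nat (Suc n) * complex_of_real (inverse (real (Suc n)))) * ?D w"
      by (simp only: mult.assoc)
    also have "of_nat (Suc n) * complex_of_real (inverse (real (Suc n))) = 1"
      by (simp del: of_nat_Suc)
    finally have "?g n w - ?D w
        = of_nat (Suc n) * (f (w *\<^sub>C e + h n) - f (w *\<^sub>C e) - frechet_derivative f (at (w *\<^sub>C e)) (h n))"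
      by (simp add: right_diff_distrib add.commute del: of_nat_Suc)
    then have "cmod (?g n w - ?D w)
        = real (Suc n) * cmod (f (w *\<^sub>C e + h n) - f (w *\<^sub>C e) - frechet_derivative f (at (w *\<^sub>C e)) (h n))"
      by (simp only: norm_mult norm_of_nat)
    also note le
    also have "real (Suc n) * (C * (norm (h n))\<^sup>2) = C * (norm y)\<^sup>2 * inverse (real (Suc n))"
      unfolding nh by (simp add: power2_eq_square field_simps del: of_nat_Suc)
    finally show ?thesis .
  qed
  have "uniform_limit (cball w0 1) ?g ?D sequentially"
  proof (rule uniform_limitI)
    fix \<epsilon> :: real assume \<epsilon>: "0 < \<epsilon>"
    have "(\<lambda>n. C * (norm y)\<^sup>2 * inverse (real (Suc n))) \<longlonglongrightarrow> C * (norm y)\<^sup>2 * 0"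
      by (intro tendsto_mult tendsto_const LIMSEQ_inverse_real_of_nat)
    then have "eventually (\<lambda>n. C * (norm y)\<^sup>2 * inverse (real (Suc n)) < \<epsilon>) sequentially"
      using \<epsilon> by (simp add: order_tendsto_iff)
    moreover obtain N :: nat where N: "norm y \<le> real N"
      using real_arch_simple by blast
    have "eventually (\<lambda>n. norm y \<le> real (Suc n)) sequentially"
      using N by (intro eventually_sequentiallyI[of N]) auto
    ultimately show "eventually (\<lambda>n. \<forall>w\<in>cball w0 1. dist (?g n w) (?D w) < \<epsilon>) sequentially"
    proof eventually_elim
      case (elim n)
      then show ?case
        using est[of _ n] unfolding dist_norm by (meson le_less_trans)
    qed
  qed
  then show "\<exists>d>0. cball w0 d \<subseteq> UNIV \<and> uniform_limit (cball w0 d) ?g ?D sequentially"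
    using zero_less_one by blast
qed

text \<open>The linear functionals \<open>F(w)\<close> with \<open>F(0) = 0\<close> whose derivative in \<open>w\<close> is the derivative of \<open>f\<close> at
  \<open>w *\<^sub>C e\<close>.\<close>

definition primitive :: "('e :: complex_normed_vector \<Rightarrow> complex) \<Rightarrow> 'e \<Rightarrow> complex \<Rightarrow> 'e \<Rightarrow> complex" where
  "primitive f e w y = contour_integral (linepath 0 w) (\<lambda>s. frechet_derivative f (at (s *\<^sub>C e)) y)"

context
  fixes f :: "'e :: complex_normed_vector \<Rightarrow> complex" and e :: 'e
  assumes f: "f \<in> holomorphic_bounded_type"
begin

lemma primitive_integrable:
  "(\<lambda>s. frechet_derivative f (at (s *\<^sub>C e)) y) contour_integrable_on linepath 0 w"
  by (intro contour_integrable_continuous_linepath holomorphic_on_imp_continuous_on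
      holomorphic_on_subset[OF holomorphic_derivative_along_line[OF f]]) auto

lemma primitive_add: "primitive f e w (y + z) = primitive f e w y + primitive f e w z"
  unfolding primitive_def using f
  by (simp add: holomorphic_bounded_type_def holomorphic_fun_linear contour_integral_add primitive_integrable)

lemma primitive_scale: "primitive f e w (c *\<^sub>C y) = c * primitive f e w y"
  unfolding primitive_def using f
  by (simp add: holomorphic_bounded_type_def holomorphic_fun_linear contour_integral_lmul primitive_integrable)

lemma primitive_derivative:
  "((\<lambda>w. primitive f e w y) has_field_derivative frechet_derivative f (at (w *\<^sub>C e)) y) (at w)"
proof -
  let ?D = "\<lambda>s. frechet_derivative f (at (s *\<^sub>C e)) y"
  obtain G where G: "\<And>x. (G has_field_derivative ?D x) (at x)"
    using holomorphic_convex_primitive'[OF convex_UNIV open_UNIV holomorphic_derivative_along_line[OF f]] by auto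
  have "primitive f e w y = G w - G 0" for w
  proof -
    have "(?D has_contour_integral (G (pathfinish (linepath 0 w)) - G (pathstart (linepath 0 w)))) (linepath 0 w)"
      by (rule contour_integral_primitive[of UNIV, OF _ valid_path_linepath]) (use G in auto)
    then show ?thesis
      unfolding primitive_def by (simp add: contour_integral_unique)
  qed
  then show ?thesis
    using DERIV_diff[OF G DERIV_const[of "G 0"]] by simp
qed

lemma primitive_bound:
  obtains C where "0 \<le> C" "\<And>w y. cmod w \<le> 1 \<Longrightarrow> cmod (primitive f e w y) \<le> C * norm y"
proof -
  obtain C where C: "0 \<le> C"
    "\<And>x y. norm x \<le> norm e \<Longrightarrow> cmod (frechet_derivative f (at x) y) \<le> C * norm y"
    by (rule bounded_type_estimates[OF f, of "norm e"], erule that, simp)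
  have "cmod (primitive f e w y) \<le> C * norm y" if w: "cmod w \<le> 1" for w y
  proof -
    have "cmod (primitive f e w y) \<le> (C * norm y) * cmod (w - 0)"
      unfolding primitive_def
    proof (rule contour_integral_bound_linepath[OF primitive_integrable])
      fix s assume "s \<in> closed_segment 0 w"
      then have "cmod s \<le> 1"
        using w segment_bound1[of s 0 w] by simp
      then have "norm (s *\<^sub>C e) \<le> norm e"
        by (simp add: norm_scaleC mult_left_le_one_le)
      then show "cmod (frechet_derivative f (at (s *\<^sub>C e)) y) \<le> C * norm y"
        by (rule C(2))
    qed (use C(1) in simp)
    also have "\<dots> \<le> C * norm y"
      using w C(1) by (simp add: mult_left_le)
    finally show ?thesis .
  qed
  then show ?thesis
    using that C(1) by blast
qed

end

section \<open>The representing functional\<close>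

lemma continuous_map_weak_star: "continuous_map weak_star_ball euclidean \<phi> \<longleftrightarrow> continuous_on dual_unit_ball \<phi>"
  by (simp add: weak_star_ball_eq)

definition resolvent :: "'e :: complex_normed_vector \<Rightarrow> ('e \<Rightarrow> complex) \<Rightarrow> complex" where
  "resolvent x \<gamma> = 1 / (1 - \<gamma> x)"

lemma dual_unit_ball_ne_1:
  assumes "\<gamma> \<in> dual_unit_ball" "norm x \<le> r" "r < 1"
  shows "1 - r \<le> cmod (1 - \<gamma> x)" "1 - \<gamma> x \<noteq> 0"
proof -
  have "cmod (\<gamma> x) \<le> r"
    using assms by (meson dual_unit_ball_iff order_trans)
  then show "1 - r \<le> cmod (1 - \<gamma> x)"
    using norm_triangle_ineq2[of 1 "\<gamma> x"] by simp
  then show "1 - \<gamma> x \<noteq> 0"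
    using \<open>r < 1\<close> by auto
qed

lemma continuous_map_resolvent:
  assumes "norm x < 1"
  shows "continuous_map weak_star_ball euclidean (resolvent x)"
    and "continuous_map weak_star_ball euclidean (\<lambda>\<gamma>. \<gamma> y / (1 - \<gamma> x)\<^sup>2)"
proof -
  have c: "continuous_on dual_unit_ball (\<lambda>\<gamma>. \<gamma> z)" for z :: 'a
    by (rule continuous_on_subset[OF continuous_on_product_coordinates]) simp
  have "1 - \<gamma> x \<noteq> 0" if "\<gamma> \<in> dual_unit_ball" for \<gamma>
    using dual_unit_ball_ne_1[OF that order_refl assms] by blast
  then show "continuous_map weak_star_ball euclidean (resolvent x)"
    "continuous_map weak_star_ball euclidean (\<lambda>\<gamma>. \<gamma> y / (1 - \<gamma> x)\<^sup>2)"
    unfolding continuous_map_weak_star resolvent_def[abs_def] by (auto intro!: continuous_intros c)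
qed

text \<open>With \<open>a = 1 - \<gamma> x\<close> and \<open>b = \<gamma> y\<close> the left-hand side is \<open>b\<^sup>2 / (a\<^sup>2 (a - b))\<close>.\<close>

lemma resolvent_expansion:
  assumes \<gamma>: "\<gamma> \<in> dual_unit_ball" and x: "norm x \<le> r" "norm (x + y) \<le> r" "r < 1"
  shows "cmod (resolvent (x + y) \<gamma> - resolvent x \<gamma> - \<gamma> y / (1 - \<gamma> x)\<^sup>2) \<le> (norm y)\<^sup>2 / (1 - r) ^ 3"
proof -
  note 1 = dual_unit_ball_ne_1[OF \<gamma> x(1,3)] and 2 = dual_unit_ball_ne_1[OF \<gamma> x(2,3)]
  let ?a = "1 - \<gamma> x"
  have s: "\<gamma> (x + y) = \<gamma> x + \<gamma> y" and ny: "cmod (\<gamma> y) \<le> norm y"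
    using \<gamma> by (auto simp: dual_unit_ball_iff)
  have "resolvent (x + y) \<gamma> - resolvent x \<gamma> - \<gamma> y / ?a\<^sup>2 = (\<gamma> y)\<^sup>2 / (?a\<^sup>2 * (1 - \<gamma> (x + y)))"
    using 1(2) 2(2) unfolding resolvent_def s
    by (simp add: divide_simps) (simp add: power2_eq_square algebra_simps)
  also have "cmod \<dots> = (cmod (\<gamma> y))\<^sup>2 / ((cmod ?a)\<^sup>2 * cmod (1 - \<gamma> (x + y)))"
    by (simp add: norm_divide norm_mult norm_power)
  also have "\<dots> \<le> (norm y)\<^sup>2 / ((1 - r)\<^sup>2 * (1 - r))"
    using 1(1) 2(1) ny x(3) by (intro frac_le power_mono mult_mono) auto
  also have "(1 - r)\<^sup>2 * (1 - r) = (1 - r) ^ 3"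
    by (simp add: power3_eq_cube power2_eq_square)
  finally show ?thesis .
qed

abbreviation (input) on_circle :: "real \<Rightarrow> complex" where
  "on_circle \<equiv> circlepath 0 1"

lemma norm_on_circle: "cmod (on_circle \<theta>) = 1"
  by (simp add: circlepath norm_exp_eq_Re)

lemma on_circle_nonzero: "on_circle \<theta> \<noteq> 0"
  using norm_on_circle[of \<theta>] by auto

lemma continuous_on_circle: "continuous_on S on_circle"
  by (auto simp: circlepath intro!: continuous_intros)

context entire_orthogonally_additive
begin

definition one :: "'k \<Rightarrow>\<^sub>C complex" where "one = const_bcontfun 1"

lemma apply_one [simp]: "apply_bcontfun one t = 1"
  by (simp add: one_def)

text \<open>The points \<open>\<omega>\<^sup>-\<^sup>1 \<delta>\<^sub>t\<close> of the dual ball, where \<open>\<omega>\<close> runs through the unit circle and \<open>\<delta>\<^sub>t\<close> is the evaluation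
  at \<open>t\<close>; the resolvent of \<open>x\<close> takes the value \<open>1 / (1 - \<omega>\<^sup>-\<^sup>1 x(t))\<close> there.\<close>

definition rotated_eval :: "real \<Rightarrow> 'k \<Rightarrow> ('k \<Rightarrow>\<^sub>C complex) \<Rightarrow> complex" where
  "rotated_eval \<theta> t x = apply_bcontfun x t / on_circle \<theta>"

definition pullback :: "(('k \<Rightarrow>\<^sub>C complex \<Rightarrow> complex) \<Rightarrow> complex) \<Rightarrow> real \<Rightarrow> 'k \<Rightarrow>\<^sub>C complex" where
  "pullback \<phi> \<theta> = Bcontfun (\<lambda>t. \<phi> (rotated_eval \<theta> t))"

text \<open>The functional \<open>\<Lambda>\<close> on \<open>C(B\<^sub>E\<^sub>')\<close> whose measure represents \<open>f\<close>: it averages \<open>F(\<omega>)\<close>, applied to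
  \<open>t \<mapsto> \<phi> (\<omega>\<^sup>-\<^sup>1 \<delta>\<^sub>t)\<close>, over the unit circle.\<close>

definition representing :: "(('k \<Rightarrow>\<^sub>C complex \<Rightarrow> complex) \<Rightarrow> complex) \<Rightarrow> complex" where
  "representing \<phi> = integral {0..1} (\<lambda>\<theta>. primitive f one (on_circle \<theta>) (pullback \<phi> \<theta>))"

lemma rotated_eval_mem: "rotated_eval \<theta> t \<in> dual_unit_ball"
  using on_circle_nonzero[of \<theta>] norm_on_circle[of \<theta>]
  by (auto simp: dual_unit_ball_iff rotated_eval_def apply_bcontfun_scaleC scaleC_complex_def
      add_divide_distrib norm_divide norm_bounded)

lemma continuous_rotated_eval: "continuous_on UNIV (\<lambda>p. rotated_eval (fst p) (snd p))"
proof (rule continuous_on_coordinatewise_then_product)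
  fix x :: "'k \<Rightarrow>\<^sub>C complex"
  show "continuous_on UNIV (\<lambda>p. rotated_eval (fst p) (snd p) x)"
    unfolding rotated_eval_def using on_circle_nonzero
    by (auto intro!: continuous_intros continuous_on_compose2[OF continuous_on_circle]
        continuous_on_compose2[OF continuous_on_apply_bcontfun])
qed

lemma continuous_along_eval:
  assumes "continuous_map weak_star_ball euclidean \<phi>"
  shows "continuous_on UNIV (\<lambda>p. \<phi> (rotated_eval (fst p) (snd p)))"
  using assms rotated_eval_mem unfolding continuous_map_weak_star
  by (auto intro!: continuous_on_compose2[OF _ continuous_rotated_eval])

lemma apply_pullback:
  assumes "continuous_map weak_star_ball euclidean \<phi>"
  shows "apply_bcontfun (pullback \<phi> \<theta>) t = \<phi> (rotated_eval \<theta> t)"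
proof -
  have "continuous_on UNIV (\<lambda>t. \<phi> (rotated_eval \<theta> t))"
    using continuous_on_compose2[OF continuous_along_eval[OF assms], of UNIV "\<lambda>t. (\<theta>, t)"]
    by (simp add: continuous_on_Pair)
  then show ?thesis
    by (simp add: pullback_def apply_Bcontfun)
qed

text \<open>Continuity in \<open>\<theta>\<close> is uniform in \<open>t\<close> because \<open>K\<close> is compact.\<close>

lemma continuous_pullback:
  assumes \<phi>: "continuous_map weak_star_ball euclidean \<phi>"
  shows "(pullback \<phi> \<longlongrightarrow> pullback \<phi> \<theta>) (at \<theta> within S)"
proof (rule tendstoI)
  fix \<epsilon> :: real assume \<epsilon>: "0 < \<epsilon>"
  have cont: "continuous_on (UNIV \<times> UNIV) (\<lambda>p. \<phi> (rotated_eval (fst p) (snd p)))"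
    using continuous_along_eval[OF \<phi>] by simp
  obtain X where X: "\<theta> \<in> X" "open X"
    "\<forall>x\<in>X \<inter> UNIV. \<forall>t\<in>UNIV. dist (\<phi> (rotated_eval (fst (x, t)) (snd (x, t))))
       (\<phi> (rotated_eval (fst (\<theta>, t)) (snd (\<theta>, t)))) \<le> \<epsilon> / 2"
    using continuous_on_prod_compactE[OF cont compact UNIV_I[of \<theta>] half_gt_zero[OF \<epsilon>]] by blast
  have "dist (pullback \<phi> x) (pullback \<phi> \<theta>) < \<epsilon>" if "x \<in> X" for x
  proof -
    have "dist (pullback \<phi> x) (pullback \<phi> \<theta>) \<le> \<epsilon> / 2"
      using X(3) that by (intro dist_bound) (auto simp: apply_pullback[OF \<phi>])
    then show ?thesis using \<epsilon> by simp
  qed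
  then show "\<forall>\<^sub>F x in at \<theta> within S. dist (pullback \<phi> x) (pullback \<phi> \<theta>) < \<epsilon>"
    using X(1,2) by (auto simp: eventually_at_topological)
qed

lemma primitive_diff: "primitive f one w (y - z) = primitive f one w y - primitive f one w z"
  using primitive_add[OF bounded_type, of one w "y - z" z] by simp

lemma continuous_integrand:
  assumes \<phi>: "continuous_map weak_star_ball euclidean \<phi>"
  shows "continuous_on S (\<lambda>\<theta>. primitive f one (on_circle \<theta>) (pullback \<phi> \<theta>))"
  unfolding continuous_on_def
proof
  fix \<theta> assume "\<theta> \<in> S"
  let ?F = "primitive f one"
  obtain C where C: "0 \<le> C" "\<And>w y. cmod w \<le> 1 \<Longrightarrow> cmod (?F w y) \<le> C * norm y"
    by (rule primitive_bound[OF bounded_type, of one], erule that, simp)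
  have "((\<lambda>x. C * norm (pullback \<phi> x - pullback \<phi> \<theta>)) \<longlongrightarrow> C * norm (pullback \<phi> \<theta> - pullback \<phi> \<theta>)) (at \<theta> within S)"
    by (intro tendsto_intros continuous_pullback[OF \<phi>])
  then have "((\<lambda>x. C * norm (pullback \<phi> x - pullback \<phi> \<theta>)) \<longlongrightarrow> 0) (at \<theta> within S)"
    by simp
  then have 1: "((\<lambda>x. ?F (on_circle x) (pullback \<phi> x - pullback \<phi> \<theta>)) \<longlongrightarrow> 0) (at \<theta> within S)"
    by (rule Lim_null_comparison[rotated]) (auto intro!: always_eventually C simp: norm_on_circle)
  have "((\<lambda>x. ?F (on_circle x) (pullback \<phi> \<theta>)) \<longlongrightarrow> ?F (on_circle \<theta>) (pullback \<phi> \<theta>)) (at \<theta> within S)"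
  proof (rule isCont_tendsto_compose[where g = "\<lambda>w. ?F w (pullback \<phi> \<theta>)"])
    show "isCont (\<lambda>w. ?F w (pullback \<phi> \<theta>)) (on_circle \<theta>)"
      using primitive_derivative[OF bounded_type] by (rule DERIV_isCont)
    show "(on_circle \<longlongrightarrow> on_circle \<theta>) (at \<theta> within S)"
      using continuous_on_circle[of S] \<open>\<theta> \<in> S\<close> by (simp add: continuous_on_def)
  qed
  from tendsto_add[OF 1 this]
  show "((\<lambda>x. ?F (on_circle x) (pullback \<phi> x)) \<longlongrightarrow> ?F (on_circle \<theta>) (pullback \<phi> \<theta>)) (at \<theta> within S)"
    by (simp add: primitive_diff)
qed

lemma representing_integrable:
  assumes "continuous_map weak_star_ball euclidean \<phi>"
  shows "(\<lambda>\<theta>. primitive f one (on_circle \<theta>) (pullback \<phi> \<theta>)) integrable_on {0..1}"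
  by (intro integrable_continuous_real continuous_integrand assms)

lemma representing_cong:
  assumes "\<And>\<theta> t. \<phi> (rotated_eval \<theta> t) = \<psi> (rotated_eval \<theta> t)"
  shows "representing \<phi> = representing \<psi>"
  by (simp add: representing_def pullback_def assms)

lemma bounded_functional_representing:
  obtains C where "bounded_functional weak_star_ball representing C"
proof -
  obtain C where C: "0 \<le> C" "\<And>w y. cmod w \<le> 1 \<Longrightarrow> cmod (primitive f one w y) \<le> C * norm y"
    by (rule primitive_bound[OF bounded_type, of one], erule that, simp)
  have "bounded_functional weak_star_ball representing C"
  proof
    show "compact_space (weak_star_ball :: ('k \<Rightarrow>\<^sub>C complex \<Rightarrow> complex) topology)"
      "Hausdorff_space (weak_star_ball :: ('k \<Rightarrow>\<^sub>C complex \<Rightarrow> complex) topology)"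
      by (rule compact_space_weak_star_ball Hausdorff_space_weak_star_ball)+
  next
    fix \<phi> \<psi> :: "('k \<Rightarrow>\<^sub>C complex \<Rightarrow> complex) \<Rightarrow> complex"
    assume \<phi>: "continuous_map weak_star_ball euclidean \<phi>" and \<psi>: "continuous_map weak_star_ball euclidean \<psi>"
    have "pullback (\<lambda>x. \<phi> x + \<psi> x) \<theta> = pullback \<phi> \<theta> + pullback \<psi> \<theta>" for \<theta>
      using \<phi> \<psi> by (intro bcontfun_eqI) (simp add: apply_pullback continuous_map_add)
    then show "representing (\<lambda>x. \<phi> x + \<psi> x) = representing \<phi> + representing \<psi>"
      unfolding representing_def using representing_integrable[OF \<phi>] representing_integrable[OF \<psi>]
      by (simp add: primitive_add[OF bounded_type] Henstock_Kurzweil_Integration.integral_add)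
  next
    fix \<phi> :: "('k \<Rightarrow>\<^sub>C complex \<Rightarrow> complex) \<Rightarrow> complex" and c :: complex
    assume \<phi>: "continuous_map weak_star_ball euclidean \<phi>"
    have "continuous_map weak_star_ball euclidean (\<lambda>x. c * \<phi> x)"
      using \<phi> by (intro continuous_map_mult_complex) auto
    then have "pullback (\<lambda>x. c * \<phi> x) \<theta> = c *\<^sub>C pullback \<phi> \<theta>" for \<theta>
      using \<phi> by (intro bcontfun_eqI) (simp add: apply_pullback apply_bcontfun_scaleC scaleC_complex_def)
    then show "representing (\<lambda>x. c * \<phi> x) = c * representing \<phi>"
      unfolding representing_def by (simp add: primitive_scale[OF bounded_type])
  next
    fix \<phi> :: "('k \<Rightarrow>\<^sub>C complex \<Rightarrow> complex) \<Rightarrow> complex" and B :: real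
    assume \<phi>: "continuous_map weak_star_ball euclidean \<phi>" and B: "0 \<le> B"
      "\<And>x. x \<in> topspace weak_star_ball \<Longrightarrow> cmod (\<phi> x) \<le> B"
    have orb: "norm (pullback \<phi> \<theta>) \<le> B" for \<theta>
      using B(2) rotated_eval_mem by (intro norm_bound) (simp add: apply_pullback[OF \<phi>] topspace_weak_star_ball)
    have le: "cmod (primitive f one (on_circle \<theta>) (pullback \<phi> \<theta>)) \<le> C * B" for \<theta>
      by (rule order_trans[OF C(2) mult_left_mono[OF orb C(1)]]) (simp add: norm_on_circle)
    show "cmod (representing \<phi>) \<le> C * B"
      unfolding representing_def using integral_bound[OF _ continuous_integrand[OF \<phi>], of 0 1 "C * B"] le by simp
  qed
  then show ?thesis by (rule that)
qed

text \<open>Cauchy's formula for the unit circle, parametrised by the unit interval.\<close>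

lemma has_integral_circle_cauchy:
  assumes g: "g holomorphic_on UNIV" and w: "cmod w < 1"
  shows "((\<lambda>\<theta>. on_circle \<theta> / (on_circle \<theta> - w) ^ Suc k * g (on_circle \<theta>)) has_integral (deriv ^^ k) g w / fact k) {0..1}"
proof -
  let ?I = "(deriv ^^ k) g w / fact k"
  have "((\<lambda>u. g u / (u - w) ^ Suc k) has_contour_integral ((2 * pi * \<i>) / fact k * (deriv ^^ k) g w)) (circlepath 0 1)"
    using w holomorphic_on_subset[OF g] holomorphic_on_imp_continuous_on
    by (intro Cauchy_has_contour_integral_higher_derivative_circlepath) auto
  then have "((\<lambda>\<theta>. g (on_circle \<theta>) / (on_circle \<theta> - w) ^ Suc k *
      vector_derivative on_circle (at \<theta> within {0..1})) has_integral (2 * pi * \<i>) * ?I) {0..1}"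
    by (simp add: has_contour_integral_def)
  then have "((\<lambda>\<theta>. (2 * pi * \<i>) * (on_circle \<theta> / (on_circle \<theta> - w) ^ Suc k * g (on_circle \<theta>)))
      has_integral (2 * pi * \<i>) * ?I) {0..1}"
  proof (rule has_integral_eq[rotated])
    fix \<theta> :: real assume "\<theta> \<in> {0..1}"
    then have "vector_derivative on_circle (at \<theta> within {0..1}) = 2 * pi * \<i> * on_circle \<theta>"
      using vector_derivative_circlepath01[of \<theta> 0 1] by (simp add: circlepath[of 0 1])
    then show "g (on_circle \<theta>) / (on_circle \<theta> - w) ^ Suc k * vector_derivative on_circle (at \<theta> within {0..1})
        = (2 * pi * \<i>) * (on_circle \<theta> / (on_circle \<theta> - w) ^ Suc k * g (on_circle \<theta>))"
      by simp
  qed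
  from has_integral_mult_right[OF this, of "inverse (2 * pi * \<i>)"]
  have "((\<lambda>\<theta>. inverse (2 * pi * \<i>) * ((2 * pi * \<i>) * (on_circle \<theta> / (on_circle \<theta> - w) ^ Suc k * g (on_circle \<theta>))))
      has_integral inverse (2 * pi * \<i>) * ((2 * pi * \<i>) * ?I)) {0..1}" .
  moreover have "inverse (2 * pi * \<i>) * ((2 * pi * \<i>) * z) = z" for z
    by (simp add: field_simps)
  ultimately show ?thesis
    by (simp only:)
qed

lemma holomorphic_primitive: "(\<lambda>u. primitive f one u y) holomorphic_on S"
  using primitive_derivative[OF bounded_type]
  by (meson holomorphic_on_def has_field_derivative_at_within field_differentiable_def)

lemma norm_scale_one: "norm (w *\<^sub>C one) \<le> cmod w"
  by (rule norm_bound) (simp add: apply_bcontfun_scaleC scaleC_complex_def)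

text \<open>The derivatives of \<open>f\<close> and of \<open>x \<mapsto> \<Lambda>(1 / (1 - \<gamma> x))\<close> agree at the constant functions: applied to the
  integrand, \<open>F(\<omega>)\<close> gives \<open>\<omega> F(\<omega>)(y) / (\<omega> - w)\<^sup>2\<close>, and Cauchy's formula for the derivative of
  \<open>\<omega> \<mapsto> F(\<omega>)(y)\<close> at \<open>w\<close> evaluates the average.\<close>

lemma representing_resolvent_derivative:
  assumes w: "cmod w < 1"
  shows "representing (\<lambda>\<gamma>. \<gamma> y / (1 - \<gamma> (w *\<^sub>C one))\<^sup>2) = frechet_derivative f (at (w *\<^sub>C one)) y"
proof -
  have n: "norm (w *\<^sub>C one) < 1"
    using norm_scale_one[of w] w by simp
  have orb: "pullback (\<lambda>\<gamma>. \<gamma> y / (1 - \<gamma> (w *\<^sub>C one))\<^sup>2) \<theta> = (on_circle \<theta> / (on_circle \<theta> - w)\<^sup>2) *\<^sub>C y" for \<theta>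
  proof (rule bcontfun_eqI)
    fix t
    have "on_circle \<theta> - w \<noteq> 0"
      using w norm_on_circle[of \<theta>] by auto
    then have "apply_bcontfun y t / on_circle \<theta> / (1 - w / on_circle \<theta>)\<^sup>2
        = on_circle \<theta> / (on_circle \<theta> - w)\<^sup>2 * apply_bcontfun y t"
      using on_circle_nonzero[of \<theta>] by (simp add: divide_simps) (simp add: power2_eq_square algebra_simps)
    then show "apply_bcontfun (pullback (\<lambda>\<gamma>. \<gamma> y / (1 - \<gamma> (w *\<^sub>C one))\<^sup>2) \<theta>) t
        = apply_bcontfun ((on_circle \<theta> / (on_circle \<theta> - w)\<^sup>2) *\<^sub>C y) t"
      by (simp add: apply_pullback[OF continuous_map_resolvent(2)[OF n]] rotated_eval_def
          apply_bcontfun_scaleC scaleC_complex_def)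
  qed
  have "deriv (\<lambda>u. primitive f one u y) w = frechet_derivative f (at (w *\<^sub>C one)) y"
    using primitive_derivative[OF bounded_type] by (rule DERIV_imp_deriv)
  then show ?thesis
    using has_integral_circle_cauchy[OF holomorphic_primitive w, of 1 y]
    unfolding representing_def orb primitive_scale[OF bounded_type]
    by (simp add: power2_eq_square integral_unique)
qed

lemma representing_resolvent_zero: "representing (resolvent 0) = 0"
proof -
  have "pullback (resolvent 0) \<theta> = one" for \<theta>
    by (rule bcontfun_eqI)
      (simp add: apply_pullback[OF continuous_map_resolvent(1)] rotated_eval_def resolvent_def)
  moreover have "primitive f one 0 one = 0"
    by (simp add: primitive_def)
  ultimately show ?thesis
    using has_integral_circle_cauchy[OF holomorphic_primitive, of 0 0 one] on_circle_nonzero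
    unfolding representing_def by (simp add: integral_unique)
qed

section \<open>Comparison of the function with its representation\<close>

definition defect :: "('k \<Rightarrow>\<^sub>C complex) \<Rightarrow> complex" where
  "defect x = f x - representing (resolvent x)"

text \<open>The function \<open>f\<close> is local by the theorem above, and \<open>\<Lambda>\<close> only sees the resolvent of \<open>x\<close> at the points
  \<open>\<omega>\<^sup>-\<^sup>1 \<delta>\<^sub>t\<close>, where it depends on \<open>x(t)\<close> alone.\<close>

lemma defect_local:
  assumes uv: "\<And>t. apply_bcontfun u t = 0 \<or> apply_bcontfun v t = 0"
    and n: "norm x < 1" "norm (x + u) < 1" "norm (x + v) < 1" "norm (x + u + v) < 1"
  shows "defect (x + u + v) + defect x = defect (x + u) + defect (x + v)"
proof -
  obtain C where "bounded_functional weak_star_ball representing C"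
    by (rule bounded_functional_representing)
  then interpret bounded_functional weak_star_ball representing C .
  note c = n[THEN continuous_map_resolvent(1)]
  have "representing (resolvent (x + u + v)) + representing (resolvent x)
      = representing (\<lambda>\<gamma>. resolvent (x + u + v) \<gamma> + resolvent x \<gamma>)"
    by (rule add[OF c(4,1), symmetric])
  also have "\<dots> = representing (\<lambda>\<gamma>. resolvent (x + u) \<gamma> + resolvent (x + v) \<gamma>)"
  proof (rule representing_cong)
    fix \<theta> t
    show "resolvent (x + u + v) (rotated_eval \<theta> t) + resolvent x (rotated_eval \<theta> t)
        = resolvent (x + u) (rotated_eval \<theta> t) + resolvent (x + v) (rotated_eval \<theta> t)"
      using uv[of t] by (auto simp: resolvent_def rotated_eval_def)
  qed
  also have "\<dots> = representing (resolvent (x + u)) + representing (resolvent (x + v))"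
    by (rule add[OF c(2,3)])
  finally show ?thesis
    using locality[OF uv, of x] by (simp add: defect_def algebra_simps)
qed

lemma representing_expansion:
  obtains C where "0 \<le> C"
    "\<And>x y r. norm x \<le> r \<Longrightarrow> norm (x + y) \<le> r \<Longrightarrow> r < 1 \<Longrightarrow>
      cmod (representing (resolvent (x + y)) - representing (resolvent x)
        - representing (\<lambda>\<gamma>. \<gamma> y / (1 - \<gamma> x)\<^sup>2)) \<le> C * ((norm y)\<^sup>2 / (1 - r) ^ 3)"
proof -
  obtain C where C: "bounded_functional weak_star_ball representing C"
    by (rule bounded_functional_representing)
  then interpret bounded_functional weak_star_ball representing C .
  have "cmod (representing (resolvent (x + y)) - representing (resolvent x)
        - representing (\<lambda>\<gamma>. \<gamma> y / (1 - \<gamma> x)\<^sup>2)) \<le> C * ((norm y)\<^sup>2 / (1 - r) ^ 3)"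
    if x: "norm x \<le> r" "norm (x + y) \<le> r" "r < 1" for x y r
  proof -
    let ?l = "\<lambda>\<gamma>. \<gamma> y / (1 - \<gamma> x)\<^sup>2"
    have n: "norm x < 1" "norm (x + y) < 1"
      using x by auto
    note c = continuous_map_resolvent(1)[OF n(2)] continuous_map_resolvent(1)[OF n(1)]
      continuous_map_resolvent(2)[OF n(1), of y]
    have c': "continuous_map weak_star_ball euclidean (\<lambda>\<gamma>. resolvent x \<gamma> + ?l \<gamma>)"
      by (rule continuous_map_add[OF c(2,3)])
    have c'': "continuous_map weak_star_ball euclidean (\<lambda>\<gamma>. - 1 * (resolvent x \<gamma> + ?l \<gamma>))"
      by (intro continuous_map_mult_complex c') simp
    have "representing (resolvent (x + y)) - representing (resolvent x) - representing ?l
        = representing (\<lambda>\<gamma>. resolvent (x + y) \<gamma> + - 1 * (resolvent x \<gamma> + ?l \<gamma>))"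
      unfolding add[OF c(1) c''] scale[OF c'] add[OF c(2,3)] by simp
    also have "cmod \<dots> \<le> C * ((norm y)\<^sup>2 / (1 - r) ^ 3)"
    proof (rule bound[OF continuous_map_add[OF c(1) c'']])
      fix \<gamma> assume "\<gamma> \<in> topspace (weak_star_ball :: ('k \<Rightarrow>\<^sub>C complex \<Rightarrow> complex) topology)"
      then have "\<gamma> \<in> dual_unit_ball"
        by (simp add: topspace_weak_star_ball)
      from resolvent_expansion[OF this x]
      show "cmod (resolvent (x + y) \<gamma> + - 1 * (resolvent x \<gamma> + ?l \<gamma>)) \<le> (norm y)\<^sup>2 / (1 - r) ^ 3"
        by (simp add: algebra_simps)
    qed (use x in simp)
    finally show ?thesis .
  qed
  then show ?thesis
    using that C_nonneg by blast
qed

text \<open>The first-order terms of \<open>f\<close> and of its candidate representation cancel at constant functions, so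
  the defect is of second order there, uniformly in a ball.\<close>

lemma defect_flat:
  assumes r: "r < 1"
  obtains C where "0 \<le> C"
    "\<And>w y. cmod w \<le> r \<Longrightarrow> norm y \<le> 1 \<Longrightarrow> norm (w *\<^sub>C one + y) \<le> r \<Longrightarrow>
      cmod (defect (w *\<^sub>C one + y) - defect (w *\<^sub>C one)) \<le> C * (norm y)\<^sup>2"
proof -
  let ?D = "\<lambda>x. frechet_derivative f (at x)"
  obtain A where A0: "0 \<le> A"
    and A: "\<And>x y. norm x \<le> r \<Longrightarrow> norm y \<le> 1 \<Longrightarrow> cmod (f (x + y) - f x - ?D x y) \<le> A * (norm y)\<^sup>2"
    by (rule bounded_type_estimates[OF bounded_type, of r], erule that, simp)
  obtain B where B: "0 \<le> B" "\<And>x y r. norm x \<le> r \<Longrightarrow> norm (x + y) \<le> r \<Longrightarrow> r < 1 \<Longrightarrow>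
      cmod (representing (resolvent (x + y)) - representing (resolvent x)
        - representing (\<lambda>\<gamma>. \<gamma> y / (1 - \<gamma> x)\<^sup>2)) \<le> B * ((norm y)\<^sup>2 / (1 - r) ^ 3)"
    by (rule representing_expansion, erule that, simp)
  show ?thesis
  proof (rule that[of "A + B / (1 - r) ^ 3"])
    show "0 \<le> A + B / (1 - r) ^ 3"
      using A0 B(1) r by simp
    fix w and y :: "'k \<Rightarrow>\<^sub>C complex"
    assume w: "cmod w \<le> r" and y: "norm y \<le> 1" "norm (w *\<^sub>C one + y) \<le> r"
    let ?x = "w *\<^sub>C one"
    have n: "norm ?x \<le> r"
      using norm_scale_one[of w] w by simp
    let ?d1 = "f (?x + y) - f ?x - ?D ?x y"
    let ?d2 = "representing (resolvent (?x + y)) - representing (resolvent ?x) - ?D ?x y"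
    have "representing (\<lambda>\<gamma>. \<gamma> y / (1 - \<gamma> ?x)\<^sup>2) = ?D ?x y"
      using w r by (intro representing_resolvent_derivative) simp
    then have "cmod ?d2 \<le> B * ((norm y)\<^sup>2 / (1 - r) ^ 3)"
      using B(2)[OF n y(2) r] by simp
    moreover have "cmod ?d1 \<le> A * (norm y)\<^sup>2"
      by (rule A[OF n y(1)])
    moreover have "defect (?x + y) - defect ?x = ?d1 - ?d2"
      by (simp add: defect_def)
    moreover have "cmod (?d1 - ?d2) \<le> cmod ?d1 + cmod ?d2"
      by (rule norm_triangle_ineq4)
    ultimately have "cmod (defect (?x + y) - defect ?x) \<le> A * (norm y)\<^sup>2 + B * ((norm y)\<^sup>2 / (1 - r) ^ 3)"
      by simp
    then show "cmod (defect (?x + y) - defect ?x) \<le> (A + B / (1 - r) ^ 3) * (norm y)\<^sup>2"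
      by (simp add: algebra_simps)
  qed
qed

text \<open>Let \<open>X j\<close> be \<open>x\<close> truncated at the height \<open>w j\<close>, where the heights divide
  \<open>[-r, r]\<close> into \<open>N\<close> steps. The layer between two truncations lives where \<open>X j\<close> already equals the constant
  \<open>w j\<close>, so by locality it changes the defect just as if it were added to that constant, that is, by
  \<open>O(1 / N\<^sup>2)\<close>. The \<open>N\<close> layers together contribute \<open>O(1 / N)\<close>.\<close>

lemma defect_constant_real:
  assumes r: "0 \<le> r" "r < 1" and x: "\<And>t. Im (apply_bcontfun x t) = 0" "norm x \<le> r"
  shows "defect x = defect (complex_of_real (- r) *\<^sub>C one)"
proof -
  obtain C where C: "0 \<le> C"
    "\<And>w y. cmod w \<le> r \<Longrightarrow> norm y \<le> 1 \<Longrightarrow> norm (w *\<^sub>C one + y) \<le> r \<Longrightarrow>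
      cmod (defect (w *\<^sub>C one + y) - defect (w *\<^sub>C one)) \<le> C * (norm y)\<^sup>2"
    by (rule defect_flat[OF r(2)], erule that, simp)
  define \<rho> where "\<rho> t = Re (apply_bcontfun x t)" for t
  have \<rho>: "- r \<le> \<rho> t" "\<rho> t \<le> r" "apply_bcontfun x t = complex_of_real (\<rho> t)" for t
  proof -
    have "cmod (apply_bcontfun x t) \<le> r"
      using norm_bounded[of x t] x(2) by linarith
    then show "- r \<le> \<rho> t" "\<rho> t \<le> r"
      using abs_Re_le_cmod[of "apply_bcontfun x t"] by (auto simp: \<rho>_def)
    show "apply_bcontfun x t = complex_of_real (\<rho> t)"
      using x(1)[of t] by (simp add: \<rho>_def complex_eq_iff)
  qed
  have \<rho>_cont: "continuous_on UNIV \<rho>"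
    unfolding \<rho>_def by (intro continuous_intros) simp
  have bound: "cmod (defect x - defect (complex_of_real (- r) *\<^sub>C one)) \<le> 4 * C * r\<^sup>2 / real N" if N: "2 \<le> N" for N
  proof -
    define h where "h = 2 * r / real N"
    have h: "0 \<le> h" "h \<le> 1"
      using r N by (auto simp: h_def field_simps)
    define w where "w j = - r + h * real j" for j
    have w: "- r \<le> w j" "w j \<le> r" "w (Suc j) = w j + h" if "j \<le> N" for j
    proof -
      have "h * real j \<le> h * real N"
        using that h(1) by (intro mult_left_mono) auto
      also have "\<dots> = 2 * r"
        using N by (simp add: h_def)
      finally show "w j \<le> r" "- r \<le> w j" "w (Suc j) = w j + h"
        using h(1) by (auto simp: w_def algebra_simps)
    qed
    define X where "X j = Bcontfun (\<lambda>t. complex_of_real (min (\<rho> t) (w j)))" for j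
    have X: "apply_bcontfun (X j) t = complex_of_real (min (\<rho> t) (w j))" for j t
      unfolding X_def using \<rho>_cont by (subst apply_Bcontfun) (auto intro!: continuous_intros)
    have const: "apply_bcontfun (complex_of_real s *\<^sub>C one) t = complex_of_real s" for s t
      by (simp add: apply_bcontfun_scaleC scaleC_complex_def)
    have step: "cmod (defect (X (Suc j)) - defect (X j)) \<le> C * h\<^sup>2" if j: "j < N" for j
    proof -
      let ?w = "complex_of_real (w j) *\<^sub>C one" and ?c = "X (Suc j) - X j"
      \<comment> \<open>Adding \<open>v\<close> to \<open>X j\<close> yields the constant \<open>w j\<close>, and \<open>v\<close> vanishes wherever the layer \<open>?c\<close> does not.\<close>
      define v where "v = ?w - X j"
      note wj = w[of j] and wj' = w[of "Suc j"]
      have c: "apply_bcontfun ?c t = complex_of_real (min (\<rho> t) (w (Suc j)) - min (\<rho> t) (w j))" for t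
        by (simp add: X)
      have v: "apply_bcontfun v t = complex_of_real (w j - min (\<rho> t) (w j))" for t
        by (simp add: v_def X const)
      have nX: "norm (X i) \<le> r" if "i \<le> N" for i
      proof (rule norm_bound)
        fix t
        show "cmod (apply_bcontfun (X i) t) \<le> r"
          unfolding X norm_of_real using \<rho>(1)[of t] \<rho>(2)[of t] w[OF that] by (auto simp: abs_le_iff min_def)
      qed
      have nw: "norm ?w \<le> r"
        using wj j by (intro norm_bound) (auto simp: const abs_le_iff)
      have nwc: "norm (?w + ?c) \<le> r"
      proof (rule norm_bound)
        fix t
        have "apply_bcontfun (?w + ?c) t = complex_of_real (w j + (min (\<rho> t) (w (Suc j)) - min (\<rho> t) (w j)))"
          by (simp only: plus_bcontfun.rep_eq c const of_real_add)
        then have "cmod (apply_bcontfun (?w + ?c) t) = \<bar>w j + (min (\<rho> t) (w (Suc j)) - min (\<rho> t) (w j))\<bar>"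
          by (simp only: norm_of_real)
        also have "\<dots> \<le> r"
          using \<rho>(2)[of t] wj wj' j h(1) by (auto simp: min_def)
        finally show "cmod (apply_bcontfun (?w + ?c) t) \<le> r" .
      qed
      have nc: "norm ?c \<le> h"
      proof (rule norm_bound)
        fix t
        show "cmod (apply_bcontfun ?c t) \<le> h"
          unfolding c norm_of_real using wj(3) j h(1) by (auto simp: min_def)
      qed
      have "defect (X j + ?c + v) + defect (X j) = defect (X j + ?c) + defect (X j + v)"
      proof (rule defect_local)
        show "apply_bcontfun ?c t = 0 \<or> apply_bcontfun v t = 0" for t
          unfolding c v using wj(3) j h(1) by (auto simp: min_def)
        have eq: "X j + ?c = X (Suc j)" "X j + v = ?w" "X (Suc j) + v = ?w + ?c"
          by (simp_all add: v_def)
        show "norm (X j) < 1" "norm (X j + ?c) < 1" "norm (X j + v) < 1" "norm (X j + ?c + v) < 1"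
          unfolding eq using j le_less_trans[OF nX r(2)] le_less_trans[OF nw r(2)] le_less_trans[OF nwc r(2)]
          by simp_all
      qed
      then have "defect (X (Suc j)) - defect (X j) = defect (?w + ?c) - defect ?w"
        by (simp add: v_def algebra_simps)
      also have "cmod \<dots> \<le> C * (norm ?c)\<^sup>2"
        using nwc nc h(2) wj j by (intro C(2)) (auto simp: abs_le_iff)
      also have "\<dots> \<le> C * h\<^sup>2"
        using nc C(1) by (intro mult_left_mono power_mono) auto
      finally show ?thesis .
    qed
    have X0: "X 0 = complex_of_real (- r) *\<^sub>C one"
      using \<rho>(1) by (intro bcontfun_eqI) (simp add: X const w_def min_absorb2 del: of_real_minus)
    have "w N = r"
      using N by (simp add: w_def h_def)
    then have XN: "X N = x"
      using \<rho>(2,3) by (intro bcontfun_eqI) (simp add: X min_absorb1)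
    have "defect x - defect (complex_of_real (- r) *\<^sub>C one) = (\<Sum>j<N. defect (X (Suc j)) - defect (X j))"
      using sum_lessThan_telescope[of "\<lambda>j. defect (X j)" N] by (simp only: X0 XN)
    also have "cmod \<dots> \<le> (\<Sum>j<N. C * h\<^sup>2)"
      using step by (intro sum_norm_le) auto
    also have "\<dots> = 4 * C * r\<^sup>2 / real N"
      using N by (simp add: h_def power2_eq_square field_simps)
    finally show ?thesis .
  qed
  have "(\<lambda>N. 4 * C * r\<^sup>2 / real N) \<longlonglongrightarrow> 0"
    by real_asymp
  then have "cmod (defect x - defect (complex_of_real (- r) *\<^sub>C one)) \<le> 0"
    using bound by (intro LIMSEQ_le_const[where X = "\<lambda>N. 4 * C * r\<^sup>2 / real N"]) auto
  then show ?thesis by simp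
qed

lemma defect_real:
  assumes x: "\<And>t. Im (apply_bcontfun x t) = 0" "norm x < 1"
  shows "defect x = 0"
proof -
  have "f (0 + 0) = f 0 + f 0"
    using orthogonal unfolding orthogonally_additive_def by (metis mult_zero_left zero_bcontfun.rep_eq)
  then have "defect 0 = 0"
    by (simp add: defect_def representing_resolvent_zero)
  then show ?thesis
    using defect_constant_real[OF norm_ge_zero x(2) x(1) order_refl]
      defect_constant_real[OF norm_ge_zero x(2), of 0] by simp
qed

text \<open>The second-order expansion of the resolvent, transported by the bounded functional, shows that the
  difference quotients converge.\<close>

lemma holomorphic_defect_on_line:
  "(\<lambda>z. defect (a + z *\<^sub>C b)) holomorphic_on {z. norm (a + z *\<^sub>C b) < 1}"
proof -
  obtain K where K: "bounded_functional weak_star_ball representing K"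
    by (rule bounded_functional_representing)
  obtain C where C: "0 \<le> C" "\<And>x y r. norm x \<le> r \<Longrightarrow> norm (x + y) \<le> r \<Longrightarrow> r < 1 \<Longrightarrow>
      cmod (representing (resolvent (x + y)) - representing (resolvent x)
        - representing (\<lambda>\<gamma>. \<gamma> y / (1 - \<gamma> x)\<^sup>2)) \<le> C * ((norm y)\<^sup>2 / (1 - r) ^ 3)"
    by (rule representing_expansion, erule that, simp)
  define H where "H z = representing (resolvent (a + z *\<^sub>C b))" for z
  have "(H has_field_derivative representing (\<lambda>\<gamma>. \<gamma> b / (1 - \<gamma> (a + z *\<^sub>C b))\<^sup>2)) (at z)"
    if z: "norm (a + z *\<^sub>C b) < 1" for z
  proof -
    let ?x = "a + z *\<^sub>C b"
    let ?T = "representing (\<lambda>\<gamma>. \<gamma> b / (1 - \<gamma> ?x)\<^sup>2)"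
    obtain r where r: "norm ?x < r" "r < 1"
      using z dense by blast
    define \<delta> where "\<delta> = (r - norm ?x) / (norm b + 1)"
    have \<delta>: "0 < \<delta>"
      using r(1) by (simp add: \<delta>_def add_nonneg_pos)
    let ?M = "C * (norm b)\<^sup>2 / (1 - r) ^ 3"
    have quot: "cmod ((H (z + s) - H z) / s - ?T) \<le> ?M * cmod s" if s: "cmod s < \<delta>" "s \<noteq> 0" for s
    proof -
      have "cmod s * norm b \<le> cmod s * (norm b + 1)"
        by (intro mult_left_mono) auto
      also have "\<dots> < r - norm ?x"
        using s(1) by (simp add: \<delta>_def pos_less_divide_eq add_nonneg_pos)
      finally have "norm (?x + s *\<^sub>C b) \<le> r"
        using norm_triangle_ineq[of ?x "s *\<^sub>C b"] by (simp add: norm_scaleC)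
      then have "cmod (representing (resolvent (?x + s *\<^sub>C b)) - representing (resolvent ?x)
          - representing (\<lambda>\<gamma>. \<gamma> (s *\<^sub>C b) / (1 - \<gamma> ?x)\<^sup>2)) \<le> C * ((norm (s *\<^sub>C b))\<^sup>2 / (1 - r) ^ 3)"
        using r by (intro C(2)) auto
      moreover have "representing (\<lambda>\<gamma>. \<gamma> (s *\<^sub>C b) / (1 - \<gamma> ?x)\<^sup>2) = s * ?T"
      proof -
        have "representing (\<lambda>\<gamma>. \<gamma> (s *\<^sub>C b) / (1 - \<gamma> ?x)\<^sup>2) = representing (\<lambda>\<gamma>. s * (\<gamma> b / (1 - \<gamma> ?x)\<^sup>2))"
          by (rule representing_cong) (simp add: rotated_eval_def apply_bcontfun_scaleC scaleC_complex_def)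
        then show ?thesis
          using bounded_functional.scale[OF K continuous_map_resolvent(2)[OF z]] by simp
      qed
      moreover have "H (z + s) = representing (resolvent (?x + s *\<^sub>C b))" "H z = representing (resolvent ?x)"
        by (simp_all add: H_def scaleC_add_left add.assoc)
      ultimately have "cmod (H (z + s) - H z - s * ?T) \<le> ?M * (cmod s)\<^sup>2"
        by (simp add: norm_scaleC power_mult_distrib mult_ac)
      moreover have "(H (z + s) - H z) / s - ?T = (H (z + s) - H z - s * ?T) / s"
        using s(2) by (simp add: field_simps)
      ultimately show ?thesis
        using s(2) by (simp add: norm_divide divide_le_eq power2_eq_square mult_ac)
    qed
    have "(\<lambda>s. ?M * cmod s) \<midarrow>0\<rightarrow> ?M * cmod 0"
      by (intro tendsto_intros)
    then have "(\<lambda>s. ?M * cmod s) \<midarrow>0\<rightarrow> 0"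
      by simp
    then have "(\<lambda>s. (H (z + s) - H z) / s - ?T) \<midarrow>0\<rightarrow> 0"
    proof (rule Lim_null_comparison[rotated])
      show "\<forall>\<^sub>F s in at 0. cmod ((H (z + s) - H z) / s - ?T) \<le> ?M * cmod s"
        unfolding eventually_at using \<delta> quot by (intro exI[of _ \<delta>]) auto
    qed
    then show ?thesis
      by (simp add: DERIV_def LIM_zero_cancel)
  qed
  then have "H holomorphic_on {z. norm (a + z *\<^sub>C b) < 1}"
    unfolding holomorphic_on_def field_differentiable_def
    by (auto intro: has_field_derivative_at_within)
  then have "(\<lambda>z. f (a + z *\<^sub>C b) - H z) holomorphic_on {z. norm (a + z *\<^sub>C b) < 1}"
    by (intro holomorphic_on_diff holomorphic_on_line holo)
  then show ?thesis
    by (simp add: defect_def H_def)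
qed

text \<open>On the line \<open>z \<mapsto> Re x + z Im x\<close> the defect is holomorphic near the segment from \<open>0\<close> to \<open>\<i>\<close>, and it
  vanishes at real \<open>z\<close> close to \<open>0\<close>. The identity theorem carries this over to \<open>z = \<i>\<close>.\<close>

lemma defect_zero:
  assumes x: "norm x < 1"
  shows "defect x = 0"
proof -
  define a where "a = Bcontfun (\<lambda>t. complex_of_real (Re (apply_bcontfun x t)))"
  define b where "b = Bcontfun (\<lambda>t. complex_of_real (Im (apply_bcontfun x t)))"
  have a: "apply_bcontfun a t = complex_of_real (Re (apply_bcontfun x t))" for t
    unfolding a_def by (subst apply_Bcontfun) (auto intro!: continuous_intros)
  have b: "apply_bcontfun b t = complex_of_real (Im (apply_bcontfun x t))" for t
    unfolding b_def by (subst apply_Bcontfun) (auto intro!: continuous_intros)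
  have x_eq: "x = a + \<i> *\<^sub>C b"
    by (rule bcontfun_eqI) (simp add: a b apply_bcontfun_scaleC scaleC_complex_def flip: complex_eq)
  define S where "S = {z. norm (a + z *\<^sub>C b) < 1}"
  have cont: "continuous_on UNIV (\<lambda>z. a + z *\<^sub>C b)"
    by (intro continuous_intros bounded_linear.continuous_on[OF bounded_linear_scaleC_left])
  have "open S"
    unfolding S_def by (intro open_Collect_less continuous_on_norm cont continuous_on_const)
  have "norm a \<le> norm x"
    by (rule norm_bound) (metis a abs_Re_le_cmod norm_bounded norm_of_real order_trans)
  then have 0: "0 \<in> S"
    using x by (simp add: S_def)
  have "convex S"
  proof (rule convexI)
    fix z w :: complex and u v :: real
    assume zw: "z \<in> S" "w \<in> S" and uv: "0 \<le> u" "0 \<le> v" "u + v = 1"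
    have "a + (u *\<^sub>R z + v *\<^sub>R w) *\<^sub>C b = u *\<^sub>R (a + z *\<^sub>C b) + v *\<^sub>R (a + w *\<^sub>C b)"
      using uv(3) by (simp add: scaleC_add_left scaleR_add_right linear_scale[OF bounded_linear.linear[OF bounded_linear_scaleC_left]]
          scaleR_left_distrib[symmetric] add_ac flip: scaleR_add_left)
    moreover have "u *\<^sub>R (a + z *\<^sub>C b) + v *\<^sub>R (a + w *\<^sub>C b) \<in> ball 0 1"
      using zw uv by (intro convexD[OF convex_ball]) (auto simp: S_def)
    ultimately show "u *\<^sub>R z + v *\<^sub>R w \<in> S"
      by (simp add: S_def)
  qed
  have "defect (a + \<i> *\<^sub>C b) = 0"
  proof (rule analytic_continuation[of "\<lambda>z. defect (a + z *\<^sub>C b)" S "S \<inter> \<real>" 0 \<i>])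
    show "(\<lambda>z. defect (a + z *\<^sub>C b)) holomorphic_on S"
      unfolding S_def by (rule holomorphic_defect_on_line)
    show "open S" by fact
    show "connected S" using \<open>convex S\<close> by (rule convex_connected)
    show "\<i> \<in> S" using x by (simp add: S_def x_eq)
    show "0 islimpt S \<inter> \<real>"
      unfolding islimpt_approachable
    proof (intro allI impI)
      fix e :: real assume e: "0 < e"
      obtain d where d: "0 < d" "ball 0 d \<subseteq> S"
        using \<open>open S\<close> 0 by (auto simp: open_contains_ball)
      let ?z = "complex_of_real (min d e / 2)"
      have nz: "cmod ?z = min d e / 2"
        unfolding norm_of_real using d(1) e by simp
      have "?z \<in> S"
        using d nz e by (intro subsetD[OF d(2)]) (auto simp del: of_real_divide)
      moreover have "?z \<noteq> 0" "dist ?z 0 < e"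
        using nz d(1) e by (auto simp del: of_real_divide)
      ultimately show "\<exists>x'\<in>S \<inter> \<real>. x' \<noteq> 0 \<and> dist x' 0 < e"
        by (meson IntI Reals_of_real)
    qed
    fix z assume z: "z \<in> S \<inter> \<real>"
    then obtain s where s: "z = complex_of_real s"
      by (auto elim: Reals_cases)
    show "defect (a + z *\<^sub>C b) = 0"
    proof (rule defect_real)
      show "Im (apply_bcontfun (a + z *\<^sub>C b) t) = 0" for t
        by (simp add: a b s apply_bcontfun_scaleC scaleC_complex_def)
      show "norm (a + z *\<^sub>C b) < 1"
        using z by (simp add: S_def)
    qed
  qed (use 0 in auto)
  then show ?thesis
    by (simp add: x_eq)
qed

end

theorem proposition1p1:
  fixes f :: "('k :: t2_space \<Rightarrow>\<^sub>C complex) \<Rightarrow> complex"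
  assumes "compact (UNIV :: 'k set)"
    and "f \<in> holomorphic_bounded_type"
    and "orthogonally_additive f"
  shows "integral_holomorphic f"
proof -
  interpret entire_orthogonally_additive f
    using assms by unfold_locales
  obtain C where "bounded_functional weak_star_ball representing C"
    by (rule bounded_functional_representing)
  then obtain \<nu> where \<nu>: "regular_complex_borel_measure weak_star_ball \<nu>"
    "\<And>\<phi>. continuous_map weak_star_ball euclidean \<phi>
      \<Longrightarrow> complex_measure_integral (borel_of weak_star_ball) \<nu> \<phi> = representing \<phi>"
    using bounded_functional.riesz_representation by blast
  have "f x = complex_measure_integral (borel_of weak_star_ball) \<nu> (\<lambda>\<gamma>. 1 / (1 - \<gamma> x))" if "norm x < 1" for x
    using \<nu>(2)[OF continuous_map_resolvent(1)[OF that]] defect_zero[OF that]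
    by (simp add: defect_def resolvent_def[abs_def])
  moreover have "holomorphic_fun_on f (ball 0 1)"
    using holo by (simp add: holomorphic_fun_on_def)
  ultimately show ?thesis
    unfolding integral_holomorphic_def using \<nu>(1) by blast
qed

end
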